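(* Let $n\ge1$ be an integer and $p>(n-1)/2$ a real number. For every real symmetric positive definite matrix $\sigma$ of order $n$, the Fisher information $I_p(\sigma)$ at $\sigma$ of the statistical model $\{f_{p,\sigma}(x)\,dx;\ \sigma\in E_+\}$ on $\mathbb{R}^n$ is invertible with inverse $$I_p(\sigma)^{-1}=\frac{2(2p+3)}{2p+1}\left(\mathbb{P}(\sigma)+\frac{1}{2p+1-n}\,\sigma\otimes\sigma\right).$$
   Context: $E$ is the Euclidean space of real symmetric matrices of order $n$ with $\langle u,v\rangle=\operatorname{tr}(uv)$; $E_+\subset E$ is the open cone of positive definite matrices. For $u\in E$, the endomorphisms $u\otimes u$ and $\mathbb{P}(u)$ of $E$ are defined by $(u\otimes u)(v)=u\operatorname{tr}(uv)$ and $\mathbb{P}(u)(v)=uvu$. For $p>(n-1)/2$ and $\sigma\in E_+$, the Wishart distribution $\gamma_{p,\sigma}$ is the probability measure on $E_+$ characterized by $\int_{E_+}e^{-\operatorname{tr}(su)}\gamma_{p,\sigma}(du)=\det(I_n+\sigma s)^{-p}$ for all $s\in E_+$. The density $f_{p,\sigma}$ on $\mathbb{R}^n$ is that of $X$ where $U\sim\gamma_{p,\sigma}$ and $X|U\sim N(0,U^{-1})$: $$f_{p,\sigma}(x)=\frac{1}{(2\pi)^{n/2}}\int_{E_+}e^{-x^tux/2}(\det u)^{1/2}\gamma_{p,\sigma}(du),$$ and explicitly $$f_{p,\sigma}(x)=\frac{1}{(2\pi)^{n/2}}\frac{\Gamma(p+\frac12)}{\Gamma(p-\frac{n-1}{2})}\frac{(\det\sigma)^{1/2}}{(1+\frac12x^t\sigma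 x)^{p+\frac12}}.$$ The Fisher information is the endomorphism of $E$ $$I_p(\sigma)=\int_{\mathbb{R}^n}\ell_x'(\sigma)\otimes\ell_x'(\sigma)\,f_{p,\sigma}(x)\,dx,$$ where $\ell_x(\sigma)=\log f_{p,\sigma}(x)$ and $\ell_x'(\sigma)\in E$ is the gradient of $\sigma\mapsto\ell_x(\sigma)$ on $E_+$ with respect to the scalar product of $E$. It is given by $I_p(\sigma)=\frac{1}{2(2p+3)}\big((2p+1)\mathbb{P}(\sigma^{-1})-\sigma^{-1}\otimes\sigma^{-1}\big)$. *)

theory Defs
  imports "HOL-Probability.Probability"
begin

definition sym_mats :: "(real^'n^'n) set" where
  "sym_mats = {u. transpose u = u}"

definition pos_def_mats :: "(real^'n^'n) set" where
  "pos_def_mats = {u \<in> sym_mats. \<forall>x. x \<noteq> 0 \<longrightarrow> 0 < x \<bullet> (u *v x)}"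

text \<open>The endomorphisms \<open>u \<otimes> u\<close> and \<open>\<P>(u)\<close> of the space of symmetric matrices. They are
  written as functions on all square matrices and are only used on \<^const>\<open>sym_mats\<close>.\<close>

definition tensor_sq :: "real^'n^'n \<Rightarrow> real^'n^'n \<Rightarrow> real^'n^'n" where
  "tensor_sq u v = trace (u ** v) *\<^sub>R u"

definition quad_rep :: "real^'n^'n \<Rightarrow> real^'n^'n \<Rightarrow> real^'n^'n" where
  "quad_rep u v = u ** v ** u"

definition is_wishart :: "real \<Rightarrow> real^'n^'n \<Rightarrow> (real^'n^'n) measure \<Rightarrow> bool" where
  "is_wishart p \<sigma> M \<longleftrightarrow>
     prob_space M \<and> sets M = sets (restrict_space borel pos_def_mats) \<and>
     (\<forall>s \<in> pos_def_mats.
        (\<integral>u. exp (- trace (s ** u)) \<partial>M) = det (mat 1 + \<sigma> ** s) powr (- p))"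

definition wishart :: "real \<Rightarrow> real^'n^'n \<Rightarrow> (real^'n^'n) measure" where
  "wishart p \<sigma> = (THE M. is_wishart p \<sigma> M)"

text \<open>The density of \<open>X\<close> when \<open>U\<close> is Wishart distributed and \<open>X\<close> given \<open>U\<close> is centred Gaussian
  with covariance matrix the inverse of \<open>U\<close>.\<close>

definition mix_density :: "real \<Rightarrow> real^'n^'n \<Rightarrow> real^'n \<Rightarrow> real" where
  "mix_density p \<sigma> x =
     1 / (2 * pi) powr (real CARD('n) / 2) *
     (\<integral>u. exp (- (x \<bullet> (u *v x)) / 2) * sqrt (det u) \<partial>wishart p \<sigma>)"

text \<open>The gradient for the scalar product \<open>tr (u v)\<close> of a function on the positive definite
  matrices, which are open in \<^const>\<open>sym_mats\<close> but not among all square matrices: the derivative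
  is taken within this cone, and requiring the gradient to be symmetric makes it unique.\<close>

definition sym_gradient :: "(real^'n^'n \<Rightarrow> real) \<Rightarrow> real^'n^'n \<Rightarrow> real^'n^'n" where
  "sym_gradient \<phi> \<sigma> =
     (THE g. g \<in> sym_mats \<and>
        (\<phi> has_derivative (\<lambda>h. trace (g ** h))) (at \<sigma> within pos_def_mats))"

text \<open>The Fisher information at \<open>\<sigma>\<close> of the model with densities \<open>f \<sigma>\<close>, as an endomorphism of
  \<^const>\<open>sym_mats\<close>; the operator-valued integral is evaluated at the argument \<open>v\<close>.\<close>

definition fisher_information ::
  "(real^'n^'n \<Rightarrow> real^'n \<Rightarrow> real) \<Rightarrow> real^'n^'n \<Rightarrow> real^'n^'n \<Rightarrow> real^'n^'n" where
  "fisher_information f \<sigma> v =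
     (\<integral>x. f \<sigma> x *\<^sub>R tensor_sq (sym_gradient (\<lambda>\<tau>. ln (f \<tau> x)) \<sigma>) v \<partial>lborel)"

end

theory Submission
  imports Defs
begin

text \<open>
  With respect to the density \<open>\<bar>det X\<bar> powr (2p - n) * exp (- tr (s X\<^sup>T X))\<close> on all square matrices
  \<open>X\<close>, the matrix \<open>X\<^sup>T X\<close> has, up to normalisation, the Wishart distribution \<open>\<gamma>\<^bsub>p, s\<^sup>-\<^sup>1\<^esub>\<close>: the
  substitution \<open>X \<mapsto> X B\<^sup>T\<close> with \<open>B\<^sup>T s B = 1\<close> shows that the total mass is a constant times
  \<open>det s powr (- p)\<close>, and the density is integrable precisely for \<open>2p - n > -1\<close>. The same integral
  with \<open>p + 1/2\<close> for \<open>p\<close> gives the mixture density in closed form. That the Laplace transform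
  determines a probability measure on the cone follows from the Weierstrass theorem after embedding the
  cone into a cube by finitely many functions \<open>exp (- tr (s u))\<close>.

  The score is \<open>\<sigma>\<^sup>-\<^sup>1 / 2 - (p + 1/2) / 2 * x x\<^sup>T / (1 + x\<^sup>T \<sigma> x / 2)\<close>. Substituting \<open>x = B y\<close> with
  \<open>B\<^sup>T \<sigma> B = 1\<close> reduces its second moment to \<open>\<sigma> = 1\<close>, where the moments of \<open>(1 + \<bar>y\<bar>\<^sup>2 / 2) powr (- q)\<close>
  are computed by writing this function as a Gamma mixture of Gaussians.
\<close>

section \<open>Positive definite matrices and determinants\<close>

text \<open>Integrating over all square matrices \<open>X\<close> avoids any Jacobian of the map to
  X^T X and any integration over the cone. The price is a singularity on det X = 0 when p < n/2,
  where the exponent 2p - n lies between -1 and 0; it is removed one row at a time by averaging over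
  a single entry. Since \<open>wishart\<close> is a definite description, existence and uniqueness
  must both be settled before anything about \<open>mix_density\<close> can be computed. The
  normalising constants of the Wishart laws are never evaluated. Only their ratio at p + 1/2 and p
  enters the mixture density, and that ratio is read off from the total mass 1. In the score every
  product y_i y_j comes with a factor 1/(1 + |y|^2/2). Each such factor raises the exponent q by
  exactly what the degree 2 costs, so all required moments exist for every admissible p, and only
  ratios of Gamma values based at p + 1/2 remain. They yield 1/(p + 1/2) and 1/((p + 1/2)(p + 3/2)),
  the origin of 2p + 1 and 2p + 3. The term 2p + 1 - n appears only on inversion, because
  tr(\<sigma>^-1 \<sigma>) = n.\<close>

lemma matrix_add_rdistrib: "((A::real^'n^'m) + B) ** C = A ** C + B ** C"
  by (simp add: vec_eq_iff matrix_matrix_mult_def sum.distrib distrib_right)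

lemma matrix_diff_rdistrib: "((A::real^'n^'m) - B) ** C = A ** C - B ** C"
  by (simp add: vec_eq_iff matrix_matrix_mult_def sum_subtractf left_diff_distrib)

lemma matrix_diff_ldistrib: "(A::real^'n^'m) ** (B - C) = A ** B - A ** C"
  by (simp add: vec_eq_iff matrix_matrix_mult_def sum_subtractf right_diff_distrib)

lemma matrix_mult_scaleR_left: "(c *\<^sub>R (A::real^'n^'m)) ** B = c *\<^sub>R (A ** B)"
  by (simp add: scalar_matrix_assoc)

lemma matrix_mult_scaleR_right: "(A::real^'n^'m) ** (c *\<^sub>R B) = c *\<^sub>R (A ** B)"
  by (simp add: matrix_scalar_ac scalar_matrix_assoc)

lemma scaleR_matrix_vector: "(c *\<^sub>R (u::real^'n^'m)) *v x = c *\<^sub>R (u *v x)"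
  by (simp add: scaleR_matrix_vector_assoc)

definition outer :: "real^'n \<Rightarrow> real^'n^'n" where
  "outer x = (\<chi> i j. x$i * x$j)"

lemma outer_mult_vec: "outer x *v z = (x \<bullet> z) *\<^sub>R x"
  by (simp add: vec_eq_iff outer_def matrix_vector_mult_def inner_vec_def sum_distrib_left
      sum_distrib_right algebra_simps)

lemma outer_in_sym_mats: "outer x \<in> sym_mats"
  by (simp add: sym_mats_def outer_def transpose_def vec_eq_iff mult.commute)

lemma trace_outer_mult: "trace (outer x ** v) = x \<bullet> (v *v x)"
proof -
  have "trace (outer x ** v) = (\<Sum>i\<in>UNIV. \<Sum>k\<in>UNIV. x$i * x$k * v$k$i)"
    by (simp add: trace_def matrix_matrix_mult_def outer_def)
  also have "\<dots> = (\<Sum>k\<in>UNIV. \<Sum>i\<in>UNIV. x$i * x$k * v$k$i)" by (rule sum.swap)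
  also have "\<dots> = x \<bullet> (v *v x)"
    by (simp add: inner_vec_def matrix_vector_mult_def sum_distrib_left algebra_simps)
  finally show ?thesis .
qed

lemma congruence_outer: "B ** outer x ** transpose B = outer (B *v x)"
proof -
  have "(B ** outer x ** transpose B) $ i $ j = outer (B *v x) $ i $ j" for i j
  proof -
    have "(B ** outer x ** transpose B) $ i $ j = (\<Sum>k\<in>UNIV. (\<Sum>l\<in>UNIV. B$i$l * (x$l * x$k)) * B$j$k)"
      by (simp add: matrix_matrix_mult_def outer_def transpose_def)
    also have "\<dots> = (\<Sum>l\<in>UNIV. B$i$l * x$l) * (\<Sum>k\<in>UNIV. B$j$k * x$k)"
      unfolding sum_product sum_distrib_right sum_distrib_left
by (simp add: mult_ac)
    finally show ?thesis by (simp add: outer_def matrix_vector_mult_def)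
  qed
  then show ?thesis by (simp add: vec_eq_iff)
qed

lemma sym_mats_inner_commute:
  assumes "u \<in> sym_mats" shows "x \<bullet> (u *v y) = y \<bullet> (u *v x)"
proof -
  have "x \<bullet> (u *v y) = (x v* u) \<bullet> y" by (simp add: dot_lmul_matrix)
  also have "x v* u = transpose u *v x" by simp
  also have "transpose u = u" using assms by (simp add: sym_mats_def)
  finally show ?thesis by (simp add: inner_commute)
qed

text \<open>Polarization: the difference is symmetric and its quadratic form vanishes, hence so does
  its bilinear form. This makes the matrices \<open>outer x\<close> sufficient as test directions
  for a symmetric gradient.\<close>

lemma sym_mats_eqI:
  assumes g: "g \<in> sym_mats" "g' \<in> sym_mats" and eq: "\<And>x. x \<bullet> (g *v x) = x \<bullet> (g' *v x)"
  shows "g = g'"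
proof -
  define d where "d = g - g'"
  have d: "d \<in> sym_mats" using g by (simp add: d_def sym_mats_def transpose_def vec_eq_iff)
  have q: "x \<bullet> (d *v x) = 0" for x
    using eq[of x] by (simp add: d_def matrix_vector_mult_diff_rdistrib inner_diff_right)
  have "x \<bullet> (d *v y) = 0" for x y
  proof -
    have "(x + y) \<bullet> (d *v (x + y)) = x \<bullet> (d *v x) + y \<bullet> (d *v y) + x \<bullet> (d *v y) + y \<bullet> (d *v x)"
      by (simp add: matrix_vector_right_distrib inner_add_left inner_add_right)
    then show ?thesis using q sym_mats_inner_commute[OF d, of x y] by simp
  qed
  then have "d *v y = 0" for y using inner_eq_zero_iff by blast
  then have "d = 0" by (simp add: matrix_eq)
  then show ?thesis by (simp add: d_def)
qed

lemma pos_def_mats_sym: "u \<in> pos_def_mats \<Longrightarrow> u \<in> sym_mats"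
  by (simp add: pos_def_mats_def)

lemma pos_def_mats_pos: "u \<in> pos_def_mats \<Longrightarrow> x \<noteq> 0 \<Longrightarrow> 0 < x \<bullet> (u *v x)"
  by (simp add: pos_def_mats_def)

lemma mat_1_pos_def: "(mat 1 :: real^'n^'n) \<in> pos_def_mats"
  by (simp add: pos_def_mats_def sym_mats_def transpose_mat)

lemma pos_def_mats_nonneg: "u \<in> pos_def_mats \<Longrightarrow> 0 \<le> x \<bullet> (u *v x)"
  using pos_def_mats_pos[of u x] by (cases "x = 0") auto

lemma pos_def_mats_add:
  "u \<in> pos_def_mats \<Longrightarrow> w \<in> pos_def_mats \<Longrightarrow> u + w \<in> pos_def_mats"
  by (auto simp: pos_def_mats_def sym_mats_def transpose_def vec_eq_iff
      matrix_vector_mult_add_rdistrib inner_add_right add_pos_pos)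

lemma inner_outer: "y \<bullet> (outer x *v y) = (x \<bullet> y)\<^sup>2"
  by (simp add: outer_mult_vec power2_eq_square inner_commute)

lemma pos_def_mats_add_outer:
  assumes "u \<in> pos_def_mats" "0 \<le> t" shows "u + t *\<^sub>R outer x \<in> pos_def_mats"
proof -
  have "u + t *\<^sub>R outer x \<in> sym_mats"
    using pos_def_mats_sym[OF assms(1)] outer_in_sym_mats[of x]
    by (simp add: sym_mats_def transpose_def vec_eq_iff)
  moreover have "0 < y \<bullet> ((u + t *\<^sub>R outer x) *v y)" if "y \<noteq> 0" for y
    using pos_def_mats_pos[OF assms(1) that] assms(2)
    by (simp add: matrix_vector_mult_add_rdistrib inner_add_right scaleR_matrix_vector inner_outer
        add_pos_nonneg)
  ultimately show ?thesis by (simp add: pos_def_mats_def)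
qed

lemma inner_transpose_mult: "x \<bullet> (transpose B *v y) = (B *v x) \<bullet> (y::real^'n)"
  by (metis dot_lmul_matrix transpose_matrix_vector transpose_transpose)

lemma gram_in_pos_def_mats:
  fixes X :: "real^'n^'n"
  assumes "det X \<noteq> 0" shows "transpose X ** X \<in> pos_def_mats"
proof -
  have "X *v x \<noteq> 0" if "x \<noteq> 0" for x
    using assms that
    by (metis invertible_det_nz inj_matrix_vector_mult injD matrix_vector_mult_0_right)
  then show ?thesis
    by (simp add: pos_def_mats_def sym_mats_def matrix_transpose_mul
        flip: matrix_vector_mul_assoc)
      (simp add: inner_transpose_mult del: transpose_matrix_vector flip: transpose_matrix_vector)
qed

text \<open>Gram-Schmidt for the inner product x^T u y, adding one index at a time. A new vector is
  available because fewer than n vectors cannot span the space.\<close>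

lemma pos_def_orthonormal_family:
  fixes u :: "real^'n^'n" and S :: "'n set"
  assumes u: "u \<in> pos_def_mats" and "finite S"
  shows "\<exists>v::'n \<Rightarrow> real^'n. \<forall>i\<in>S. \<forall>j\<in>S. v i \<bullet> (u *v v j) = (if i = j then 1 else 0)"
  using \<open>finite S\<close>
proof (induction S rule: finite_induct)
  case empty
  then show ?case by simp
next
  case (insert k F)
  then obtain v where v: "\<And>i j. i \<in> F \<Longrightarrow> j \<in> F \<Longrightarrow> v i \<bullet> (u *v v j) = (if i = j then 1 else 0)"
    by blast
  have "dim (v ` F) \<le> card (v ` F)" by (rule dim_le_card') (use insert in auto)
  also have "\<dots> \<le> card F" using insert by (auto intro: card_image_le)
  also have "\<dots> < CARD('n)" using insert by (intro psubset_card_mono) auto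
  finally have "span (v ` F) \<noteq> UNIV" by (metis dim_UNIV dim_span DIM_cart DIM_real mult.right_neutral less_irrefl)
  then obtain w where w: "w \<notin> span (v ` F)" by blast
  define z where "z = w - (\<Sum>i\<in>F. (v i \<bullet> (u *v w)) *\<^sub>R v i)"
  have "z \<noteq> 0"
  proof
    assume "z = 0"
    then have "w = (\<Sum>i\<in>F. (v i \<bullet> (u *v w)) *\<^sub>R v i)" by (simp add: z_def)
    also have "\<dots> \<in> span (v ` F)" by (intro span_sum span_scale span_base) auto
    finally show False using w by simp
  qed
  then have c: "0 < z \<bullet> (u *v z)" using u by (rule pos_def_mats_pos[rotated])
  have orth: "v j \<bullet> (u *v z) = 0" if "j \<in> F" for j
  proof -
    have "v j \<bullet> (u *v z) = v j \<bullet> (u *v w) - (\<Sum>i\<in>F. (v i \<bullet> (u *v w)) * (v j \<bullet> (u *v v i)))"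
      by (simp add: z_def matrix_vector_mult_diff_distrib inner_diff_right inner_sum_right
          linear_sum[OF matrix_vector_mul_linear] matrix_vector_mult_scaleR)
    also have "(\<Sum>i\<in>F. (v i \<bullet> (u *v w)) * (v j \<bullet> (u *v v i)))
        = (\<Sum>i\<in>F. if j = i then v i \<bullet> (u *v w) else 0)"
      using that v by (intro sum.cong) auto
    finally show ?thesis using that insert by simp
  qed
  define v' where "v' = v(k := (1 / sqrt (z \<bullet> (u *v z))) *\<^sub>R z)"
  have "v' i \<bullet> (u *v v' j) = (if i = j then 1 else 0)" if "i \<in> insert k F" "j \<in> insert k F" for i j
  proof -
    have orth': "z \<bullet> (u *v v j) = 0" if "j \<in> F" for j
      using orth[OF that] sym_mats_inner_commute[OF pos_def_mats_sym[OF u], of z "v j"] by simp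
    have F: "i \<noteq> k \<Longrightarrow> i \<in> F" "j \<noteq> k \<Longrightarrow> j \<in> F" using that by auto
    show ?thesis
    proof (cases "i = k")
      case True
      then show ?thesis
      using F c orth' by (cases "j = k") (simp_all add: v'_def matrix_vector_mult_scaleR)
    next
      case False
      then show ?thesis
      using F v orth by (cases "j = k") (simp_all add: v'_def matrix_vector_mult_scaleR)
    qed
  qed
  then show ?case by blast
qed

text \<open>The columns of \<open>B\<close> form a basis orthonormal for x^T u y. This
  \<open>B\<close> takes the place of an inverse square root of \<open>u\<close> in every reduction
  to the identity matrix, so no spectral theorem is involved.\<close>

lemma pos_def_congruent_identity:
  fixes u :: "real^'n^'n"
  assumes u: "u \<in> pos_def_mats"
  obtains B where "transpose B ** u ** B = mat 1" "det B \<noteq> 0" "(det B)\<^sup>2 * det u = 1"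
    "\<And>y. (B *v y) \<bullet> (u *v (B *v y)) = y \<bullet> y"
proof -
  obtain v :: "'n \<Rightarrow> real^'n" where v: "\<And>i j. v i \<bullet> (u *v v j) = (if i = j then 1 else 0)"
    using pos_def_orthonormal_family[OF u, of UNIV] by auto
  define B where "B = (\<chi> i j. v j $ i)"
  have "(transpose B ** u ** B) $ i $ j = v i \<bullet> (u *v v j)" for i j
    by (simp add: matrix_mul_assoc[symmetric])
       (simp add: B_def matrix_matrix_mult_def transpose_def inner_vec_def matrix_vector_mult_def)
  then have 1: "transpose B ** u ** B = mat 1" using v by (simp add: vec_eq_iff mat_def)
  then have "det (transpose B ** u ** B) = 1" by simp
  then have 2: "(det B)\<^sup>2 * det u = 1" by (simp add: det_mul det_transpose power2_eq_square algebra_simps)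
  have 3: "(B *v y) \<bullet> (u *v (B *v y)) = y \<bullet> y" for y
  proof -
    have "y \<bullet> ((transpose B ** u ** B) *v y) = (B *v y) \<bullet> (u *v (B *v y))"
      by (simp flip: matrix_vector_mul_assoc add: inner_transpose_mult del: transpose_matrix_vector)
    then show ?thesis by (simp add: 1)
  qed
  show ?thesis by (rule that[of B]) (use 1 2 3 in auto)
qed

lemma det_pos_def:
  fixes u :: "real^'n^'n"
  assumes "u \<in> pos_def_mats" shows "0 < det u"
proof -
  obtain B :: "real^'n^'n" where "det B \<noteq> 0" "(det B)\<^sup>2 * det u = 1" 
    by (rule pos_def_congruent_identity[OF assms]) blast
  then show ?thesis by (metis zero_less_mult_pos zero_less_one zero_less_power2)
qed

text \<open>From B^T u B = 1 it follows that B B^T is inverse to \<open>u\<close>, and it is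
  positive definite as the Gram matrix of B^T.\<close>

lemma pos_def_inverse:
  assumes "u \<in> pos_def_mats"
  obtains w where "w \<in> pos_def_mats" "u ** w = mat 1" "w ** u = mat 1"
proof -
  obtain B where B: "transpose B ** u ** B = mat 1" "det B \<noteq> 0"
    using pos_def_congruent_identity[OF assms] by metis
  define w where "w = B ** transpose B"
  have "w \<in> pos_def_mats" using gram_in_pos_def_mats[of "transpose B"] B by (simp add: w_def det_transpose)
  moreover have "B ** (transpose B ** u) = mat 1" using B(1) matrix_left_right_inverse by blast
  then have "w ** u = mat 1" by (simp add: w_def matrix_mul_assoc)
  moreover then have "u ** w = mat 1" using matrix_left_right_inverse by blast
  ultimately show ?thesis using that by blast
qed

text \<open>A rotation taking \<open>y\<close> to a multiple of a basis vector makes the matrix diagonal.\<close>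

lemma det_identity_add_outer: "det (mat 1 + c *\<^sub>R outer (y::real^'n)) = 1 + c * (y \<bullet> y)"
proof -
  fix k :: 'n
  have "norm (norm y *\<^sub>R axis k (1::real)) = norm y" by simp
  then obtain f :: "real^'n \<Rightarrow> real^'n" where f: "orthogonal_transformation f" "f y = norm y *\<^sub>R axis k 1"
    
    by (rule orthogonal_transformation_exists[OF sym]) blast
  define Q where "Q = matrix f"
  have Q: "orthogonal_matrix Q" "Q *v y = norm y *\<^sub>R axis k 1"
    using f orthogonal_transformation_matrix[of f]
    by (auto simp: Q_def matrix_works orthogonal_transformation_linear)
  then have QQ: "Q ** transpose Q = mat 1" by (simp add: orthogonal_matrix_def)
  have "Q ** (mat 1 + c *\<^sub>R outer y) ** transpose Q = mat 1 + c *\<^sub>R outer (Q *v y)"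
    by (simp add: matrix_add_ldistrib matrix_add_rdistrib matrix_mult_scaleR_left matrix_mult_scaleR_right QQ
        congruence_outer)
  then have "det (Q ** (mat 1 + c *\<^sub>R outer y) ** transpose Q) = det (mat 1 + c *\<^sub>R outer (Q *v y))"
    by simp
  moreover have "det (Q ** (mat 1 + c *\<^sub>R outer y) ** transpose Q) = det (mat 1 + c *\<^sub>R outer y)"
    using arg_cong[OF QQ, of det] by (simp add: det_mul det_transpose)
  moreover have "det (mat 1 + c *\<^sub>R outer (Q *v y)) =
      (\<Prod>i\<in>UNIV. (mat 1 + c *\<^sub>R outer (Q *v y)) $ i $ i)"
    by (rule det_diagonal) (auto simp: Q outer_def mat_def axis_def)
  moreover have "\<dots> = (\<Prod>i\<in>UNIV. if i = k then 1 + c * (y \<bullet> y) else 1)"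
    by (rule prod.cong) (auto simp: Q outer_def mat_def axis_def dot_square_norm power2_eq_square)
  ultimately show ?thesis by simp
qed

text \<open>Congruence by \<open>B\<close> with B^T w B = 1 reduces this to the rank-one update of
  the identity by the vector B^T x, whose squared length is x^T B B^T x with B B^T = w^-1 =
  \<open>u\<close>.\<close>

lemma det_pos_def_add_outer:
  fixes u w :: "real^'n^'n"
  assumes w: "w \<in> pos_def_mats" and inv: "u ** w = mat 1"
  shows "det (w + c *\<^sub>R outer x) = det w * (1 + c * (x \<bullet> (u *v x)))"
proof -
  obtain B where B: "transpose B ** w ** B = mat 1" "det B \<noteq> 0" "(det B)\<^sup>2 * det w = 1"
    using pos_def_congruent_identity[OF w] by metis
  have "transpose B ** (w + c *\<^sub>R outer x) ** B = mat 1 + c *\<^sub>R outer (transpose B *v x)"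
    using congruence_outer[of "transpose B" x] B(1)
    by (simp add: matrix_add_ldistrib matrix_add_rdistrib matrix_mult_scaleR_left matrix_mult_scaleR_right)
  then have "det (transpose B ** (w + c *\<^sub>R outer x) ** B) = det (mat 1 + c *\<^sub>R outer (transpose B *v x))"
    by (rule arg_cong)
  then have "(det B)\<^sup>2 * det (w + c *\<^sub>R outer x) = 1 + c * ((transpose B *v x) \<bullet> (transpose B *v x))"
    by (simp add: det_identity_add_outer det_mul power2_eq_square mult_ac del: transpose_matrix_vector)
  moreover have "(transpose B *v x) \<bullet> (transpose B *v x) = x \<bullet> ((B ** transpose B) *v x)"
    by (metis inner_commute inner_transpose_mult matrix_vector_mul_assoc)
  moreover have "B ** transpose B = u"
  proof -
    have "B ** (transpose B ** w) = mat 1" using B(1) matrix_left_right_inverse by blast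
    then show ?thesis using inv by (metis matrix_left_right_inverse matrix_mul_assoc matrix_mul_lid matrix_mul_rid)
  qed
  ultimately have "(det B)\<^sup>2 * det (w + c *\<^sub>R outer x) = 1 + c * (x \<bullet> (u *v x))" by simp
  then show ?thesis using B(2,3) by (metis mult.assoc mult.commute mult.left_neutral)
qed

section \<open>The derivative of the determinant\<close>

text \<open>In the differentiated Leibniz sum only the identity permutation survives. Any other
  permutation moves at least two points, so after one factor is differentiated another off-diagonal
  entry of the identity, a zero, is left.\<close>

lemma det_has_derivative_at_identity:
  "((det :: real^'n^'n \<Rightarrow> real) has_derivative trace) (at (mat 1) within S)"
proof -
  have "((\<lambda>A::real^'n^'n. \<Sum>\<pi> | \<pi> permutes UNIV. of_int (sign \<pi>) * (\<Prod>i\<in>UNIV. A $ i $ \<pi> i)) has_derivative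
     (\<lambda>h. \<Sum>\<pi> | \<pi> permutes UNIV. of_int (sign \<pi>) *
        (\<Sum>i\<in>UNIV. h $ i $ \<pi> i * (\<Prod>j\<in>UNIV - {i}. (mat 1 :: real^'n^'n) $ j $ \<pi> j)))) (at (mat 1) within S)"
    by (auto intro!: derivative_eq_intros has_derivative_prod
        bounded_linear.has_derivative[OF bounded_linear_vec_nth] simp: mult.commute)
  moreover have "(\<Sum>\<pi> | \<pi> permutes UNIV. of_int (sign \<pi>) *
        (\<Sum>i\<in>UNIV. h $ i $ \<pi> i * (\<Prod>j\<in>UNIV - {i}. (mat 1 :: real^'n^'n) $ j $ \<pi> j))) = trace h"
    for h :: "real^'n^'n"
  proof -
    have zero: "(\<Prod>j\<in>UNIV - {i}. (mat 1 :: real^'n^'n) $ j $ \<pi> j) = 0"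
      if "\<pi> permutes UNIV" "\<pi> \<noteq> id" for \<pi> :: "'n \<Rightarrow> 'n" and i
    proof -
      have "\<exists>j. j \<noteq> i \<and> \<pi> j \<noteq> j"
      proof (rule ccontr)
        assume a: "\<not> (\<exists>j. j \<noteq> i \<and> \<pi> j \<noteq> j)"
        then have "\<pi> i = i" using permutes_inj[OF that(1)] by (metis injD)
        then show False using a that(2) by (metis eq_id_iff)
      qed
      then show ?thesis by (auto simp: mat_def intro!: prod_zero bexI)
    qed
    have "(\<Sum>\<pi> | \<pi> permutes UNIV. of_int (sign \<pi>) *
        (\<Sum>i\<in>UNIV. h $ i $ \<pi> i * (\<Prod>j\<in>UNIV - {i}. (mat 1 :: real^'n^'n) $ j $ \<pi> j)))
      = (\<Sum>\<pi>\<in>{id}. of_int (sign \<pi>) *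
        (\<Sum>i\<in>UNIV. h $ i $ \<pi> i * (\<Prod>j\<in>UNIV - {i}. (mat 1 :: real^'n^'n) $ j $ \<pi> j)))"
      by (rule sum.mono_neutral_right) (auto simp: zero permutes_id)
    also have "\<dots> = trace h" by (simp add: trace_def mat_def sign_id)
    finally show ?thesis .
  qed
  ultimately show ?thesis by (simp add: det_def[abs_def])
qed

lemma bounded_linear_matrix_mult: "bounded_linear (\<lambda>h::real^'n^'n. (w::real^'n^'n) ** h)"
  by (auto intro!: linear_conv_bounded_linear[THEN iffD1] linearI simp: matrix_add_ldistrib matrix_mult_scaleR_right)

text \<open>Jacobi's formula: the factorization det h = det u * det(w h) moves the base point to the
  identity, so cofactors are avoided.\<close>

lemma det_has_derivative:
  fixes u w :: "real^'n^'n"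
  assumes inv: "u ** w = mat 1" "w ** u = mat 1"
  shows "(det has_derivative (\<lambda>h. det u * trace (w ** h))) (at u within S)"
proof -
  have "((\<lambda>h. det (w ** h)) has_derivative (\<lambda>h. trace (w ** h))) (at u within S)"
    using has_derivative_compose[OF bounded_linear.has_derivative[OF bounded_linear_matrix_mult has_derivative_ident],
        of det trace w u S] det_has_derivative_at_identity[of UNIV]
    by (simp add: inv)
  then have "((\<lambda>h. det u * det (w ** h)) has_derivative (\<lambda>h. det u * trace (w ** h))) (at u within S)"
    by (rule has_derivative_mult_right)
  moreover have "det u * det (w ** h) = det h" for h
    by (metis det_mul inv(1) matrix_mul_assoc matrix_mul_lid)
  ultimately show ?thesis by simp
qed

section \<open>Linear change of variables\<close>

text \<open>A matrix is integrated as the family of its rows, so that a map acting on each row, or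
  on one row only, is handled by product measure theory. The value type is general because both uses
  occur: real coordinates of a vector, and vectors as rows of a matrix.\<close>

definition lborel_fun :: "('n::finite \<Rightarrow> 'b::euclidean_space) measure" where
  "lborel_fun = Pi\<^sub>M UNIV (\<lambda>_. lborel)"

lemma product_sigma_finite_lborel: "product_sigma_finite (\<lambda>_. lborel)"
  by standard

lemma sets_lborel_fun: "sets lborel_fun = sets (Pi\<^sub>M UNIV (\<lambda>_. borel))"
  unfolding lborel_fun_def by (rule sets_PiM_cong) auto

lemma space_lborel_fun [simp]: "space lborel_fun = UNIV"
  by (auto simp: lborel_fun_def space_PiM)

lemma measurable_lborel_fun_component [measurable (raw)]: "(\<lambda>\<omega>. \<omega> i) \<in> lborel_fun \<rightarrow>\<^sub>M borel"
  unfolding lborel_fun_def by measurable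

lemma sigma_finite_lborel_fun: "sigma_finite_measure lborel_fun"
  unfolding lborel_fun_def
  by (rule product_sigma_finite.sigma_finite[OF product_sigma_finite_lborel]) simp

lemma lborel_fun_eqI:
  fixes P :: "('n::finite \<Rightarrow> 'b::euclidean_space) measure"
  assumes "sets P = sets lborel_fun"
    and "\<And>A. (\<And>i. A i \<in> sets borel) \<Longrightarrow> emeasure P (Pi\<^sub>E UNIV A) = (\<Prod>i\<in>UNIV. emeasure lborel (A i))"
  shows "P = lborel_fun"
  unfolding lborel_fun_def
  by (rule product_sigma_finite.PiM_eqI[OF product_sigma_finite_lborel])
     (use assms in \<open>auto simp: lborel_fun_def\<close>)

lemma emeasure_lborel_fun_box:
  assumes "\<And>i. A i \<in> sets borel"
  shows "emeasure lborel_fun (Pi\<^sub>E UNIV A) = (\<Prod>i\<in>UNIV. emeasure lborel (A i))"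
  unfolding lborel_fun_def
  by (rule product_sigma_finite.emeasure_PiM[OF product_sigma_finite_lborel]) (use assms in auto)

lemma sets_lborel_fun_box:
  assumes "\<And>i. A i \<in> sets borel" shows "Pi\<^sub>E UNIV A \<in> sets lborel_fun"
  unfolding lborel_fun_def using assms by (intro sets_PiM_I_finite) auto

lemma nn_integral_lborel_fun_prod:
  assumes "\<And>i. f i \<in> borel_measurable borel"
  shows "(\<integral>\<^sup>+\<omega>. (\<Prod>i\<in>UNIV. f i (\<omega> i)) \<partial>lborel_fun) = (\<Prod>i\<in>UNIV. \<integral>\<^sup>+x. f i x \<partial>lborel)"
  unfolding lborel_fun_def
  by (rule product_sigma_finite.product_nn_integral_prod[OF product_sigma_finite_lborel])
     (use assms in auto)

lemma measurable_lborel_funI: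
  assumes "\<And>i. (\<lambda>x. f x i) \<in> M \<rightarrow>\<^sub>M borel"
  shows "f \<in> M \<rightarrow>\<^sub>M lborel_fun"
proof -
  have "(\<lambda>x i. f x i) \<in> M \<rightarrow>\<^sub>M Pi\<^sub>M UNIV (\<lambda>_. borel)"
    using assms by (intro measurable_PiM_single') auto
  then show ?thesis by (simp cong: measurable_cong_sets add: sets_lborel_fun)
qed

text \<open>A product measure is determined by its values on boxes, and there the constant Jacobians
  \<open>c i\<close> multiply. It serves for the same linear map on every row and for a translation
  of a single row.\<close>

lemma lborel_fun_eq_density_componentwise:
  fixes g :: "'n::finite \<Rightarrow> 'b::euclidean_space \<Rightarrow> 'b"
  assumes g_meas: "\<And>i. g i \<in> borel \<rightarrow>\<^sub>M borel"
    and g: "\<And>i. lborel = density (distr lborel borel (g i)) (\<lambda>_. c i)"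
  shows "density (distr lborel_fun lborel_fun (\<lambda>\<omega> i. g i (\<omega> i))) (\<lambda>_. \<Prod>i\<in>UNIV. c i) = lborel_fun"
    (is "?D = _")
proof (rule lborel_fun_eqI)
  have meas: "(\<lambda>\<omega> i. g i (\<omega> i)) \<in> lborel_fun \<rightarrow>\<^sub>M lborel_fun"
    by (intro measurable_lborel_funI measurable_compose[OF _ g_meas]) simp
  fix A :: "'n \<Rightarrow> 'b set" assume A: "\<And>i. A i \<in> sets borel"
  have A': "g i -` A i \<in> sets borel" for i
    using measurable_sets[OF g_meas A[of i]] by simp
  have c: "c i * emeasure lborel (g i -` A i) = emeasure lborel (A i)" for i
    using arg_cong[OF g[of i], of "\<lambda>M. emeasure M (A i)"] A[of i] g_meas[of i]
    by (simp add: emeasure_density_const emeasure_distr)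
  have "?D (Pi\<^sub>E UNIV A) = (\<Prod>i\<in>UNIV. c i) * lborel_fun ((\<lambda>\<omega> i. g i (\<omega> i)) -` Pi\<^sub>E UNIV A)"
    using sets_lborel_fun_box[of A, OF A] by (simp add: emeasure_density_const emeasure_distr[OF meas])
  also have "(\<lambda>\<omega> i. g i (\<omega> i)) -` Pi\<^sub>E UNIV A = Pi\<^sub>E UNIV (\<lambda>i. g i -` A i)"
    by (auto simp: PiE_def Pi_def)
  also have "(\<Prod>i\<in>UNIV. c i) * lborel_fun \<dots> = (\<Prod>i\<in>UNIV. emeasure lborel (A i))"
    by (simp add: emeasure_lborel_fun_box[of "\<lambda>i. g i -` A i", OF A'] c flip: prod.distrib)
  finally show "?D (Pi\<^sub>E UNIV A) = (\<Prod>i\<in>UNIV. emeasure lborel (A i))" .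
qed simp

lemma nn_integral_lborel_fun_componentwise:
  fixes g :: "'n::finite \<Rightarrow> 'b::euclidean_space \<Rightarrow> 'b"
  assumes g_meas: "\<And>i. g i \<in> borel \<rightarrow>\<^sub>M borel"
    and g: "\<And>i. lborel = density (distr lborel borel (g i)) (\<lambda>_. c i)"
    and [measurable]: "f \<in> borel_measurable lborel_fun"
  shows "(\<integral>\<^sup>+\<omega>. f \<omega> \<partial>lborel_fun) = (\<Prod>i\<in>UNIV. c i) * (\<integral>\<^sup>+\<omega>. f (\<lambda>i. g i (\<omega> i)) \<partial>lborel_fun)"
proof -
  have meas [measurable]: "(\<lambda>\<omega> i. g i (\<omega> i)) \<in> lborel_fun \<rightarrow>\<^sub>M lborel_fun"
    by (intro measurable_lborel_funI measurable_compose[OF _ g_meas]) simp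
  have "(\<integral>\<^sup>+\<omega>. f \<omega> \<partial>lborel_fun) =
    (\<integral>\<^sup>+\<omega>. f \<omega> \<partial>density (distr lborel_fun lborel_fun (\<lambda>\<omega> i. g i (\<omega> i))) (\<lambda>_. \<Prod>i\<in>UNIV. c i))"
    by (simp only: lborel_fun_eq_density_componentwise[OF g_meas g])
  also have "\<dots> = (\<Prod>i\<in>UNIV. c i) * (\<integral>\<^sup>+\<omega>. f (\<lambda>i. g i (\<omega> i)) \<partial>lborel_fun)"
    by (subst nn_integral_density, simp, simp, subst nn_integral_cmult, simp, subst nn_integral_distr[OF meas])
       simp_all
  finally show ?thesis .
qed

lemma borel_measurable_vecI:
  fixes f :: "'a \<Rightarrow> ('b::euclidean_space)^'n"
  assumes "\<And>i. (\<lambda>x. f x $ i) \<in> borel_measurable M"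
  shows "f \<in> borel_measurable M"
proof (subst borel_measurable_euclidean_space, intro ballI)
  fix b :: "'b^'n" assume "b \<in> Basis"
  then obtain i v where b: "b = axis i v" "v \<in> Basis" by (auto simp: Basis_vec_def)
  have [measurable]: "(\<lambda>x. f x $ i) \<in> borel_measurable M" by (rule assms)
  show "(\<lambda>x. f x \<bullet> b) \<in> borel_measurable M" by (simp add: b inner_axis)
qed

lemma measurable_vec_lambda [measurable]: "vec_lambda \<in> lborel_fun \<rightarrow>\<^sub>M borel"
  by (rule borel_measurable_vecI) simp

lemma lborel_eq_distr_vec_lambda:
  "lborel = distr lborel_fun borel (vec_lambda :: ('n::finite \<Rightarrow> real) \<Rightarrow> real^'n)"
proof (rule lborel_eqI)
  fix l u :: "real^'n" assume lu: "\<And>b. b \<in> Basis \<Longrightarrow> l \<bullet> b \<le> u \<bullet> b"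
  have le: "l $ i \<le> u $ i" for i using lu[of "axis i 1"] by (simp add: inner_axis axis_in_Basis_iff)
  have "emeasure (distr lborel_fun borel (vec_lambda :: ('n \<Rightarrow> real) \<Rightarrow> real^'n)) (box l u) =
      emeasure lborel_fun (vec_lambda -` box l u)"
    by (simp add: emeasure_distr)
  also have "(vec_lambda :: ('n \<Rightarrow> real) \<Rightarrow> real^'n) -` box l u = Pi\<^sub>E UNIV (\<lambda>i. {l $ i<..<u $ i})"
    by (auto simp: mem_box_cart PiE_def Pi_def)
  also have "emeasure lborel_fun \<dots> = ennreal (\<Prod>i\<in>UNIV. u $ i - l $ i)"
    by (subst emeasure_lborel_fun_box) (simp_all add: le prod_ennreal)
  also have "(\<Prod>i\<in>UNIV. u $ i - l $ i) = (\<Prod>b\<in>Basis. (u - l) \<bullet> b)"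
  proof -
    have B: "Basis = range (\<lambda>i::'n. axis i (1::real))" by (auto simp: Basis_vec_def)
    have "inj (\<lambda>i::'n. axis i (1::real))" by (auto simp: inj_def axis_eq_axis)
    then show ?thesis unfolding B by (simp add: prod.reindex inner_axis)
  qed
  finally show "emeasure (distr lborel_fun borel (vec_lambda :: ('n \<Rightarrow> real) \<Rightarrow> real^'n)) (box l u) =
    ennreal (\<Prod>b\<in>Basis. (u - l) \<bullet> b)" .
qed simp

lemma nn_integral_lborel_vec:
  fixes f :: "real^'n \<Rightarrow> ennreal"
  assumes "f \<in> borel_measurable borel"
  shows "(\<integral>\<^sup>+x. f x \<partial>lborel) = (\<integral>\<^sup>+\<omega>. f (vec_lambda \<omega>) \<partial>lborel_fun)"
  using assms by (subst lborel_eq_distr_vec_lambda) (simp add: nn_integral_distr)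

lemma nn_integral_lborel_vec_prod:
  fixes f :: "'n::finite \<Rightarrow> real \<Rightarrow> ennreal"
  assumes [measurable]: "\<And>i. f i \<in> borel_measurable borel"
  shows "(\<integral>\<^sup>+x. (\<Prod>i\<in>UNIV. f i (x $ i)) \<partial>lborel) = (\<Prod>i\<in>UNIV. \<integral>\<^sup>+t. f i t \<partial>lborel)"
  by (subst nn_integral_lborel_vec) (simp_all add: nn_integral_lborel_fun_prod)

lemma borel_measurable_matrix_vector_mult [measurable]:
  "(\<lambda>x. (B::real^'n^'m) *v x) \<in> borel_measurable borel"
  by (intro borel_measurable_continuous_onI continuous_intros)

text \<open>By Fubini the coordinate \<open>m\<close> is integrated first; with the others fixed,
  the shear is a translation by the coordinate \<open>k\<close>.\<close>

lemma nn_integral_shear: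
  fixes f :: "real^'n \<Rightarrow> ennreal" and m k :: 'n
  assumes "m \<noteq> k" and [measurable]: "f \<in> borel_measurable borel"
  shows "(\<integral>\<^sup>+x. f (\<chi> i. if i = m then x $ m + x $ k else x $ i) \<partial>lborel) = (\<integral>\<^sup>+x. f x \<partial>lborel)"
proof -
  interpret product_sigma_finite "\<lambda>_::'n. lborel :: real measure" by (rule product_sigma_finite_lborel)
  let ?I = "UNIV - {m}"
  have ins: "Pi\<^sub>M (insert m ?I) (\<lambda>_. lborel) = (lborel_fun :: ('n \<Rightarrow> real) measure)"
    by (simp add: lborel_fun_def insert_absorb)
  have split: "(\<integral>\<^sup>+\<omega>. F \<omega> \<partial>lborel_fun) = (\<integral>\<^sup>+\<omega>. (\<integral>\<^sup>+y. F (fun_upd \<omega> m y) \<partial>lborel) \<partial>(Pi\<^sub>M ?I (\<lambda>_. lborel)))"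
    if "F \<in> borel_measurable lborel_fun" for F :: "('n \<Rightarrow> real) \<Rightarrow> ennreal"
    using product_nn_integral_insert[of ?I m F] that unfolding ins by simp
  have sh [measurable]: "(\<lambda>x::real^'n. \<chi> i. if i = m then x $ m + x $ k else x $ i) \<in> borel_measurable borel"
    by (rule borel_measurable_vecI) (auto intro!: borel_measurable_continuous_onI continuous_intros)
  have upd [measurable]: "(\<lambda>y. f (vec_lambda (fun_upd \<omega> m y))) \<in> borel_measurable borel" for \<omega>
  proof -
    have "(\<lambda>y. vec_lambda (fun_upd \<omega> m y)) \<in> borel_measurable borel"
      by (rule borel_measurable_vecI) (simp add: fun_upd_def)
    then show ?thesis by measurable
  qed
  \<comment> \<open>The inner argument is written with \<open>1 * y\<close> to match the affine
    substitution rule with slope 1.\<close>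
  have "(\<integral>\<^sup>+x. f (\<chi> i. if i = m then x $ m + x $ k else x $ i) \<partial>lborel)
      = (\<integral>\<^sup>+\<omega>. (\<integral>\<^sup>+y. f (vec_lambda (fun_upd \<omega> m (\<omega> k + 1 * y))) \<partial>lborel) \<partial>(Pi\<^sub>M ?I (\<lambda>_. lborel)))"
    using \<open>m \<noteq> k\<close>
    by (subst nn_integral_lborel_vec, simp, subst split, simp)
       (auto intro!: nn_integral_cong arg_cong[of _ _ f] simp: vec_eq_iff)
  also have "\<dots> = (\<integral>\<^sup>+\<omega>. (\<integral>\<^sup>+y. f (vec_lambda (fun_upd \<omega> m y)) \<partial>lborel) \<partial>(Pi\<^sub>M ?I (\<lambda>_. lborel)))"
    by (rule nn_integral_cong, subst nn_integral_real_affine[where c = 1 and t = "_ k"]) auto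
  also have "\<dots> = (\<integral>\<^sup>+x. f x \<partial>lborel)"
    by (subst nn_integral_lborel_vec, simp, subst split) auto
  finally show ?thesis .
qed

lemma nn_integral_transposition:
  fixes f :: "real^'n \<Rightarrow> ennreal" and m k :: 'n
  assumes [measurable]: "f \<in> borel_measurable borel"
  shows "(\<integral>\<^sup>+x. f (\<chi> i. x $ Transposition.transpose m k i) \<partial>lborel) = (\<integral>\<^sup>+x. f x \<partial>lborel)"
proof -
  let ?\<tau> = "Transposition.transpose m k"
  have meas: "(\<lambda>\<omega> i. \<omega> (?\<tau> i)) \<in> lborel_fun \<rightarrow>\<^sub>M (lborel_fun :: ('n \<Rightarrow> real) measure)"
    by (rule measurable_lborel_funI) simp
  have "distr lborel_fun lborel_fun (\<lambda>\<omega> i. \<omega> (?\<tau> i)) = (lborel_fun :: ('n \<Rightarrow> real) measure)"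
  proof (rule lborel_fun_eqI)
    fix A :: "'n \<Rightarrow> real set" assume A: "\<And>i. A i \<in> sets borel"
    have vim: "(\<lambda>\<omega> i. \<omega> (?\<tau> i)) -` Pi\<^sub>E UNIV A = Pi\<^sub>E UNIV (\<lambda>i. A (?\<tau> i))"
      by (auto simp: PiE_def Pi_def) (metis transpose_involutory)+
    have "emeasure (distr lborel_fun lborel_fun (\<lambda>\<omega> i. \<omega> (?\<tau> i))) (Pi\<^sub>E UNIV A) =
      (\<Prod>i\<in>UNIV. emeasure lborel (A (?\<tau> i)))"
      using sets_lborel_fun_box[of A, OF A] A by (simp add: emeasure_distr[OF meas] vim emeasure_lborel_fun_box)
    also have "\<dots> = (\<Prod>i\<in>UNIV. emeasure lborel (A i))"
      by (rule prod.reindex_bij_betw) (rule bij_transpose)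
    finally show "emeasure (distr lborel_fun lborel_fun (\<lambda>\<omega> i. \<omega> (?\<tau> i))) (Pi\<^sub>E UNIV A) =
      (\<Prod>i\<in>UNIV. emeasure lborel (A i))" .
  qed simp
  then have "(\<integral>\<^sup>+\<omega>. f (vec_lambda \<omega>) \<partial>lborel_fun) =
      (\<integral>\<^sup>+\<omega>. f (vec_lambda \<omega>) \<partial>distr lborel_fun lborel_fun (\<lambda>\<omega> i. \<omega> (?\<tau> i)))" by simp
  also have "\<dots> = (\<integral>\<^sup>+\<omega>. f (\<chi> i. \<omega> (?\<tau> i)) \<partial>lborel_fun)"
    by (subst nn_integral_distr[OF meas]) simp_all
  finally have e: "(\<integral>\<^sup>+\<omega>. f (vec_lambda \<omega>) \<partial>lborel_fun) = (\<integral>\<^sup>+\<omega>. f (\<chi> i. \<omega> (?\<tau> i)) \<partial>lborel_fun)" .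
  have [measurable]: "(\<lambda>x::real^'n. \<chi> i. x $ ?\<tau> i) \<in> borel_measurable borel"
    by (rule borel_measurable_vecI) (auto intro!: borel_measurable_continuous_onI continuous_intros)
  show ?thesis by (simp add: nn_integral_lborel_vec e)
qed

lemma nn_integral_matrix_vector_mult:
  fixes A :: "real^'n^'n"
  assumes "det A \<noteq> 0" "f \<in> borel_measurable borel"
  shows "(\<integral>\<^sup>+x. f x \<partial>lborel) = ennreal \<bar>det A\<bar> * (\<integral>\<^sup>+x. f (A *v x) \<partial>lborel)"
proof -
  \<comment> \<open>The condition on the determinant is put inside \<open>P\<close>, because the
    induction over elementary matrices also passes through singular ones, where \<open>P\<close>
    holds vacuously.\<close>
  define P :: "real^'n^'n \<Rightarrow> bool" where "P A \<longleftrightarrow> (det A \<noteq> 0 \<longrightarrow> (\<forall>f\<in>borel_measurable borel.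
    (\<integral>\<^sup>+x. f x \<partial>lborel) = ennreal \<bar>det A\<bar> * (\<integral>\<^sup>+x. f (A *v x) \<partial>lborel)))" for A
  have "P A"
  proof (rule induct_matrix_elementary_alt)
    fix A B assume AB: "P A" "P B"
    show "P (A ** B)" unfolding P_def
    proof (intro impI ballI)
      fix f :: "real^'n \<Rightarrow> ennreal" assume nz: "det (A ** B) \<noteq> 0" and f [measurable]: "f \<in> borel_measurable borel"
      have nz: "det A \<noteq> 0" "det B \<noteq> 0" using nz by (auto simp: det_mul)
      have "(\<integral>\<^sup>+x. f x \<partial>lborel) = ennreal \<bar>det A\<bar> * (\<integral>\<^sup>+x. f (A *v x) \<partial>lborel)"
        using AB nz f unfolding P_def by blast
      also have "(\<integral>\<^sup>+x. f (A *v x) \<partial>lborel) = ennreal \<bar>det B\<bar> * (\<integral>\<^sup>+x. f (A *v (B *v x)) \<partial>lborel)"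
      proof -
        have "(\<lambda>x. f (A *v x)) \<in> borel_measurable borel" by measurable
        then show ?thesis using AB(2) nz unfolding P_def by blast
      qed
      finally show "(\<integral>\<^sup>+x. f x \<partial>lborel) = ennreal \<bar>det (A ** B)\<bar> * (\<integral>\<^sup>+x. f (A ** B *v x) \<partial>lborel)"
        by (simp add: det_mul abs_mult ennreal_mult matrix_vector_mul_assoc mult.assoc)
    qed
  next
    fix A :: "real^'n^'n" and i assume "row i A = 0"
    then show "P A" by (simp add: P_def det_zero_row)
  next
    fix A :: "real^'n^'n" assume diag: "\<And>i j. i \<noteq> j \<Longrightarrow> A $ i $ j = 0"
    show "P A" unfolding P_def
    proof (intro impI ballI)
      fix f :: "real^'n \<Rightarrow> ennreal" assume "det A \<noteq> 0" and [measurable]: "f \<in> borel_measurable borel"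
      then have nz: "A $ i $ i \<noteq> 0" for i by (auto simp: det_diagonal[OF diag])
      have "A *v x = (\<chi> i. A $ i $ i * x $ i)" for x
      proof -
        have "(\<Sum>j\<in>UNIV. A $ i $ j * x $ j) = (\<Sum>j\<in>UNIV. if i = j then A $ i $ i * x $ i else 0)" for i
          by (rule sum.cong) (use diag in auto)
        then show ?thesis by (simp add: vec_eq_iff matrix_vector_mult_def)
      qed
      then have Av: "A *v vec_lambda \<omega> = (\<chi> i. A $ i $ i * \<omega> i)" for \<omega> by simp
      have "(\<integral>\<^sup>+\<omega>. f (vec_lambda \<omega>) \<partial>lborel_fun) =
          (\<Prod>i\<in>UNIV. ennreal \<bar>A $ i $ i\<bar>) * (\<integral>\<^sup>+\<omega>. f (\<chi> i. A $ i $ i * \<omega> i) \<partial>lborel_fun)"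
        by (rule nn_integral_lborel_fun_componentwise)
           (use lborel_real_affine[OF nz, of 0] in auto)
      then show "(\<integral>\<^sup>+x. f x \<partial>lborel) = ennreal \<bar>det A\<bar> * (\<integral>\<^sup>+x. f (A *v x) \<partial>lborel)"
        by (simp add: nn_integral_lborel_vec Av det_diagonal[OF diag] abs_prod prod_ennreal)
    qed
  next
    fix m k :: 'n assume "m \<noteq> k"
    let ?A = "(\<chi> i j. mat 1 $ i $ Transposition.transpose m k j) :: real^'n^'n"
    have "?A *v x = (\<chi> i. x $ Transposition.transpose m k i)" for x
    proof -
      have "(\<Sum>j\<in>UNIV. (if i = Transposition.transpose m k j then 1 else 0) * x $ j)
        = (\<Sum>j\<in>UNIV. if Transposition.transpose m k i = j then x $ j else 0)" for i
        by (rule sum.cong) (auto simp: transpose_eq_iff)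
      then show ?thesis by (simp add: vec_eq_iff matrix_vector_mult_def mat_def)
    qed
    moreover have "\<bar>det ?A\<bar> = 1"
    proof -
      have "det ?A = of_int (sign (Transposition.transpose m k)) * det (mat 1 :: real^'n^'n)"
        by (rule det_permute_columns) (simp add: permutes_swap_id)
      then show ?thesis by (simp add: sign_def)
    qed
    ultimately show "P ?A" by (simp add: P_def nn_integral_transposition)
  next
    fix m k :: 'n assume mk: "m \<noteq> k"
    let ?A = "(\<chi> i j. of_bool (i = m \<and> j = k \<or> i = j)) :: real^'n^'n"
    have "?A *v x = (\<chi> i. if i = m then x $ m + x $ k else x $ i)" for x
    proof -
      have "(\<Sum>j\<in>UNIV. of_bool (i = m \<and> j = k \<or> i = j) * x $ j)
        = (\<Sum>j\<in>UNIV. (if j = k then if i = m then x $ k else 0 else 0) + (if j = i then x $ i else 0))" for i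
        by (rule sum.cong) (use mk in auto)
      then show ?thesis by (auto simp: vec_eq_iff matrix_vector_mult_def sum.distrib)
    qed
    moreover have "det ?A = 1"
    proof -
      have "?A = (\<chi> i. if i = m then row m (mat 1) + 1 *s row k (mat 1) else row i (mat 1))"
        using mk by (auto simp: vec_eq_iff row_def mat_def)
      then show ?thesis using det_row_operation[OF mk, of "mat 1 :: real^'n^'n" 1] by (simp only: det_I)
    qed
    ultimately show "P ?A" using mk by (simp add: P_def nn_integral_shear)
  qed
  then show ?thesis using assms unfolding P_def by blast
qed

lemma lborel_eq_density_matrix_vector_mult:
  fixes B :: "real^'n^'n"
  assumes "det B \<noteq> 0"
  shows "lborel = density (distr lborel borel ((*v) B)) (\<lambda>_. ennreal \<bar>det B\<bar>)"
proof (rule measure_eqI)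
  fix X :: "(real^'n) set" assume "X \<in> sets lborel"
  then have [measurable]: "X \<in> sets borel" by simp
  have "emeasure lborel X = (\<integral>\<^sup>+x. indicator X x \<partial>lborel)" by simp
  also have "\<dots> = ennreal \<bar>det B\<bar> * (\<integral>\<^sup>+x. indicator X (B *v x) \<partial>lborel)"
    by (rule nn_integral_matrix_vector_mult[OF assms]) simp
  also have "(\<integral>\<^sup>+x. indicator X (B *v x) \<partial>lborel) = emeasure (distr lborel borel ((*v) B)) X"
    by (subst nn_integral_indicator[symmetric], simp, subst nn_integral_distr) auto
  finally show "emeasure lborel X = emeasure (density (distr lborel borel ((*v) B)) (\<lambda>_. ennreal \<bar>det B\<bar>)) X"
    by (simp add: emeasure_density_const)
qed simp

lemma integral_matrix_vector_mult:
  fixes B :: "real^'n^'n" and f :: "real^'n \<Rightarrow> 'b::{banach, second_countable_topology}"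
  assumes "det B \<noteq> 0" and [measurable]: "f \<in> borel_measurable borel"
  shows "(\<integral>x. f x \<partial>lborel) = \<bar>det B\<bar> *\<^sub>R (\<integral>x. f (B *v x) \<partial>lborel)"
  by (subst lborel_eq_density_matrix_vector_mult[OF assms(1)])
     (simp add: integral_density integral_distr)

section \<open>The integral of a power of the determinant against a Gaussian weight\<close>

lemma borel_measurable_det [measurable]: "(det :: real^'n^'n \<Rightarrow> real) \<in> borel_measurable borel"
  unfolding det_def[abs_def] by (intro borel_measurable_continuous_onI continuous_intros)

lemma det_vec_lambda_mult: "det (vec_lambda (\<lambda>i. B *v \<omega> i)) = det B * det (vec_lambda \<omega>)"
  for B :: "real^'n^'n"
proof -
  have "vec_lambda (\<lambda>i. B *v \<omega> i) = vec_lambda \<omega> ** transpose B"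
    by (simp add: vec_eq_iff matrix_matrix_mult_def matrix_vector_mult_def transpose_def mult.commute)
  then show ?thesis by (simp add: det_mul)
qed

text \<open>The exponential weight thus splits into one Gaussian factor per row, which is what lets
  a linear map act on the rows independently.\<close>

lemma trace_mult_gram:
  fixes s :: "real^'n^'n"
  shows "trace (s ** (transpose (vec_lambda \<omega>) ** vec_lambda \<omega>)) = (\<Sum>i\<in>(UNIV::'m::finite set). \<omega> i \<bullet> (s *v \<omega> i))"
proof -
  have "trace (s ** (transpose (vec_lambda \<omega>) ** vec_lambda \<omega>)) =
      (\<Sum>j\<in>UNIV. \<Sum>k\<in>UNIV. \<Sum>i\<in>UNIV. s$j$k * (\<omega> i$k * \<omega> i$j))"
    by (simp add: trace_def matrix_matrix_mult_def transpose_def sum_distrib_left)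
  also have "\<dots> = (\<Sum>j\<in>UNIV. \<Sum>i\<in>UNIV. \<Sum>k\<in>UNIV. s$j$k * (\<omega> i$k * \<omega> i$j))"
    by (rule sum.cong[OF refl]) (rule sum.swap)
  also have "\<dots> = (\<Sum>i\<in>UNIV. \<Sum>j\<in>UNIV. \<Sum>k\<in>UNIV. s$j$k * (\<omega> i$k * \<omega> i$j))" by (rule sum.swap)
  also have "\<dots> = (\<Sum>i\<in>UNIV. \<omega> i \<bullet> (s *v \<omega> i))"
    by (simp add: inner_vec_def matrix_vector_mult_def sum_distrib_left mult_ac)
  finally show ?thesis .
qed

text \<open>The Laplace transform at \<open>s\<close> of the image of |det X|^a dX under X^T X.
  Values in \<open>ennreal\<close> allow the scaling law in \<open>s\<close> to be proved before
  finiteness is known.\<close>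

definition det_laplace :: "real \<Rightarrow> real^'n^'n \<Rightarrow> ennreal" where
  "det_laplace a s = (\<integral>\<^sup>+\<omega>. ennreal (\<bar>det (vec_lambda \<omega>)\<bar> powr a *
     exp (- (\<Sum>i\<in>UNIV. \<omega> i \<bullet> (s *v \<omega> i)))) \<partial>lborel_fun)"

text \<open>Applying \<open>B\<close> with B^T s B = 1 to each of the n rows costs |det B|^n as
  Jacobian and |det B|^a from the determinant of the matrix; finally |det B| = (det
  s)^(-1/2).\<close>

lemma det_laplace_pos_def:
  fixes s :: "real^'n^'n"
  assumes s: "s \<in> pos_def_mats"
  shows "det_laplace a s = ennreal (det s powr (- (a + CARD('n)) / 2)) * det_laplace a (mat 1 :: real^'n^'n)"
proof -
  obtain B :: "real^'n^'n" where B: "det B \<noteq> 0" "(det B)\<^sup>2 * det s = 1"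
    "\<And>y. (B *v y) \<bullet> (s *v (B *v y)) = y \<bullet> y"
    by (rule pos_def_congruent_identity[OF s]) blast
  have "det_laplace a s = (\<Prod>i\<in>(UNIV::'n set). ennreal \<bar>det B\<bar>) *
      (\<integral>\<^sup>+\<omega>. ennreal (\<bar>det (vec_lambda (\<lambda>i. B *v \<omega> i))\<bar> powr a *
        exp (- (\<Sum>i\<in>UNIV. (B *v \<omega> i) \<bullet> (s *v (B *v \<omega> i))))) \<partial>lborel_fun)"
    unfolding det_laplace_def
    by (rule nn_integral_lborel_fun_componentwise[where g = "\<lambda>_ x. B *v x" and c = "\<lambda>_. ennreal \<bar>det B\<bar>",
            OF borel_measurable_matrix_vector_mult lborel_eq_density_matrix_vector_mult[OF B(1)]])
       measurable
  also have "(\<integral>\<^sup>+\<omega>. ennreal (\<bar>det (vec_lambda (\<lambda>i. B *v \<omega> i))\<bar> powr a *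
        exp (- (\<Sum>i\<in>UNIV. (B *v \<omega> i) \<bullet> (s *v (B *v \<omega> i))))) \<partial>lborel_fun)
     = (\<integral>\<^sup>+\<omega>. ennreal (\<bar>det B\<bar> powr a) * ennreal (\<bar>det (vec_lambda \<omega>)\<bar> powr a *
        exp (- (\<Sum>i\<in>UNIV. \<omega> i \<bullet> (mat 1 *v \<omega> i)))) \<partial>(lborel_fun :: ('n \<Rightarrow> real^'n) measure))"
    by (rule nn_integral_cong)
       (simp add: B(3) det_vec_lambda_mult abs_mult powr_mult mult.assoc flip: ennreal_mult)
  also have "\<dots> = ennreal (\<bar>det B\<bar> powr a) * det_laplace a (mat 1 :: real^'n^'n)"
    unfolding det_laplace_def by (rule nn_integral_cmult) measurable
  also have "(\<Prod>i\<in>(UNIV::'n set). ennreal \<bar>det B\<bar>) = ennreal (\<bar>det B\<bar> powr CARD('n))"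
    using B(1) by (simp add: prod_ennreal powr_realpow ennreal_power)
  also have "\<dots> * (ennreal (\<bar>det B\<bar> powr a) * det_laplace a (mat 1 :: real^'n^'n)) =
      ennreal (\<bar>det B\<bar> powr (a + CARD('n))) * det_laplace a (mat 1 :: real^'n^'n)"
    by (simp add: powr_add ennreal_mult mult_ac)
  also have "\<bar>det B\<bar> powr (a + CARD('n)) = det s powr (- (a + CARD('n)) / 2)"
  proof -
    have "det s = \<bar>det B\<bar> powr (-2)"
      using B(1,2) by (simp add: powr_minus field_simps)
    then show ?thesis by (simp add: powr_powr add_divide_distrib add.commute)
  qed
  finally show ?thesis .
qed

section \<open>Integrability of powers of the determinant\<close>

text \<open>The value at \<open>0\<close> is infinite, unlike \<open>0 powr a = 0\<close>, so that the bounds below, for negative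
  exponents, also hold on singular matrices.\<close>

definition abs_powr :: "real \<Rightarrow> real \<Rightarrow> ennreal" where
  "abs_powr a t = (if t = 0 then \<infinity> else ennreal (\<bar>t\<bar> powr a))"

lemma borel_measurable_abs_powr [measurable]: "abs_powr a \<in> borel_measurable borel"
  unfolding abs_powr_def by measurable

lemma abs_powr_mult: "c \<noteq> 0 \<Longrightarrow> abs_powr a (c * t) = abs_powr a c * abs_powr a t"
  by (auto simp: abs_powr_def abs_mult powr_mult ennreal_mult ennreal_mult_top)

lemma nn_integral_powr_exp_finite:
  assumes "-1 < (a::real)"
  shows "(\<integral>\<^sup>+t. ennreal (indicator {0..} t * t powr a / exp t) \<partial>lborel) < \<infinity>"
proof -
  have "(\<integral>\<^sup>+t. ennreal (indicator {0..} t * t powr a / exp t) \<partial>lborel) = ennreal (Gamma (a + 1))"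
    using Gamma_conv_nn_integral_real[of "a + 1"] assms by simp
  then show ?thesis by simp
qed

lemma nn_integral_reflect:
  assumes "(f :: real \<Rightarrow> ennreal) \<in> borel_measurable borel"
  shows "(\<integral>\<^sup>+t. f (- t) \<partial>lborel) = (\<integral>\<^sup>+t. f t \<partial>lborel)"
  using nn_integral_real_affine[OF assms, of "-1" 0] by simp

text \<open>For c = 1 the singularity of |s|^a at 0 is integrable because a > -1, and away from it
  the integrand is at most 1; hence a bound independent of \<open>b\<close>. Homogeneity of
  \<open>abs_powr\<close> then extracts the factor for general \<open>c\<close>.\<close>

lemma nn_integral_abs_powr_unit_interval:
  assumes a: "-1 < a" "a < 0"
  obtains K where "0 < K" "K < \<infinity>" "\<And>b c. (\<integral>\<^sup>+t. indicator {0..1} t * abs_powr a (b + t * c) \<partial>lborel) \<le> K * abs_powr a c"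
proof -
  define G where "G = (\<integral>\<^sup>+t. ennreal (indicator {0..} t * t powr a / exp t) \<partial>lborel)"
  have G: "G < \<infinity>" unfolding G_def by (rule nn_integral_powr_exp_finite) fact
  \<comment> \<open>The summand 1 is the length of the interval, for |s| >= 1. On |s| < 1 the power
    is at most e |s|^a exp(-|s|), which costs one Gamma integral \<open>G\<close> on each
    half-line.\<close>
  define K where "K = 1 + 2 * ennreal (exp 1) * G"
  have refl_G: "(\<integral>\<^sup>+t. ennreal (indicator {0..} (-t) * (-t) powr a / exp (-t)) \<partial>lborel) = G"
    unfolding G_def by (rule nn_integral_reflect) measurable
  have bound: "indicator {0..1} (s - b) * abs_powr a s \<le> indicator {b..b+1} s +
      (ennreal (exp 1) * ennreal (indicator {0..} s * s powr a / exp s) +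
       ennreal (exp 1) * ennreal (indicator {0..} (-s) * (-s) powr a / exp (-s)))" if "s \<noteq> 0" for s b :: real
  proof (cases "\<bar>s\<bar> \<ge> 1")
    case True
    then have "abs_powr a s \<le> 1"
      using powr_mono2'[of a 1 "\<bar>s\<bar>"] a that by (simp add: abs_powr_def)
    moreover have "indicator {0..1} (s - b) = (indicator {b..b+1} s :: ennreal)" by (auto simp: indicator_def)
    ultimately show ?thesis
      by (metis (no_types, lifting) add_increasing2 mult.right_neutral mult_left_mono zero_le)
  next
    case False
    have "\<bar>s\<bar> powr a \<le> exp 1 * (\<bar>s\<bar> powr a / exp \<bar>s\<bar>)"
      using False mult_left_mono[of "exp \<bar>s\<bar>" "exp 1" "\<bar>s\<bar> powr a"] by (simp add: field_simps)
    then have "abs_powr a s \<le> ennreal (exp 1 * (\<bar>s\<bar> powr a / exp \<bar>s\<bar>))"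
      using that by (simp add: abs_powr_def ennreal_leI)
    also have "\<dots> \<le> ennreal (exp 1) * ennreal (indicator {0..} s * s powr a / exp s) +
       ennreal (exp 1) * ennreal (indicator {0..} (-s) * (-s) powr a / exp (-s))"
      using that by (cases "0 < s") (auto simp: indicator_def simp flip: ennreal_mult)
    finally have *: "abs_powr a s \<le> ennreal (exp 1) * ennreal (indicator {0..} s * s powr a / exp s) +
       ennreal (exp 1) * ennreal (indicator {0..} (-s) * (-s) powr a / exp (-s))" .
    show ?thesis
      by (intro add_increasing order_trans[OF _ *]) (auto simp: indicator_def)
  qed
  have unit: "(\<integral>\<^sup>+t. indicator {0..1} t * abs_powr a (b + t) \<partial>lborel) \<le> K" for b
  proof -
    have "(\<integral>\<^sup>+t. indicator {0..1} t * abs_powr a (b + t) \<partial>lborel) =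
        (\<integral>\<^sup>+s. indicator {0..1} (s - b) * abs_powr a s \<partial>lborel)"
      by (subst (2) nn_integral_real_affine[where c = 1 and t = b]) auto
    also have "\<dots> \<le> (\<integral>\<^sup>+s. indicator {b..b+1} s +
      (ennreal (exp 1) * ennreal (indicator {0..} s * s powr a / exp s) +
       ennreal (exp 1) * ennreal (indicator {0..} (-s) * (-s) powr a / exp (-s))) \<partial>lborel)"
      using AE_lborel_singleton[of 0] bound by (intro nn_integral_mono_AE) auto
    also have "\<dots> = 1 + (ennreal (exp 1) * G + ennreal (exp 1) * G)"
    proof -
      define g h where "g t = ennreal (indicator {0..} t * t powr a / exp t)"
        and "h t = ennreal (indicator {0..} (-t) * (-t) powr a / exp (-t))" for t :: real
      have [measurable]: "g \<in> borel_measurable borel" "h \<in> borel_measurable borel"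
        unfolding g_def h_def by measurable
      have "(\<integral>\<^sup>+s. g s \<partial>lborel) = G" "(\<integral>\<^sup>+s. h s \<partial>lborel) = G"
        using refl_G by (simp_all only: g_def h_def G_def)
      then have "(\<integral>\<^sup>+s. indicator {b..b+1} s + (ennreal (exp 1) * g s + ennreal (exp 1) * h s) \<partial>lborel) =
        1 + (ennreal (exp 1) * G + ennreal (exp 1) * G)"
        by (simp add: nn_integral_add nn_integral_cmult)
      then show ?thesis by (simp only: g_def h_def)
    qed
    also have "\<dots> = K" by (simp add: K_def mult_2 distrib_right mult.assoc)
    finally show ?thesis .
  qed
  have "0 < K" by (simp add: K_def add_pos_nonneg)
  moreover have "K < \<infinity>" using G by (auto simp: K_def ennreal_mult_less_top)
  moreover have "(\<integral>\<^sup>+t. indicator {0..1} t * abs_powr a (b + t * c) \<partial>lborel) \<le> K * abs_powr a c" for b c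
  \<comment> \<open>For c = 0 the right-hand side is infinite, which uses that \<open>K\<close> is
    strictly positive.\<close>
  proof (cases "c = 0")
    case True
    then show ?thesis using \<open>0 < K\<close> by (simp add: abs_powr_def ennreal_mult_top)
  next
    case False
    have "abs_powr a (b + t * c) = abs_powr a c * abs_powr a (b / c + t)" for t
      using False by (subst abs_powr_mult[symmetric]) (auto simp: distrib_left mult.commute)
    then have "(\<integral>\<^sup>+t. indicator {0..1} t * abs_powr a (b + t * c) \<partial>lborel) =
      (\<integral>\<^sup>+t. abs_powr a c * (indicator {0..1} t * abs_powr a (b / c + t)) \<partial>lborel)"
      by (simp add: mult_ac)
    also have "\<dots> = abs_powr a c * (\<integral>\<^sup>+t. indicator {0..1} t * abs_powr a (b / c + t) \<partial>lborel)"
      by (rule nn_integral_cmult) simp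
    also have "\<dots> \<le> abs_powr a c * K" by (intro mult_left_mono unit) simp
    finally show ?thesis by (simp add: mult.commute)
  qed
  ultimately show ?thesis by (rule that)
qed

text \<open>The principal minor with rows and columns in \<open>S\<close>, written as a full
  determinant by inserting unit rows. It interpolates between 1 for the empty set and the
  determinant itself.\<close>

definition partial_det :: "'n set \<Rightarrow> ('n \<Rightarrow> real^'n) \<Rightarrow> real" where
  "partial_det S \<omega> = det (\<chi> i. if i \<in> S then \<omega> i else axis i 1)"

lemma borel_measurable_partial_det [measurable]:
  "partial_det (S :: 'n::finite set) \<in> borel_measurable lborel_fun"
proof -
  have "(\<lambda>\<omega>. (\<chi> i. if i \<in> S then \<omega> i else axis i 1) :: real^'n^'n) \<in> lborel_fun \<rightarrow>\<^sub>M borel"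
    by (rule borel_measurable_vecI) simp
  then show ?thesis unfolding partial_det_def by measurable
qed

text \<open>Linearity in row \<open>k\<close>: the added multiple of the unit row turns that row
  back into the one used by the minor for \<open>F\<close>, since \<open>k\<close> is outside
  \<open>F\<close>.\<close>

lemma partial_det_insert:
  assumes "k \<notin> F"
  shows "partial_det (insert k F) (\<lambda>i. \<omega> i + (if i = k then t *\<^sub>R axis k 1 else 0)) =
    partial_det (insert k F) \<omega> + t * partial_det F \<omega>"
proof -
  let ?c = "\<lambda>i. if i \<in> F then \<omega> i else axis i (1::real)"
  have "partial_det (insert k F) (\<lambda>i. \<omega> i + (if i = k then t *\<^sub>R axis k 1 else 0)) =
      det (\<chi> i. if i = k then \<omega> i + t *s axis i 1 else ?c i)"
    unfolding partial_det_def
    by (rule arg_cong[of _ _ det]) (auto simp: vec_eq_iff vector_scalar_mult_def)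
  also have "\<dots> = det (\<chi> i. if i = k then \<omega> i else ?c i) + det (\<chi> i. if i = k then t *s axis i 1 else ?c i)"
    by (rule det_row_add)
  also have "det (\<chi> i. if i = k then t *s axis i 1 else ?c i) = t * det (\<chi> i. if i = k then axis i 1 else ?c i)"
    by (rule det_row_mul)
  also have "det (\<chi> i. if i = k then axis i 1 else ?c i) = partial_det F \<omega>"
    unfolding partial_det_def using assms by (intro arg_cong[of _ _ det]) (auto simp: vec_eq_iff)
  also have "det (\<chi> i. if i = k then \<omega> i else ?c i) = partial_det (insert k F) \<omega>"
    unfolding partial_det_def by (intro arg_cong[of _ _ det]) (auto simp: vec_eq_iff)
  finally show ?thesis .
qed

text \<open>The weight exp(-\<open>l1_norm\<close>) replaces the Gaussian in the induction: it still
  factorizes over the entries, but translating one entry by at most 1 changes it only by a factor at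
  most e, which fails for the Gaussian.\<close>

definition l1_norm :: "('n::finite \<Rightarrow> real^'n) \<Rightarrow> real" where
  "l1_norm \<omega> = (\<Sum>i\<in>UNIV. \<Sum>j\<in>UNIV. \<bar>\<omega> i $ j\<bar>)"

lemma borel_measurable_vec_nth [measurable]: "(\<lambda>x. (x::real^'n) $ i) \<in> borel_measurable borel"
  by (intro borel_measurable_continuous_onI continuous_intros)

lemma borel_measurable_l1_norm [measurable]: "l1_norm \<in> borel_measurable lborel_fun"
  unfolding l1_norm_def by measurable

lemma nn_integral_exp_l1_norm:
  "(\<integral>\<^sup>+\<omega>. ennreal (exp (- l1_norm \<omega>)) \<partial>(lborel_fun :: ('n::finite \<Rightarrow> real^'n) measure)) < \<infinity>"
proof -
  define G where "G = (\<integral>\<^sup>+t. ennreal (indicator {0..} t * t powr 0 / exp t) \<partial>lborel)"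
  have G: "G < \<infinity>" unfolding G_def by (rule nn_integral_powr_exp_finite) simp
  have refl_G: "(\<integral>\<^sup>+t. ennreal (indicator {0..} (-t) * (-t) powr 0 / exp (-t)) \<partial>lborel) = G"
    unfolding G_def by (rule nn_integral_reflect) measurable
  \<comment> \<open>The comparison holds only almost everywhere: at t = 0 the right-hand side is 0,
    because \<open>0 powr 0 = 0\<close>.\<close>
  have "(\<integral>\<^sup>+t. ennreal (exp (- \<bar>t\<bar>)) \<partial>lborel) \<le> (\<integral>\<^sup>+t. ennreal (indicator {0..} t * t powr 0 / exp t) +
      ennreal (indicator {0..} (-t) * (-t) powr 0 / exp (-t)) \<partial>lborel)"
    using AE_lborel_singleton[of 0]
    by (intro nn_integral_mono_AE, eventually_elim) (auto simp: indicator_def exp_minus field_simps)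
  also have "\<dots> = G + G" by (subst nn_integral_add) (simp_all only: refl_G, simp_all add: G_def)
  finally have fin: "(\<integral>\<^sup>+t. ennreal (exp (- \<bar>t\<bar>)) \<partial>lborel) < \<infinity>"
    using G by (auto simp: less_top[symmetric] top_unique)
  have "(\<integral>\<^sup>+\<omega>. ennreal (exp (- l1_norm \<omega>)) \<partial>(lborel_fun :: ('n \<Rightarrow> real^'n) measure)) =
    (\<integral>\<^sup>+\<omega>. (\<Prod>i\<in>UNIV. (\<Prod>j\<in>UNIV. ennreal (exp (- \<bar>\<omega> i $ j\<bar>)))) \<partial>(lborel_fun :: ('n \<Rightarrow> real^'n) measure))"
    by (simp add: l1_norm_def exp_sum prod_ennreal prod_nonneg flip: sum_negf)
  also have "\<dots> = (\<Prod>i\<in>(UNIV::'n set). \<integral>\<^sup>+x. (\<Prod>j\<in>UNIV. ennreal (exp (- \<bar>(x::real^'n) $ j\<bar>))) \<partial>lborel)"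
    by (rule nn_integral_lborel_fun_prod) measurable
  also have "\<dots> = (\<Prod>i\<in>(UNIV::'n set). (\<Prod>j\<in>(UNIV::'n set). \<integral>\<^sup>+t. ennreal (exp (- \<bar>t\<bar>)) \<partial>lborel))"
    by (subst nn_integral_lborel_vec_prod) auto
  also have "\<dots> < \<infinity>" using fin by (simp add: power_less_top_ennreal flip: power_mult)
  finally show ?thesis .
qed

text \<open>Averaging over the translations of the entry \<open>(k, k)\<close> by \<open>t \<in> [0, 1]\<close>, which preserve the measure
  and change the weight by a bounded factor, replaces \<^term>\<open>partial_det (insert k F)\<close> by its slope
  \<^term>\<open>partial_det F\<close> in \<open>t\<close>.\<close>

lemma nn_integral_abs_powr_partial_det:
  fixes S :: "'n::finite set"
  assumes a: "-1 < a" "a < 0"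
  shows "(\<integral>\<^sup>+\<omega>. abs_powr a (partial_det S \<omega>) * ennreal (exp (- l1_norm \<omega>)) \<partial>lborel_fun) < \<infinity>"
proof -
  have "finite S" by simp
  then show ?thesis
  proof (induction S rule: finite_induct)
    case empty
    have "partial_det ({}::'n set) \<omega> = 1" for \<omega>
    proof -
      have "(\<chi> i. axis i 1) = (mat 1 :: real^'n^'n)" by (simp add: vec_eq_iff mat_def axis_def)
      then show ?thesis by (simp add: partial_det_def)
    qed
    then show ?case using nn_integral_exp_l1_norm by (simp add: abs_powr_def)
  next
    case (insert k F)
    interpret lf: sigma_finite_measure "lborel_fun :: ('n \<Rightarrow> real^'n) measure"
      by (rule sigma_finite_lborel_fun)
    interpret pair_sigma_finite lborel "lborel_fun :: ('n \<Rightarrow> real^'n) measure" ..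
    obtain K where K: "0 < K" "K < \<infinity>" "\<And>b c. (\<integral>\<^sup>+t. indicator {0..1} t * abs_powr a (b + t * c) \<partial>lborel) \<le> K * abs_powr a c"
      using nn_integral_abs_powr_unit_interval[OF a] by blast
    define H where "H \<omega> = abs_powr a (partial_det (insert k F) \<omega>) * ennreal (exp (- l1_norm \<omega>))" for \<omega>
    define sh :: "real \<Rightarrow> ('n \<Rightarrow> real^'n) \<Rightarrow> 'n \<Rightarrow> real^'n"
      where "sh t \<omega> = (\<lambda>i. \<omega> i + (if i = k then t *\<^sub>R axis k 1 else 0))" for t \<omega>
    have [measurable]: "H \<in> borel_measurable lborel_fun" unfolding H_def by measurable
    have shift: "(\<integral>\<^sup>+\<omega>. H \<omega> \<partial>lborel_fun) = (\<integral>\<^sup>+\<omega>. H (sh t \<omega>) \<partial>lborel_fun)" for t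
    proof -
      have tr: "lborel = density (distr lborel borel (\<lambda>x::real^'n. x + v)) (\<lambda>_. 1)" for v
        using lborel_distr_plus[of v] by (simp add: density_1 add.commute[of _ v])
      have "(\<integral>\<^sup>+\<omega>. H \<omega> \<partial>lborel_fun) = (\<Prod>i\<in>(UNIV::'n set). 1) * (\<integral>\<^sup>+\<omega>. H (sh t \<omega>) \<partial>lborel_fun)"
        unfolding sh_def by (rule nn_integral_lborel_fun_componentwise[OF _ tr]) measurable
      then show ?thesis by simp
    qed
    have exp_le: "exp (- l1_norm (sh t \<omega>)) \<le> exp 1 * exp (- l1_norm \<omega>)" if "t \<in> {0..1}" for t \<omega>
    proof -
      have "l1_norm \<omega> \<le> (\<Sum>i\<in>UNIV. \<Sum>j\<in>UNIV. \<bar>sh t \<omega> i $ j\<bar> + (if i = k then if j = k then 1 else 0 else 0))"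
        unfolding l1_norm_def sh_def using that by (intro sum_mono) (auto simp: axis_def)
      also have "\<dots> = l1_norm (sh t \<omega>) + 1"
        by (simp add: l1_norm_def sum.distrib) (subst sum.swap, simp)
      finally show ?thesis by (simp flip: exp_add)
    qed
    have shm [measurable]: "(\<lambda>(t, \<omega>). sh t \<omega>) \<in> borel \<Otimes>\<^sub>M lborel_fun \<rightarrow>\<^sub>M lborel_fun"
    proof (rule measurable_lborel_funI)
      fix i
      have [measurable]: "(\<lambda>x. snd x i) \<in> borel_measurable (borel \<Otimes>\<^sub>M (lborel_fun :: ('n \<Rightarrow> real^'n) measure))"
        by (rule measurable_compose[OF measurable_snd measurable_lborel_fun_component])
      show "(\<lambda>x. (case x of (t, \<omega>) \<Rightarrow> sh t \<omega>) i) \<in> borel_measurable (borel \<Otimes>\<^sub>M lborel_fun)"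
        by (simp add: sh_def split_beta)
    qed
    have "(\<integral>\<^sup>+\<omega>. H \<omega> \<partial>lborel_fun) = (\<integral>\<^sup>+t. indicator {0..1::real} t * (\<integral>\<^sup>+\<omega>. H \<omega> \<partial>lborel_fun) \<partial>lborel)"
      by (subst nn_integral_multc) simp_all
    also have "\<dots> = (\<integral>\<^sup>+t. indicator {0..1} t * (\<integral>\<^sup>+\<omega>. H (sh t \<omega>) \<partial>lborel_fun) \<partial>lborel)"
      using shift by simp
    also have "\<dots> = (\<integral>\<^sup>+t. (\<integral>\<^sup>+\<omega>. indicator {0..1} t * H (sh t \<omega>) \<partial>lborel_fun) \<partial>lborel)"
      by (intro nn_integral_cong nn_integral_cmult[symmetric]) measurable
    also have "\<dots> = (\<integral>\<^sup>+\<omega>. (\<integral>\<^sup>+t. indicator {0..1} t * H (sh t \<omega>) \<partial>lborel) \<partial>lborel_fun)"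
      by (rule Fubini'[symmetric]) measurable
    also have "\<dots> \<le> (\<integral>\<^sup>+\<omega>. K * ennreal (exp 1) * (abs_powr a (partial_det F \<omega>) * ennreal (exp (- l1_norm \<omega>))) \<partial>lborel_fun)"
    proof (rule nn_integral_mono)
      fix \<omega> :: "'n \<Rightarrow> real^'n"
      have "(\<integral>\<^sup>+t. indicator {0..1} t * H (sh t \<omega>) \<partial>lborel) \<le>
        (\<integral>\<^sup>+t. (indicator {0..1} t * abs_powr a (partial_det (insert k F) \<omega> + t * partial_det F \<omega>)) *
           ennreal (exp 1 * exp (- l1_norm \<omega>)) \<partial>lborel)"
      proof (rule nn_integral_mono)
        fix t :: real
        show "indicator {0..1} t * H (sh t \<omega>) \<le>
          (indicator {0..1} t * abs_powr a (partial_det (insert k F) \<omega> + t * partial_det F \<omega>)) *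
           ennreal (exp 1 * exp (- l1_norm \<omega>))"
        proof (cases "t \<in> {0..1}")
          case True
          have "partial_det (insert k F) (sh t \<omega>) = partial_det (insert k F) \<omega> + t * partial_det F \<omega>"
            unfolding sh_def by (rule partial_det_insert) fact
          with True show ?thesis
            by (simp add: H_def mult_left_mono ennreal_leI exp_le)
        qed simp
      qed
      also have "\<dots> = (\<integral>\<^sup>+t. indicator {0..1} t * abs_powr a (partial_det (insert k F) \<omega> + t * partial_det F \<omega>) \<partial>lborel) *
           ennreal (exp 1 * exp (- l1_norm \<omega>))"
        by (rule nn_integral_multc) simp
      also have "\<dots> \<le> (K * abs_powr a (partial_det F \<omega>)) * ennreal (exp 1 * exp (- l1_norm \<omega>))"
        by (intro mult_right_mono K) simp
      finally show "(\<integral>\<^sup>+t. indicator {0..1} t * H (sh t \<omega>) \<partial>lborel) \<le>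
        K * ennreal (exp 1) * (abs_powr a (partial_det F \<omega>) * ennreal (exp (- l1_norm \<omega>)))"
        by (simp add: ennreal_mult mult_ac)
    qed
    also have "\<dots> = K * ennreal (exp 1) * (\<integral>\<^sup>+\<omega>. abs_powr a (partial_det F \<omega>) * ennreal (exp (- l1_norm \<omega>)) \<partial>lborel_fun)"
      by (rule nn_integral_cmult) measurable
    also have "\<dots> < \<infinity>" using K(2) insert.IH by (simp add: ennreal_mult_less_top)
    finally show ?case by (simp add: H_def)
  qed
qed

lemma partial_det_UNIV: "partial_det UNIV \<omega> = det (vec_lambda \<omega>)"
  by (simp add: partial_det_def)

text \<open>\<open>abs_powr\<close> is infinite exactly at 0, so finiteness of its weighted integral
  forces the zero set of the determinant to be null. The exponent -1/2 is just one choice between -1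
  and 0.\<close>

lemma AE_det_nonzero: "AE \<omega> in (lborel_fun :: ('n::finite \<Rightarrow> real^'n) measure). det (vec_lambda \<omega>) \<noteq> 0"
proof -
  have "AE \<omega> in (lborel_fun :: ('n \<Rightarrow> real^'n) measure).
      abs_powr (-1/2) (partial_det UNIV \<omega>) * ennreal (exp (- l1_norm \<omega>)) \<noteq> \<infinity>"
    using nn_integral_abs_powr_partial_det[of "-1/2" "UNIV :: 'n set"]
    by (intro nn_integral_noteq_infinite) auto
  then show ?thesis
    by eventually_elim (auto simp: abs_powr_def partial_det_UNIV ennreal_top_mult)
qed

text \<open>The inequality t^2 >= 2|t| - 1 summed over the n^2 entries. The factor 2 leaves one copy
  of exp(-\<open>l1_norm\<close>) to integrate after the other has absorbed the growth of the
  determinant.\<close>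

lemma sum_squares_ge_l1_norm:
  "2 * l1_norm \<omega> - (real CARD('n))\<^sup>2 \<le> (\<Sum>i\<in>UNIV. \<omega> i \<bullet> (mat 1 *v \<omega> i))"
  for \<omega> :: "'n::finite \<Rightarrow> real^'n"
proof -
  have "2 * l1_norm \<omega> - (real CARD('n))\<^sup>2 = (\<Sum>i\<in>UNIV. \<Sum>j\<in>UNIV. 2 * \<bar>\<omega> i $ j\<bar> - 1)"
    by (simp add: l1_norm_def sum_subtractf sum_distrib_left power2_eq_square)
  also have "\<dots> \<le> (\<Sum>i\<in>UNIV. \<Sum>j\<in>UNIV. \<omega> i $ j * \<omega> i $ j)"
  proof (intro sum_mono)
    fix i j
    have "0 \<le> (\<bar>\<omega> i $ j\<bar> - 1)\<^sup>2" by simp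
    then show "2 * \<bar>\<omega> i $ j\<bar> - 1 \<le> \<omega> i $ j * \<omega> i $ j"
      by (simp add: power2_diff) (simp add: power2_eq_square)
  qed
  finally show ?thesis by (simp add: inner_vec_def)
qed

text \<open>Each of the n! Leibniz terms is a product of n entries. The base 1 +
  \<open>l1_norm\<close> rather than \<open>l1_norm\<close> is at least 1, so that its powers
  increase with the exponent.\<close>

lemma abs_det_le_l1_norm:
  "\<bar>det (vec_lambda \<omega>)\<bar> \<le> fact CARD('n) * (1 + l1_norm \<omega>) ^ CARD('n)" for \<omega> :: "'n::finite \<Rightarrow> real^'n"
proof -
  have entry: "\<bar>\<omega> i $ j\<bar> \<le> 1 + l1_norm \<omega>" for i j
  proof -
    have "\<bar>\<omega> i $ j\<bar> \<le> (\<Sum>j\<in>UNIV. \<bar>\<omega> i $ j\<bar>)" by (rule member_le_sum) auto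
    also have "\<dots> \<le> l1_norm \<omega>" unfolding l1_norm_def
      by (rule member_le_sum[of i UNIV "\<lambda>i. \<Sum>j\<in>UNIV. \<bar>\<omega> i $ j\<bar>"]) (auto intro: sum_nonneg)
    finally show ?thesis by simp
  qed
  have "\<bar>det (vec_lambda \<omega>)\<bar> \<le> (\<Sum>\<pi> | \<pi> permutes (UNIV::'n set). \<bar>of_int (sign \<pi>) * (\<Prod>i\<in>UNIV. \<omega> i $ \<pi> i)\<bar>)"
    unfolding det_def by (simp add: sum_abs)
  also have "\<dots> \<le> (\<Sum>\<pi> | \<pi> permutes (UNIV::'n set). (1 + l1_norm \<omega>) ^ CARD('n))"
  proof (rule sum_mono)
    fix \<pi> :: "'n \<Rightarrow> 'n"
    have "\<bar>of_int (sign \<pi>) * (\<Prod>i\<in>UNIV. \<omega> i $ \<pi> i)\<bar> = (\<Prod>i\<in>UNIV. \<bar>\<omega> i $ \<pi> i\<bar>)"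
      by (simp add: abs_mult abs_prod sign_def)
    also have "\<dots> \<le> (\<Prod>i\<in>(UNIV::'n set). 1 + l1_norm \<omega>)" by (intro prod_mono) (simp add: entry)
    finally show "\<bar>of_int (sign \<pi>) * (\<Prod>i\<in>UNIV. \<omega> i $ \<pi> i)\<bar> \<le> (1 + l1_norm \<omega>) ^ CARD('n)" by simp
  qed
  finally show ?thesis by (simp add: card_permutations)
qed

text \<open>The \<open>m\<close>-th power of x <= exp x at x = t/m.\<close>

lemma powr_le_exp: "0 < m \<Longrightarrow> 0 \<le> t \<Longrightarrow> t powr m \<le> m powr m * exp t" for t m :: real
proof -
  assume "0 < m" "0 \<le> t"
  have "t / m \<le> exp (t / m)" using exp_ge_add_one_self[of "t / m"] by linarith
  then have "(t / m) powr m \<le> exp (t / m) powr m" using \<open>0 < m\<close> \<open>0 \<le> t\<close> by (intro powr_mono2) auto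
  also have "\<dots> = exp t" using \<open>0 < m\<close> by (simp add: powr_def)
  finally show ?thesis using \<open>0 < m\<close> \<open>0 \<le> t\<close> by (simp add: powr_divide field_simps)
qed

text \<open>The two signs of \<open>a\<close> pose different problems: for a < 0 the singular
  matrices, settled by the induction over minors; for a >= 0 growth at infinity, settled by a
  polynomial bound on the determinant.\<close>

lemma det_laplace_identity_finite:
  assumes a: "-1 < a"
  shows "det_laplace a (mat 1 :: real^'n^'n) < \<infinity>"
proof (cases "a < 0")
  case True
  let ?N = "(real CARD('n))\<^sup>2"
  have "det_laplace a (mat 1 :: real^'n^'n) \<le> (\<integral>\<^sup>+\<omega>. ennreal (exp ?N) *
      (abs_powr a (partial_det UNIV \<omega>) * ennreal (exp (- l1_norm \<omega>))) \<partial>(lborel_fun :: ('n \<Rightarrow> real^'n) measure))"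
    unfolding det_laplace_def
  proof (rule nn_integral_mono)
    fix \<omega> :: "'n \<Rightarrow> real^'n"
    have l1: "0 \<le> l1_norm \<omega>" by (simp add: l1_norm_def sum_nonneg)
    have e: "exp (- (\<Sum>i\<in>UNIV. \<omega> i \<bullet> (mat 1 *v \<omega> i))) \<le> exp ?N * exp (- l1_norm \<omega>)"
      using sum_squares_ge_l1_norm[of \<omega>] l1 by (simp flip: exp_add)
    have "ennreal (\<bar>det (vec_lambda \<omega>)\<bar> powr a) \<le> abs_powr a (partial_det UNIV \<omega>)"
      by (simp add: abs_powr_def partial_det_UNIV)
    then have "ennreal (\<bar>det (vec_lambda \<omega>)\<bar> powr a) * ennreal (exp (- (\<Sum>i\<in>UNIV. \<omega> i \<bullet> (mat 1 *v \<omega> i))))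
       \<le> abs_powr a (partial_det UNIV \<omega>) * ennreal (exp ?N * exp (- l1_norm \<omega>))"
      using e by (intro mult_mono ennreal_leI) auto
    then show "ennreal (\<bar>det (vec_lambda \<omega>)\<bar> powr a * exp (- (\<Sum>i\<in>UNIV. \<omega> i \<bullet> (mat 1 *v \<omega> i))))
       \<le> ennreal (exp ?N) * (abs_powr a (partial_det UNIV \<omega>) * ennreal (exp (- l1_norm \<omega>)))"
      by (simp add: ennreal_mult mult_ac)
  qed
  also have "\<dots> = ennreal (exp ?N) * (\<integral>\<^sup>+\<omega>. abs_powr a (partial_det UNIV \<omega>) * ennreal (exp (- l1_norm \<omega>))
       \<partial>(lborel_fun :: ('n \<Rightarrow> real^'n) measure))"
    by (rule nn_integral_cmult) measurable
  also have "\<dots> < \<infinity>"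
    using nn_integral_abs_powr_partial_det[OF a True, of "UNIV :: 'n set"] by (simp add: ennreal_mult_less_top)
  finally show ?thesis .
next
  case False
  then have a0: "0 \<le> a" by simp
  let ?n = "real CARD('n)"
  \<comment> \<open>The extra 1 keeps the exponent positive also for a = 0, as
    \<open>powr_le_exp\<close> requires.\<close>
  define m where "m = ?n * a + 1"
  have m: "0 < m" using a0 by (simp add: m_def add_nonneg_pos)
  define C where "C = fact CARD('n) powr a * (m powr m * exp 1) * exp (?n\<^sup>2)"
  have "det_laplace a (mat 1 :: real^'n^'n) \<le> (\<integral>\<^sup>+\<omega>. ennreal C * ennreal (exp (- l1_norm \<omega>))
      \<partial>(lborel_fun :: ('n \<Rightarrow> real^'n) measure))"
    unfolding det_laplace_def
  proof (rule nn_integral_mono)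
    fix \<omega> :: "'n \<Rightarrow> real^'n"
    let ?t = "1 + l1_norm \<omega>"
    have l1: "0 \<le> l1_norm \<omega>" by (simp add: l1_norm_def sum_nonneg)
    have e: "exp (- (\<Sum>i\<in>UNIV. \<omega> i \<bullet> (mat 1 *v \<omega> i))) \<le> exp (?n\<^sup>2) * exp (- 2 * l1_norm \<omega>)"
      using sum_squares_ge_l1_norm[of \<omega>] by (simp flip: exp_add)
    have "\<bar>det (vec_lambda \<omega>)\<bar> powr a \<le> (fact CARD('n) * ?t ^ CARD('n)) powr a"
      using abs_det_le_l1_norm[of \<omega>] a0 by (intro powr_mono2) auto
    also have "\<dots> = fact CARD('n) powr a * ?t powr (?n * a)"
      using l1 by (simp add: powr_mult powr_powr flip: powr_realpow)
    also have "\<dots> \<le> fact CARD('n) powr a * ?t powr m"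
      using l1 by (intro mult_left_mono powr_mono) (auto simp: m_def)
    also have "\<dots> \<le> fact CARD('n) powr a * (m powr m * exp ?t)"
      using l1 m by (intro mult_left_mono powr_le_exp) auto
    finally have "\<bar>det (vec_lambda \<omega>)\<bar> powr a * exp (- (\<Sum>i\<in>UNIV. \<omega> i \<bullet> (mat 1 *v \<omega> i))) \<le>
        fact CARD('n) powr a * (m powr m * exp ?t) * (exp (?n\<^sup>2) * exp (- 2 * l1_norm \<omega>))"
      using e by (intro mult_mono) auto
    also have "\<dots> = C * exp (- l1_norm \<omega>)"
    proof -
      have "exp (- 2 * l1_norm \<omega>) = exp (- l1_norm \<omega>) * exp (- l1_norm \<omega>)" by (simp flip: exp_add)
      then show ?thesis by (simp add: C_def exp_add exp_minus field_simps)
    qed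
    finally show "ennreal (\<bar>det (vec_lambda \<omega>)\<bar> powr a * exp (- (\<Sum>i\<in>UNIV. \<omega> i \<bullet> (mat 1 *v \<omega> i)))) \<le>
        ennreal C * ennreal (exp (- l1_norm \<omega>))"
      by (simp add: ennreal_leI C_def flip: ennreal_mult)
  qed
  also have "\<dots> = ennreal C * (\<integral>\<^sup>+\<omega>. ennreal (exp (- l1_norm \<omega>)) \<partial>(lborel_fun :: ('n \<Rightarrow> real^'n) measure))"
    by (rule nn_integral_cmult) measurable
  also have "\<dots> < \<infinity>" using nn_integral_exp_l1_norm[where 'n='n] by (simp add: ennreal_mult_less_top)
  finally show ?thesis .
qed

text \<open>The integrand is positive off the singular matrices, which are null, and
  \<open>lborel_fun\<close> is not the zero measure.\<close>

lemma det_laplace_identity_pos: "0 < det_laplace a (mat 1 :: real^'n^'n)"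
proof (rule ccontr)
  assume "\<not> ?thesis"
  then have "AE \<omega> in (lborel_fun :: ('n \<Rightarrow> real^'n) measure).
     ennreal (\<bar>det (vec_lambda \<omega>)\<bar> powr a * exp (- (\<Sum>i\<in>UNIV. \<omega> i \<bullet> (mat 1 *v \<omega> i)))) = 0"
    unfolding det_laplace_def by (subst nn_integral_0_iff_AE[symmetric]) auto
  with AE_det_nonzero have "AE \<omega> in (lborel_fun :: ('n \<Rightarrow> real^'n) measure). False"
    by eventually_elim (auto simp: ennreal_eq_0_iff mult_le_0_iff not_le)
  then have "emeasure (lborel_fun :: ('n \<Rightarrow> real^'n) measure) UNIV = 0"
    using AE_iff_measurable[of UNIV "lborel_fun :: ('n \<Rightarrow> real^'n) measure" "\<lambda>_. False"]
    by (auto simp: sets.top[of lborel_fun, simplified])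
  moreover have "(UNIV :: ('n \<Rightarrow> real^'n) set) = Pi\<^sub>E UNIV (\<lambda>_. UNIV)" by auto
  ultimately show False
    using emeasure_lborel_fun_box[of "\<lambda>_::'n. UNIV :: (real^'n) set"] by simp
qed

section \<open>Existence of the Wishart distribution\<close>

text \<open>The total mass of |det X|^(2p - n) exp(-tr X^T X), a multiple of the multivariate Gamma
  function at \<open>p\<close>. With a = 2p - n the exponent -(a + n)/2 of the scaling law becomes
  -p.\<close>

definition wishart_const :: "'n::finite itself \<Rightarrow> real \<Rightarrow> real" where
  "wishart_const _ p = enn2real (det_laplace (2 * p - CARD('n)) (mat 1 :: real^'n^'n))"

lemma wishart_const_pos:
  assumes "p > (real CARD('n) - 1) / 2"
  shows "0 < wishart_const TYPE('n::finite) p"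
  unfolding wishart_const_def enn2real_positive_iff
  using det_laplace_identity_pos[where 'n='n] det_laplace_identity_finite[where 'n='n, of "2 * p - CARD('n)"] assms
  by (simp add: field_simps)

lemma det_laplace_eq:
  fixes s :: "real^'n^'n"
  assumes "p > (real CARD('n) - 1) / 2" "s \<in> pos_def_mats"
  shows "det_laplace (2 * p - CARD('n)) s = ennreal (wishart_const TYPE('n) p * det s powr (- p))"
proof -
  have "det_laplace (2 * p - CARD('n)) (mat 1 :: real^'n^'n) = ennreal (wishart_const TYPE('n) p)"
    unfolding wishart_const_def
    using det_laplace_identity_finite[where 'n='n, of "2 * p - CARD('n)"] assms
    by (simp add: field_simps)
  moreover have "- (2 * p - real CARD('n) + real CARD('n)) / 2 = - p" by simp
  ultimately show ?thesis
    using det_laplace_pos_def[OF assms(2), of "2 * p - CARD('n)"] wishart_const_pos[OF assms(1)]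
    by (simp add: ennreal_mult mult.commute)
qed

text \<open>The law of X^T X under the normalised density. The factor exp(-tr(s u)) changes
  \<open>w\<close> into \<open>w + s\<close>, and (det u)^b = |det X|^(2b) changes \<open>p\<close>
  into \<open>p + b\<close>, so numerator and normalisation are values of the same integral. The
  condition is on \<open>w + s\<close> because \<open>s\<close> is also taken to be 0 or a multiple
  of \<open>outer x\<close>.\<close>

lemma wishart_mixed_moment_exists:
  fixes w :: "real^'n^'n"
  assumes p: "p > (real CARD('n) - 1) / 2" and w: "w \<in> pos_def_mats"
  obtains M :: "(real^'n^'n) measure" where "sets M = sets (restrict_space borel pos_def_mats)"
    and "\<And>b s. 0 \<le> b \<Longrightarrow> w + s \<in> pos_def_mats \<Longrightarrow>
      (\<integral>\<^sup>+u. ennreal (exp (- trace (s ** u)) * det u powr b) \<partial>M) =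
      ennreal (wishart_const TYPE('n) (p + b) * det (w + s) powr (- (p + b)) /
               (wishart_const TYPE('n) p * det w powr (- p)))"
proof -
  define X :: "('n \<Rightarrow> real^'n) \<Rightarrow> real^'n^'n" where "X = vec_lambda"
  define q where "q s \<omega> = (\<Sum>i\<in>UNIV. \<omega> i \<bullet> (s *v \<omega> i))" for s :: "real^'n^'n" and \<omega> :: "'n \<Rightarrow> real^'n"
  \<comment> \<open>The density \<open>d\<close> vanishes on singular matrices because \<open>0 powr a = 0\<close>, so the value \<open>mat 1\<close> is immaterial.\<close>
  define U where "U \<omega> = (if det (X \<omega>) = 0 then mat 1 else transpose (X \<omega>) ** X \<omega>)" for \<omega>
  define c where "c = wishart_const TYPE('n) p * det w powr (- p)"
  have c: "0 < c" using wishart_const_pos[OF p] det_pos_def[OF w] by (simp add: c_def)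
  define d where "d \<omega> = ennreal (\<bar>det (X \<omega>)\<bar> powr (2 * p - CARD('n)) * exp (- q w \<omega>) / c)" for \<omega>
  let ?R = "restrict_space borel (pos_def_mats :: (real^'n^'n) set)"
  define M where "M = distr (density lborel_fun d) ?R U"
  have [measurable]: "X \<in> lborel_fun \<rightarrow>\<^sub>M borel" by (simp add: X_def)
  have [measurable]: "q s \<in> borel_measurable lborel_fun" for s unfolding q_def by measurable
  have [measurable]: "d \<in> borel_measurable lborel_fun" unfolding d_def by measurable
  have gram: "(\<lambda>A::real^'n^'n. transpose A ** A) \<in> borel_measurable borel"
    unfolding matrix_matrix_mult_def transpose_def
    by (intro borel_measurable_continuous_onI continuous_intros)
  have Upd: "U \<omega> \<in> pos_def_mats" for \<omega>
    using gram_in_pos_def_mats[of "X \<omega>"] by (simp add: U_def mat_1_pos_def)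
  have Um: "U \<in> lborel_fun \<rightarrow>\<^sub>M ?R"
  proof (rule measurable_restrict_space2)
    show "U \<in> lborel_fun \<rightarrow>\<^sub>M borel" unfolding U_def using gram by measurable
  qed (use Upd in auto)
  then have Um' [measurable]: "U \<in> density lborel_fun d \<rightarrow>\<^sub>M ?R" by simp
  show ?thesis
  proof (rule that[of M])
    show "sets M = sets ?R" by (simp add: M_def)
  next
    fix b :: real and s :: "real^'n^'n" assume b: "0 \<le> b" and ws: "w + s \<in> pos_def_mats"
    have tr: "(\<lambda>u::real^'n^'n. exp (- trace (s ** u)) * det u powr b) \<in> borel_measurable borel"
    proof -
      have [measurable]: "(\<lambda>u::real^'n^'n. trace (s ** u)) \<in> borel_measurable borel"
        unfolding trace_def matrix_matrix_mult_def
        by (intro borel_measurable_continuous_onI continuous_intros)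
      show ?thesis by measurable
    qed
    then have [measurable]: "(\<lambda>u::real^'n^'n. ennreal (exp (- trace (s ** u)) * det u powr b)) \<in> borel_measurable ?R"
      by (intro measurable_restrict_space1) simp
    have Fm: "(\<lambda>\<omega>. ennreal (exp (- trace (s ** U \<omega>)) * det (U \<omega>) powr b)) \<in> borel_measurable lborel_fun"
      by (rule measurable_compose[OF Um]) measurable
    have "(\<integral>\<^sup>+u. ennreal (exp (- trace (s ** u)) * det u powr b) \<partial>M) =
        (\<integral>\<^sup>+\<omega>. d \<omega> * ennreal (exp (- trace (s ** U \<omega>)) * det (U \<omega>) powr b) \<partial>lborel_fun)"
      unfolding M_def
      by (subst nn_integral_distr[OF Um'], measurable, subst nn_integral_density[OF _ Fm]) auto
    also have "\<dots> = (\<integral>\<^sup>+\<omega>. ennreal (\<bar>det (X \<omega>)\<bar> powr (2 * (p + b) - CARD('n)) * exp (- q (w + s) \<omega>)) * ennreal (1 / c) \<partial>lborel_fun)"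
    proof (rule nn_integral_cong)
      fix \<omega>
      show "d \<omega> * ennreal (exp (- trace (s ** U \<omega>)) * det (U \<omega>) powr b) =
         ennreal (\<bar>det (X \<omega>)\<bar> powr (2 * (p + b) - CARD('n)) * exp (- q (w + s) \<omega>)) * ennreal (1 / c)"
      proof (cases "det (X \<omega>) = 0")
        case True
        then show ?thesis by (simp add: d_def)
      next
        case False
        then have "trace (s ** U \<omega>) = q s \<omega>"
          by (simp add: U_def X_def q_def trace_mult_gram)
        moreover have "det (U \<omega>) powr b = \<bar>det (X \<omega>)\<bar> powr (2 * b)"
        proof -
          have "det (U \<omega>) = \<bar>det (X \<omega>)\<bar> powr 2" using False by (simp add: U_def det_mul power2_eq_square)
          then show ?thesis by (simp only: powr_powr)
        qed
        moreover have "exp (- q (w + s) \<omega>) = exp (- q w \<omega>) * exp (- q s \<omega>)"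
          by (simp add: q_def matrix_vector_mult_add_rdistrib inner_add_right sum.distrib flip: exp_add)
        moreover have "2 * (p + b) - real CARD('n) = (2 * p - CARD('n)) + 2 * b" by simp
        ultimately show ?thesis
          using c by (simp only: d_def powr_add flip: ennreal_mult) (simp add: mult_ac flip: ennreal_mult)
      qed
    qed
    also have "\<dots> = (\<integral>\<^sup>+\<omega>. ennreal (\<bar>det (X \<omega>)\<bar> powr (2 * (p + b) - CARD('n)) * exp (- q (w + s) \<omega>)) \<partial>lborel_fun) * ennreal (1 / c)"
      by (rule nn_integral_multc) measurable
    also have "(\<integral>\<^sup>+\<omega>. ennreal (\<bar>det (X \<omega>)\<bar> powr (2 * (p + b) - CARD('n)) * exp (- q (w + s) \<omega>)) \<partial>lborel_fun)
        = det_laplace (2 * (p + b) - CARD('n)) (w + s)"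
      by (simp add: det_laplace_def X_def q_def)
    also have "\<dots> = ennreal (wishart_const TYPE('n) (p + b) * det (w + s) powr (- (p + b)))"
      using p b ws by (intro det_laplace_eq) auto
    finally show "(\<integral>\<^sup>+u. ennreal (exp (- trace (s ** u)) * det u powr b) \<partial>M) =
      ennreal (wishart_const TYPE('n) (p + b) * det (w + s) powr (- (p + b)) /
               (wishart_const TYPE('n) p * det w powr (- p)))"
      using c by (simp add: c_def flip: ennreal_mult'')
  qed
qed

section \<open>Laplace transforms on the cone of positive definite matrices\<close>

text \<open>Writing u = B B^T makes the trace a sum of values of the quadratic form of
  \<open>s\<close> at the columns of \<open>B\<close>.\<close>

lemma trace_pos_def_mult_nonneg:
  fixes s u :: "real^'n^'n"
  assumes "s \<in> pos_def_mats" "u \<in> pos_def_mats"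
  shows "0 \<le> trace (s ** u)"
proof -
  obtain w where w: "w \<in> pos_def_mats" "u ** w = mat 1" "w ** u = mat 1"
    using pos_def_inverse[OF assms(2)] by blast
  obtain B :: "real^'n^'n" where B: "transpose B ** w ** B = mat 1"
    by (rule pos_def_congruent_identity[OF w(1)]) blast
  then have "B ** (transpose B ** w) = mat 1" using matrix_left_right_inverse by blast
  then have "(B ** transpose B ** w) ** u = u" by (simp add: matrix_mul_assoc)
  then have "u = B ** transpose B" using w(3) by (simp flip: matrix_mul_assoc)
  then have "trace (s ** u) = (\<Sum>i\<in>UNIV. (transpose B $ i) \<bullet> (s *v (transpose B $ i)))"
    using trace_mult_gram[of s "\<lambda>i. transpose B $ i"] by (simp add: vec_lambda_eta)
  then show ?thesis using pos_def_mats_nonneg[OF assms(1)] by (simp add: sum_nonneg)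
qed

text \<open>The algebra generated by the functions on which two measures with equal Laplace
  transforms agree. The matrix 0 lies outside the open cone and is adjoined to supply the constants;
  for it agreement means equal total mass.\<close>

inductive_set exp_span :: "(real^'n^'n \<Rightarrow> real) set" where
  exp_span_base: "s \<in> insert 0 pos_def_mats \<Longrightarrow> (\<lambda>u. exp (- trace (s ** u))) \<in> exp_span"
| exp_span_add: "f \<in> exp_span \<Longrightarrow> g \<in> exp_span \<Longrightarrow> (\<lambda>u. f u + g u) \<in> exp_span"
| exp_span_scale: "f \<in> exp_span \<Longrightarrow> (\<lambda>u. c * f u) \<in> exp_span"

lemma trace_zero [simp]: "trace (0::real^'n^'n) = 0"
  by (simp add: trace_def)

lemma exp_span_const: "(\<lambda>u. c) \<in> exp_span"
  using exp_span_scale[OF exp_span_base[of 0], of c] by simp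

lemma exp_span_sum:
  assumes "\<And>i. i \<in> I \<Longrightarrow> f i \<in> exp_span"
  shows "(\<lambda>u. \<Sum>i\<in>I. f i u) \<in> exp_span"
  using assms by (induction I rule: infinite_finite_induct) (auto intro: exp_span_add exp_span_const)

text \<open>Two exponentials multiply to the exponential of the sum of their parameters, and the
  cone with 0 adjoined is closed under addition. Bilinearity is handled by nested
  inductions.\<close>

lemma exp_span_mult:
  assumes "f \<in> exp_span" "g \<in> exp_span"
  shows "(\<lambda>u. f u * g u) \<in> exp_span"
  using assms(1)
proof induction
  case (exp_span_base s)
  from assms(2) show ?case
  proof induction
    case (exp_span_base t)
    have "s + t \<in> insert 0 pos_def_mats"
      using exp_span_base \<open>s \<in> insert 0 pos_def_mats\<close> by (auto intro: pos_def_mats_add)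
    then have "(\<lambda>u. exp (- trace ((s + t) ** u))) \<in> exp_span" by (rule exp_span.intros)
    moreover have "exp (- trace ((s + t) ** u)) = exp (- trace (s ** u)) * exp (- trace (t ** u))" for u
      by (simp add: matrix_add_rdistrib trace_add flip: exp_add)
    ultimately show ?case by simp
  next
    case (exp_span_add g h)
    then show ?case using exp_span.exp_span_add by (simp add: distrib_left)
  next
    case (exp_span_scale g c)
    then show ?case using exp_span.exp_span_scale[OF exp_span_scale.IH, of c] by (simp add: mult_ac)
  qed
next
  case (exp_span_add f h)
  then show ?case using exp_span.exp_span_add by (simp add: distrib_right)
next
  case (exp_span_scale f c)
  then show ?case using exp_span.exp_span_scale[OF exp_span_scale.IH, of c] by (simp add: mult_ac)
qed

section \<open>Embedding the cone into a cube, and uniqueness\<close>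

text \<open>The symmetrized elementary matrix, which alone is not positive definite off the
  diagonal, plus twice the identity. Its quadratic form is 2|x|^2 + x_i x_j, positive since |x_i
  x_j| <= |x|^2.\<close>

definition entry_form :: "'n \<Rightarrow> 'n \<Rightarrow> real^'n^'n" where
  "entry_form i j = (\<chi> k l. 2 * of_bool (k = l) +
     (of_bool (k = i \<and> l = j) + of_bool (k = j \<and> l = i)) / 2)"

lemma entry_form_mult:
  fixes x :: "real^'n"
  shows "entry_form i j *v x = 2 *\<^sub>R x + (1/2) *\<^sub>R (x $ j *\<^sub>R axis i 1 + x $ i *\<^sub>R axis j 1)"
proof -
  have "(\<Sum>l\<in>UNIV. (2 * of_bool (k = l) + (of_bool (k = i \<and> l = j) + of_bool (k = j \<and> l = i)) / 2) * x $ l)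
    = (\<Sum>l\<in>UNIV. (if l = k then 2 * x $ k else 0) + (if l = j then of_bool (k = i) * x $ j / 2 else 0)
        + (if l = i then of_bool (k = j) * x $ i / 2 else 0))" for k
    by (rule sum.cong) auto
  then show ?thesis
    by (auto simp: vec_eq_iff entry_form_def matrix_vector_mult_def sum.distrib axis_def field_simps)
qed

lemma entry_form_pos_def: "entry_form i j \<in> (pos_def_mats :: (real^'n^'n) set)"
proof -
  have "0 < x \<bullet> (entry_form i j *v x)" if "x \<noteq> 0" for x :: "real^'n"
  proof -
    have "x \<bullet> (entry_form i j *v x) = 2 * (x \<bullet> x) + x $ i * x $ j"
      by (simp add: entry_form_mult inner_add_right inner_axis)
    moreover have "\<bar>x $ i * x $ j\<bar> \<le> x \<bullet> x"
    proof -
      have "\<bar>x $ i\<bar> * \<bar>x $ j\<bar> \<le> norm x * norm x"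
        by (intro mult_mono component_le_norm_cart) auto
      then show ?thesis by (simp add: abs_mult dot_square_norm power2_eq_square)
    qed
    moreover have "0 < x \<bullet> x" using that by simp
    ultimately show ?thesis by linarith
  qed
  moreover have "entry_form i j \<in> sym_mats"
    by (auto simp: sym_mats_def entry_form_def transpose_def vec_eq_iff)
  ultimately show ?thesis by (simp add: pos_def_mats_def)
qed

text \<open>Hence a symmetric matrix is recovered linearly from its traces against the \<^const>\<open>entry_form\<close>s.\<close>

lemma trace_entry_form:
  fixes u :: "real^'n^'n"
  assumes "u \<in> sym_mats"
  shows "trace (entry_form i j ** u) = 2 * trace u + u $ i $ j"
proof -
  have "trace (entry_form i j ** u) = (\<Sum>l\<in>UNIV. (entry_form i j *v (\<chi> k. u $ k $ l)) $ l)"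
    by (simp add: trace_def matrix_matrix_mult_def matrix_vector_mult_def)
  also have "\<dots> = (\<Sum>l\<in>UNIV. 2 * u $ l $ l + (if l = i then u $ j $ i / 2 else 0) + (if l = j then u $ i $ j / 2 else 0))"
    by (rule sum.cong) (auto simp: entry_form_mult axis_def)
  also have "u $ j $ i = u $ i $ j"
    using assms by (auto simp: sym_mats_def transpose_def vec_eq_iff)
  finally show ?thesis by (simp add: sum.distrib trace_def sum_distrib_left)
qed

text \<open>Each coordinate belongs to \<open>exp_span\<close> and takes values in [0, 1] on the
  cone. Polynomials in these coordinates are therefore integrated alike by both measures, and the
  cube supplies the compactness needed for Weierstrass approximation.\<close>

definition exp_embed :: "real^'n^'n \<Rightarrow> real^'n^'n" where
  "exp_embed u = (\<chi> i j. exp (- trace (entry_form i j ** u)))"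

text \<open>A measurable left inverse on symmetric matrices. There -ln z_ij = 2 tr u + u_ij; summing
  over the diagonal gives (2n + 1) tr u, whence the coefficient 2/(2n + 1) that cancels 2 tr
  u.\<close>

definition exp_unembed :: "real^'n^'n \<Rightarrow> real^'n^'n" where
  "exp_unembed z = (\<chi> i j. - ln (z $ i $ j) + 2 / (2 * real CARD('n) + 1) * (\<Sum>k\<in>UNIV. ln (z $ k $ k)))"

lemma exp_unembed_embed:
  fixes u :: "real^'n^'n"
  assumes "u \<in> sym_mats" shows "exp_unembed (exp_embed u) = u"
proof -
  have nz: "2 * real CARD('n) + 1 \<noteq> 0" by (simp add: add_pos_nonneg)
  have "(\<Sum>k\<in>UNIV. ln (exp_embed u $ k $ k)) = - ((2 * real CARD('n) + 1) * trace u)"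
  proof -
    have "ln (exp_embed u $ k $ k) = - 2 * trace u - u $ k $ k" for k
      by (simp add: exp_embed_def trace_entry_form[OF assms])
    then have "(\<Sum>k\<in>UNIV. ln (exp_embed u $ k $ k)) = - 2 * (real CARD('n) * trace u) - (\<Sum>k\<in>UNIV. u $ k $ k)"
      by (simp add: sum_subtractf)
    then show ?thesis by (simp add: algebra_simps flip: trace_def)
  qed
  then have "2 / (2 * real CARD('n) + 1) * (\<Sum>k\<in>UNIV. ln (exp_embed u $ k $ k)) = - (2 * trace u)"
    using nz by simp
  then show ?thesis
    unfolding exp_unembed_def by (simp add: vec_eq_iff exp_embed_def trace_entry_form[OF assms])
qed

lemma exp_embed_in_cbox:
  assumes "u \<in> pos_def_mats" shows "exp_embed u \<in> cbox 0 (\<chi> i j. 1)"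
  using trace_pos_def_mult_nonneg[OF entry_form_pos_def assms]
  by (auto simp: mem_box Basis_vec_def inner_axis exp_embed_def)

lemma polynomial_exp_embed_in_exp_span:
  fixes q :: "real^'n^'n \<Rightarrow> real"
  assumes "real_polynomial_function q"
  shows "(\<lambda>u. q (exp_embed u)) \<in> exp_span"
  using assms
proof induction
  case (linear q)
  have rep: "q z = (\<Sum>b\<in>Basis. (z \<bullet> b) * q b)" for z
  proof -
    have "q z = q (\<Sum>b\<in>Basis. (z \<bullet> b) *\<^sub>R b)" by (simp add: euclidean_representation)
    also have "\<dots> = (\<Sum>b\<in>Basis. (z \<bullet> b) * q b)"
      using linear by (simp add: bounded_linear.linear linear_sum linear_cmul)
    finally show ?thesis .
  qed
  have "(\<lambda>u. \<Sum>b\<in>Basis. (exp_embed u \<bullet> b) * q b) \<in> exp_span"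
  proof (rule exp_span_sum)
    fix b :: "real^'n^'n" assume "b \<in> Basis"
    then obtain i j where "b = axis i (axis j 1)" by (auto simp: Basis_vec_def)
    then have "(exp_embed u \<bullet> b) * q b = q b * exp (- trace (entry_form i j ** u))" for u
      by (simp add: inner_axis exp_embed_def)
    moreover have "(\<lambda>u. q b * exp (- trace (entry_form i j ** u))) \<in> exp_span"
      by (intro exp_span_scale exp_span_base) (simp add: entry_form_pos_def)
    ultimately show "(\<lambda>u. (exp_embed u \<bullet> b) * q b) \<in> exp_span" by (simp only:)
  qed
  then show ?case by (subst rep)
qed (auto intro: exp_span_const exp_span_add exp_span_mult)

lemma borel_measurable_trace_mult [measurable]:
  "(\<lambda>u. trace ((s::real^'n^'n) ** u)) \<in> borel_measurable borel"
  unfolding trace_def matrix_matrix_mult_def by (intro borel_measurable_continuous_onI continuous_intros)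

lemma borel_measurable_exp_embed [measurable]: "exp_embed \<in> borel_measurable borel"
  unfolding exp_embed_def by (intro borel_measurable_vecI) simp

lemma borel_measurable_exp_unembed [measurable]: "exp_unembed \<in> borel_measurable borel"
proof -
  have [measurable]: "(\<lambda>z::real^'n^'n. z $ i $ j) \<in> borel_measurable borel" for i j
    by (intro borel_measurable_continuous_onI continuous_intros)
  show ?thesis unfolding exp_unembed_def by (intro borel_measurable_vecI) simp
qed

lemma borel_measurable_restrict_pos_def:
  assumes "sets M = sets (restrict_space borel pos_def_mats)" "f \<in> borel \<rightarrow>\<^sub>M N"
  shows "f \<in> M \<rightarrow>\<^sub>M N"
  using measurable_restrict_space1[OF assms(2), of pos_def_mats] assms(1)
  by (simp cong: measurable_cong_sets)

lemma space_restrict_pos_def: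
  assumes "sets M = sets (restrict_space borel pos_def_mats)"
  shows "space M = pos_def_mats"
  using sets_eq_imp_space_eq[OF assms] by (simp add: space_restrict_space)

lemma exp_span_integrable:
  assumes "prob_space M" and M: "sets M = sets (restrict_space borel pos_def_mats)" and "f \<in> exp_span"
  shows "integrable M f"
  using assms(3)
proof induction
  case (exp_span_base s)
  interpret prob_space M by fact
  show ?case
  proof (rule integrable_const_bound[where B = 1])
    show "AE u in M. norm (exp (- trace (s ** u))) \<le> 1"
      using exp_span_base trace_pos_def_mult_nonneg[of s] by (auto simp: space_restrict_pos_def[OF M])
  qed (rule borel_measurable_restrict_pos_def[OF M], measurable)
qed auto

lemma laplace_transform_eq_exp_span:
  assumes "prob_space M" "sets M = sets (restrict_space borel pos_def_mats)"
    and "prob_space N" "sets N = sets (restrict_space borel pos_def_mats)"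
    and eq: "\<And>s. s \<in> pos_def_mats \<Longrightarrow> (\<integral>u. exp (- trace (s ** u)) \<partial>M) = (\<integral>u. exp (- trace (s ** u)) \<partial>N)"
    and "f \<in> exp_span"
  shows "(\<integral>u. f u \<partial>M) = (\<integral>u. f u \<partial>N)"
  using assms(6)
proof induction
  case (exp_span_base s)
  then show ?case using eq assms(1,3) by (auto simp: prob_space.prob_space)
qed (simp_all add: exp_span_integrable[OF assms(1,2)] exp_span_integrable[OF assms(3,4)])

text \<open>Polynomials approximate \<open>f\<close> uniformly on the cube, and only there; this is
  enough because the measures live on the cone, which \<open>exp_embed\<close> maps into the cube.
  Each measure contributes half of the error.\<close>

lemma laplace_transform_eq_continuous:
  fixes f :: "real^'n^'n \<Rightarrow> real"
  assumes M: "prob_space M" "sets M = sets (restrict_space borel pos_def_mats)"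
    and N: "prob_space N" "sets N = sets (restrict_space borel pos_def_mats)"
    and eq: "\<And>s. s \<in> pos_def_mats \<Longrightarrow> (\<integral>u. exp (- trace (s ** u)) \<partial>M) = (\<integral>u. exp (- trace (s ** u)) \<partial>N)"
    and f: "continuous_on UNIV f" and bd: "\<And>x. \<bar>f x\<bar> \<le> 1"
  shows "(\<integral>u. f (exp_embed u) \<partial>M) = (\<integral>u. f (exp_embed u) \<partial>N)"
proof -
  let ?K = "cbox 0 (\<chi> i j. 1) :: (real^'n^'n) set"
  have close: "\<bar>(\<integral>u. f (exp_embed u) \<partial>L) - (\<integral>u. q (exp_embed u) \<partial>L)\<bar> \<le> e"
    if L: "prob_space L" "sets L = sets (restrict_space borel pos_def_mats)" and q: "real_polynomial_function q"
      and qe: "\<And>x. x \<in> ?K \<Longrightarrow> \<bar>f x - q x\<bar> < e" for L q e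
  proof -
    interpret prob_space L by fact
    have [measurable]: "f \<in> borel_measurable borel" using f by (rule borel_measurable_continuous_onI)
    have fi: "integrable L (\<lambda>u. f (exp_embed u))"
      by (rule integrable_const_bound[where B = 1])
         (use bd in \<open>auto intro!: borel_measurable_restrict_pos_def[OF L(2)]\<close>)
    have qi: "integrable L (\<lambda>u. q (exp_embed u))"
      by (rule exp_span_integrable[OF L polynomial_exp_embed_in_exp_span[OF q]])
    have "\<bar>\<integral>u. f (exp_embed u) - q (exp_embed u) \<partial>L\<bar> \<le> (\<integral>u. \<bar>f (exp_embed u) - q (exp_embed u)\<bar> \<partial>L)"
      using integral_norm_bound[of L "\<lambda>u. f (exp_embed u) - q (exp_embed u)"] by simp
    also have "\<dots> \<le> (\<integral>u. e \<partial>L)"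
      using fi qi exp_embed_in_cbox
      by (intro integral_mono) (auto simp: space_restrict_pos_def[OF L(2)] intro!: less_imp_le[OF qe])
    finally show ?thesis using fi qi by (simp add: prob_space)
  qed
  have "\<bar>(\<integral>u. f (exp_embed u) \<partial>M) - (\<integral>u. f (exp_embed u) \<partial>N)\<bar> \<le> e" if e: "e > 0" for e
  proof -
    obtain q where q: "real_polynomial_function q" "\<And>x. x \<in> ?K \<Longrightarrow> \<bar>f x - q x\<bar> < e / 2"
      by (rule Stone_Weierstrass_real_polynomial_function[of ?K f "e / 2"])
         (use e continuous_on_subset[OF f] in auto)
    have "(\<integral>u. q (exp_embed u) \<partial>M) = (\<integral>u. q (exp_embed u) \<partial>N)"
      by (rule laplace_transform_eq_exp_span[OF M N eq polynomial_exp_embed_in_exp_span[OF q(1)]])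
    then show ?thesis using close[OF M q] close[OF N q] by linarith
  qed
  then have "\<bar>(\<integral>u. f (exp_embed u) \<partial>M) - (\<integral>u. f (exp_embed u) \<partial>N)\<bar> \<le> 0" by (rule field_le_epsilon[where y = 0, simplified])
  then show ?thesis by simp
qed

text \<open>The images under \<open>exp_embed\<close> agree on closed sets, as limits of continuous
  functions, hence on all Borel sets, since closed sets form an intersection-stable generator.
  Injectivity with a measurable inverse carries this back to the cone.\<close>

lemma laplace_transform_determines_measure:
  fixes M N :: "(real^'n^'n) measure"
  assumes M: "prob_space M" "sets M = sets (restrict_space borel pos_def_mats)"
    and N: "prob_space N" "sets N = sets (restrict_space borel pos_def_mats)"
    and eq: "\<And>s. s \<in> pos_def_mats \<Longrightarrow> (\<integral>u. exp (- trace (s ** u)) \<partial>M) = (\<integral>u. exp (- trace (s ** u)) \<partial>N)"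
  shows "M = N"
proof -
  have em [measurable]: "exp_embed \<in> M \<rightarrow>\<^sub>M borel" "exp_embed \<in> N \<rightarrow>\<^sub>M borel"
    by (rule borel_measurable_restrict_pos_def[OF M(2) borel_measurable_exp_embed]
             borel_measurable_restrict_pos_def[OF N(2) borel_measurable_exp_embed])+
  interpret M: prob_space M by fact
  interpret N: prob_space N by fact
  interpret M': prob_space "distr M borel exp_embed" by (rule M.prob_space_distr) simp
  interpret N': prob_space "distr N borel exp_embed" by (rule N.prob_space_distr) simp
  have closed: "measure (distr M borel exp_embed) C = measure (distr N borel exp_embed) C" if C: "closed C" for C
  \<comment> \<open>The empty set is separated because \<open>infdist x {}\<close> is 0: the
    functions below would be constantly 1 instead of tending to its indicator.\<close>
  proof (cases "C = {}")
    case False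
    define f where "f k x = max 0 (1 - real k * infdist x C)" for k and x :: "real^'n^'n"
    have cont: "continuous_on UNIV (f k)" for k unfolding f_def by (intro continuous_intros)
    have bd: "\<bar>f k x\<bar> \<le> 1" for k x by (simp add: f_def infdist_nonneg)
    have lim: "(\<lambda>k. f k x) \<longlonglongrightarrow> indicator C x" for x
    proof (cases "x \<in> C")
      case True
      then show ?thesis by (simp add: f_def)
    next
      case x: False
      then have pos: "0 < infdist x C" using C False infdist_nonneg[of x C] in_closed_iff_infdist_zero by fastforce
      obtain k0 where k0: "1 < real k0 * infdist x C" using reals_Archimedean3[OF pos] by blast
      have "f k x = 0" if "k \<ge> k0" for k
      proof -
        have "real k0 * infdist x C \<le> real k * infdist x C" using that pos by (intro mult_right_mono) auto
        then show ?thesis using k0 by (simp add: f_def)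
      qed
      then have "\<forall>\<^sub>F k in sequentially. f k x = 0" by (auto simp: eventually_sequentially)
      then show ?thesis using x by (simp add: tendsto_eventually)
    qed
    have conv: "(\<lambda>k. \<integral>u. f k (exp_embed u) \<partial>L) \<longlonglongrightarrow> measure (distr L borel exp_embed) C"
      if L: "prob_space L" and [measurable]: "exp_embed \<in> L \<rightarrow>\<^sub>M borel" for L
    proof -
      interpret L: prob_space L by fact
      have [measurable]: "f k \<in> borel_measurable borel" for k using cont by (rule borel_measurable_continuous_onI)
      have [measurable]: "C \<in> sets borel" using C by simp
      have "(\<lambda>k. \<integral>u. f k (exp_embed u) \<partial>L) \<longlonglongrightarrow> (\<integral>u. indicator C (exp_embed u) \<partial>L)"
        by (rule integral_dominated_convergence[where w = "\<lambda>_. 1"]) (use bd lim in auto)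
      also have "(\<integral>u. indicator C (exp_embed u) \<partial>L) = (\<integral>u. indicator (exp_embed -` C \<inter> space L) u \<partial>L)"
        by (rule Bochner_Integration.integral_cong) (auto simp: indicator_def)
      also have "\<dots> = measure (distr L borel exp_embed) C"
        by (simp add: measure_distr)
      finally show ?thesis .
    qed
    have "(\<integral>u. f k (exp_embed u) \<partial>M) = (\<integral>u. f k (exp_embed u) \<partial>N)" for k
      by (rule laplace_transform_eq_continuous[OF M N eq cont bd])
    then show ?thesis using LIMSEQ_unique[OF conv[OF M(1) em(1)]] conv[OF N(1) em(2)] by simp
  qed simp
  have distr_eq: "distr M borel exp_embed = distr N borel exp_embed"
  proof (rule measure_eqI_generator_eq[where E = "Collect closed" and \<Omega> = UNIV and A = "\<lambda>_. UNIV"])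
    show "Int_stable (Collect closed :: (real^'n^'n) set set)" by (auto simp: Int_stable_def)
    show "emeasure (distr M borel exp_embed) X = emeasure (distr N borel exp_embed) X" if "X \<in> Collect closed" for X
      using closed that by (simp add: M'.emeasure_eq_measure N'.emeasure_eq_measure)
    have "sets borel = sigma_sets UNIV (Collect closed :: (real^'n^'n) set set)"
      by (subst borel_eq_closed) simp
    then show "sets (distr M borel exp_embed) = sigma_sets UNIV (Collect closed)"
      "sets (distr N borel exp_embed) = sigma_sets UNIV (Collect closed)" by simp_all
  qed auto
  show ?thesis
  proof (rule measure_eqI)
    show "sets M = sets N" using M N by simp
    fix A assume "A \<in> sets M"
    then obtain B where B: "B \<in> sets borel" "A = pos_def_mats \<inter> B"
      using M(2) by (auto simp: sets_restrict_space)
    \<comment> \<open>Since \<open>exp_unembed\<close> undoes \<open>exp_embed\<close> on the cone,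
      every measurable subset is a preimage under \<open>exp_embed\<close>.\<close>
    have "A = exp_embed -` (exp_unembed -` B) \<inter> pos_def_mats"
      unfolding B(2) using exp_unembed_embed pos_def_mats_sym by fastforce
    moreover have "exp_unembed -` B \<in> sets borel"
      using measurable_sets[OF borel_measurable_exp_unembed B(1)] by simp
    ultimately have "emeasure M A = emeasure (distr M borel exp_embed) (exp_unembed -` B)"
      "emeasure N A = emeasure (distr N borel exp_embed) (exp_unembed -` B)"
      by (simp_all add: emeasure_distr space_restrict_pos_def[OF M(2)] space_restrict_pos_def[OF N(2)])
    then show "emeasure M A = emeasure N A" by (simp add: distr_eq)
  qed
qed

section \<open>The mixture density and its moments\<close>

text \<open>Here \<open>w\<close> is the inverse of \<sigma>. The measure built from Gram matrices
  has the required transform because w + s = w (1 + \<sigma> s), so that the ratio of determinants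
  is det(1 + \<sigma> s); uniqueness then identifies it with the definite description.\<close>

lemma
  fixes \<sigma> w :: "real^'n^'n"
  assumes p: "p > (real CARD('n) - 1) / 2" and w: "w \<in> pos_def_mats" and inv: "w ** \<sigma> = mat 1"
  shows is_wishart_wishart: "is_wishart p \<sigma> (wishart p \<sigma>)"
    and wishart_mixed_moment: "\<And>b s. 0 \<le> b \<Longrightarrow> w + s \<in> pos_def_mats \<Longrightarrow>
      (\<integral>\<^sup>+u. ennreal (exp (- trace (s ** u)) * det u powr b) \<partial>wishart p \<sigma>) =
      ennreal (wishart_const TYPE('n) (p + b) * det (w + s) powr (- (p + b)) /
               (wishart_const TYPE('n) p * det w powr (- p)))"
proof -
  obtain M :: "(real^'n^'n) measure" where sets_M: "sets M = sets (restrict_space borel pos_def_mats)"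
    and mom: "\<And>b s. 0 \<le> b \<Longrightarrow> w + s \<in> pos_def_mats \<Longrightarrow>
      (\<integral>\<^sup>+u. ennreal (exp (- trace (s ** u)) * det u powr b) \<partial>M) =
      ennreal (wishart_const TYPE('n) (p + b) * det (w + s) powr (- (p + b)) /
               (wishart_const TYPE('n) p * det w powr (- p)))"
    using wishart_mixed_moment_exists[OF p w] by blast
  note space_M = space_restrict_pos_def[OF sets_M]
  have c: "0 < wishart_const TYPE('n) p" by (rule wishart_const_pos[OF p])
  have dw: "0 < det w" by (rule det_pos_def[OF w])
  have lap: "(\<integral>\<^sup>+u. ennreal (exp (- trace (s ** u))) \<partial>M) = ennreal (det (mat 1 + \<sigma> ** s) powr (- p))"
    if ws: "w + s \<in> pos_def_mats" for s
  proof -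
    \<comment> \<open>Inserting \<open>det u powr 0\<close> is harmless only because det u > 0 on
      the cone; at 0 this power is 0.\<close>
    have "(\<integral>\<^sup>+u. ennreal (exp (- trace (s ** u))) \<partial>M) =
        (\<integral>\<^sup>+u. ennreal (exp (- trace (s ** u)) * det u powr 0) \<partial>M)"
      by (intro nn_integral_cong) (use det_pos_def in \<open>force simp: space_M\<close>)
    also have "\<dots> = ennreal (det (w + s) powr (- p) / det w powr (- p))"
      using mom[OF order_refl ws] c by simp
    also have "w + s = w ** (mat 1 + \<sigma> ** s)" by (simp add: matrix_add_ldistrib matrix_mul_assoc inv)
    also have "det \<dots> = det w * det (mat 1 + \<sigma> ** s)" by (rule det_mul)
    finally have 1: "(\<integral>\<^sup>+u. ennreal (exp (- trace (s ** u))) \<partial>M) =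
        ennreal ((det w * det (mat 1 + \<sigma> ** s)) powr (- p) / det w powr (- p))" .
    have "0 < det (w ** (mat 1 + \<sigma> ** s))"
      using det_pos_def[OF ws] by (simp add: matrix_add_ldistrib matrix_mul_assoc inv)
    then have "0 < det (mat 1 + \<sigma> ** s)" using dw by (simp add: det_mul zero_less_mult_iff)
    then show ?thesis using 1 dw by (simp add: powr_mult)
  qed
  \<comment> \<open>The case s = 0, outside the cone, gives the total mass.\<close>
  have prob: "prob_space M"
    using lap[of 0] w by (intro prob_spaceI) simp
  have "(\<integral>u. exp (- trace (s ** u)) \<partial>M) = det (mat 1 + \<sigma> ** s) powr (- p)" if "s \<in> pos_def_mats" for s
    using lap[OF pos_def_mats_add[OF w that]]
    by (subst integral_eq_nn_integral) (auto intro!: borel_measurable_restrict_pos_def[OF sets_M])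
  then have isM: "is_wishart p \<sigma> M" using prob sets_M by (simp add: is_wishart_def)
  have "wishart p \<sigma> = M" unfolding wishart_def
  proof (rule the_equality)
    show "is_wishart p \<sigma> M" by (rule isM)
  next
    fix N assume "is_wishart p \<sigma> N"
    then show "N = M" using isM unfolding is_wishart_def
      by (intro laplace_transform_determines_measure) auto
  qed
  then show "is_wishart p \<sigma> (wishart p \<sigma>)"
    and "\<And>b s. 0 \<le> b \<Longrightarrow> w + s \<in> pos_def_mats \<Longrightarrow>
      (\<integral>\<^sup>+u. ennreal (exp (- trace (s ** u)) * det u powr b) \<partial>wishart p \<sigma>) =
      ennreal (wishart_const TYPE('n) (p + b) * det (w + s) powr (- (p + b)) /
               (wishart_const TYPE('n) p * det w powr (- p)))"
    using isM mom by auto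
qed

text \<open>The factor of the mixture density that depends on neither x nor \<sigma>. Its closed
  form comes later, from normalisation, in \<open>mix_const_eq\<close>.\<close>

definition mix_const :: "'n::finite itself \<Rightarrow> real \<Rightarrow> real" where
  "mix_const N p = wishart_const N (p + 1/2) / wishart_const N p / (2 * pi) powr (real CARD('n) / 2)"

lemma mix_const_pos:
  assumes "p > (real CARD('n) - 1) / 2"
  shows "0 < mix_const TYPE('n::finite) p"
  using wishart_const_pos[OF assms] wishart_const_pos[where 'n='n, of "p + 1/2"] assms
  by (simp add: mix_const_def)

lemma trace_half_outer_mult: "trace (((1/2) *\<^sub>R outer x) ** u) = x \<bullet> (u *v x) / 2"
proof -
  have "trace ((1/2) *\<^sub>R A) = trace A / 2" for A :: "real^'a^'a"
    by (simp add: trace_def sum_divide_distrib)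
  then show ?thesis by (simp add: matrix_mult_scaleR_left trace_outer_mult)
qed

text \<open>The mixed moment with b = 1/2 and s = x x^T / 2, for which the rank-one formula gives
  det(w + s) = det w (1 + x^T \<sigma> x / 2). The surplus power (det w)^(-1/2) is sqrt(det
  \<sigma>).\<close>

lemma nn_integral_wishart_mixture:
  fixes \<sigma> :: "real^'n^'n"
  assumes p: "p > (real CARD('n) - 1) / 2" and \<sigma>: "\<sigma> \<in> pos_def_mats"
  shows "(\<integral>\<^sup>+u. ennreal (exp (- (x \<bullet> (u *v x)) / 2) * sqrt (det u)) \<partial>wishart p \<sigma>) =
    ennreal ((2 * pi) powr (real CARD('n) / 2) *
      (mix_const TYPE('n) p * sqrt (det \<sigma>) * (1 + x \<bullet> (\<sigma> *v x) / 2) powr (- (p + 1/2))))"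
proof -
  obtain w where w: "w \<in> pos_def_mats" "\<sigma> ** w = mat 1" "w ** \<sigma> = mat 1"
    using pos_def_inverse[OF \<sigma>] by blast
  note sets_W = is_wishart_wishart[OF p w(1,3), unfolded is_wishart_def, THEN conjunct2, THEN conjunct1]
  have dw: "0 < det w" by (rule det_pos_def[OF w(1)])
  have dws: "det w * det \<sigma> = 1" using arg_cong[OF w(3), of det] by (simp add: det_mul)
  have pos: "0 < 1 + x \<bullet> (\<sigma> *v x) / 2" using pos_def_mats_nonneg[OF \<sigma>, of x] by simp
  have "(\<integral>\<^sup>+u. ennreal (exp (- (x \<bullet> (u *v x)) / 2) * sqrt (det u)) \<partial>wishart p \<sigma>) =
      (\<integral>\<^sup>+u. ennreal (exp (- trace (((1/2) *\<^sub>R outer x) ** u)) * det u powr (1/2)) \<partial>wishart p \<sigma>)"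
    by (intro nn_integral_cong)
       (use det_pos_def in \<open>force simp: space_restrict_pos_def[OF sets_W] trace_half_outer_mult powr_half_sqrt\<close>)
  also have "\<dots> = ennreal (wishart_const TYPE('n) (p + 1/2) * det (w + (1/2) *\<^sub>R outer x) powr (- (p + 1/2)) /
               (wishart_const TYPE('n) p * det w powr (- p)))"
    using wishart_mixed_moment[OF p w(1,3), of "1/2"] pos_def_mats_add_outer[OF w(1), of "1/2" x] by simp
  also have "det (w + (1/2) *\<^sub>R outer x) = det w * (1 + x \<bullet> (\<sigma> *v x) / 2)"
    using det_pos_def_add_outer[OF w(1,2), of "1/2" x] by simp
  also have "wishart_const TYPE('n) (p + 1/2) * (det w * (1 + x \<bullet> (\<sigma> *v x) / 2)) powr (- (p + 1/2)) /
               (wishart_const TYPE('n) p * det w powr (- p)) =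
    (2 * pi) powr (real CARD('n) / 2) *
      (mix_const TYPE('n) p * sqrt (det \<sigma>) * (1 + x \<bullet> (\<sigma> *v x) / 2) powr (- (p + 1/2)))"
  proof -
    have "det w powr (- (p + 1/2)) = det w powr (- p) * det w powr (- (1/2))"
      by (simp flip: powr_add)
    also have "det w powr (- (1/2)) = sqrt (det \<sigma>)"
    proof -
      have "det \<sigma> = inverse (det w)" using dws dw by (simp add: field_simps)
      then show ?thesis using dw by (simp add: powr_minus powr_half_sqrt real_sqrt_inverse)
    qed
    finally have "(det w * (1 + x \<bullet> (\<sigma> *v x) / 2)) powr (- (p + 1/2)) =
        det w powr (- p) * sqrt (det \<sigma>) * (1 + x \<bullet> (\<sigma> *v x) / 2) powr (- (p + 1/2))"
      using dw pos by (subst powr_mult) auto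
    moreover have "det w powr (- p) \<noteq> 0" using dw by simp
    moreover have "(2 * pi) powr (real CARD('n) / 2) \<noteq> 0" by simp
    ultimately show ?thesis unfolding mix_const_def by simp
  qed
  finally show ?thesis .
qed

lemma
  fixes \<sigma> :: "real^'n^'n"
  assumes p: "p > (real CARD('n) - 1) / 2" and \<sigma>: "\<sigma> \<in> pos_def_mats"
  shows sets_wishart: "sets (wishart p \<sigma>) = sets (restrict_space borel pos_def_mats)"
    and prob_space_wishart: "prob_space (wishart p \<sigma>)"
proof -
  obtain w where w: "w \<in> pos_def_mats" "\<sigma> ** w = mat 1" "w ** \<sigma> = mat 1"
    using pos_def_inverse[OF \<sigma>] by blast
  show "sets (wishart p \<sigma>) = sets (restrict_space borel pos_def_mats)" "prob_space (wishart p \<sigma>)"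
    using is_wishart_wishart[OF p w(1,3)] by (auto simp: is_wishart_def)
qed

lemma mix_density_eq:
  fixes \<sigma> :: "real^'n^'n"
  assumes p: "p > (real CARD('n) - 1) / 2" and \<sigma>: "\<sigma> \<in> pos_def_mats"
  shows "mix_density p \<sigma> x =
    mix_const TYPE('n) p * sqrt (det \<sigma>) * (1 + x \<bullet> (\<sigma> *v x) / 2) powr (- (p + 1/2))"
proof -
  note W = sets_wishart[OF p \<sigma>] prob_space_wishart[OF p \<sigma>]
  have [measurable]: "(\<lambda>u::real^'n^'n. u *v x) \<in> borel_measurable borel"
    unfolding matrix_vector_mult_def by (intro borel_measurable_continuous_onI continuous_intros)
  have meas: "(\<lambda>u. exp (- (x \<bullet> (u *v x)) / 2) * sqrt (det u)) \<in> borel_measurable (wishart p \<sigma>)"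
    by (intro borel_measurable_restrict_pos_def[OF W(1)]) measurable
  have pos: "0 \<le> (2 * pi) powr (real CARD('n) / 2) *
      (mix_const TYPE('n) p * sqrt (det \<sigma>) * (1 + x \<bullet> (\<sigma> *v x) / 2) powr (- (p + 1/2)))"
    using mix_const_pos[OF p] det_pos_def[OF \<sigma>] by simp
  have "(\<integral>u. exp (- (x \<bullet> (u *v x)) / 2) * sqrt (det u) \<partial>wishart p \<sigma>) =
    enn2real (\<integral>\<^sup>+u. ennreal (exp (- (x \<bullet> (u *v x)) / 2) * sqrt (det u)) \<partial>wishart p \<sigma>)"
    using meas det_pos_def
    by (intro integral_eq_nn_integral) (auto intro!: AE_I2 mult_nonneg_nonneg less_imp_le[OF det_pos_def] simp: space_restrict_pos_def[OF W(1)])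
  also have "\<dots> = (2 * pi) powr (real CARD('n) / 2) *
      (mix_const TYPE('n) p * sqrt (det \<sigma>) * (1 + x \<bullet> (\<sigma> *v x) / 2) powr (- (p + 1/2)))"
    unfolding nn_integral_wishart_mixture[OF p \<sigma>] using pos by (rule enn2real_ennreal)
  finally show ?thesis by (simp add: mix_density_def)
qed

section \<open>Radial moments and the normalising constant\<close>

lemma nn_integral_gaussian_even_moment:
  assumes "0 < t"
  shows "(\<integral>\<^sup>+y. ennreal (y ^ (2 * k) * exp (- t * y\<^sup>2 / 2)) \<partial>lborel) =
    ennreal (sqrt (2 * pi) * (fact (2 * k) / (2 ^ k * fact k)) * t powr (- (real k + 1/2)))"
proof -
  \<comment> \<open>The integrand is, up to a constant, the centred normal density of variance
    1/t.\<close>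
  define s where "s = 1 / sqrt t"
  have s: "0 < s" "s\<^sup>2 = 1 / t" using assms by (auto simp: s_def power_divide)
  have nd: "normal_density 0 s y * (y - 0) ^ (2 * k) = (sqrt t / sqrt (2 * pi)) * (y ^ (2 * k) * exp (- t * y\<^sup>2 / 2))" for y
    using assms by (simp add: normal_density_def s real_sqrt_divide real_sqrt_mult)
  have "has_bochner_integral lborel (\<lambda>y. (sqrt t / sqrt (2 * pi)) * (y ^ (2 * k) * exp (- t * y\<^sup>2 / 2)))
      (fact (2 * k) / ((2 / s\<^sup>2) ^ k * fact k))"
    using normal_moment_even[OF s(1), of 0 k] unfolding nd .
  then have "has_bochner_integral lborel (\<lambda>y. (sqrt (2 * pi) / sqrt t) * ((sqrt t / sqrt (2 * pi)) * (y ^ (2 * k) * exp (- t * y\<^sup>2 / 2))))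
      ((sqrt (2 * pi) / sqrt t) * (fact (2 * k) / ((2 / s\<^sup>2) ^ k * fact k)))"
    by (rule has_bochner_integral_mult_right)
  moreover have "(sqrt (2 * pi) / sqrt t) * ((sqrt t / sqrt (2 * pi)) * z) = z" for z using assms by simp
  moreover have "(sqrt (2 * pi) / sqrt t) * (fact (2 * k) / ((2 / s\<^sup>2) ^ k * fact k)) =
      sqrt (2 * pi) * (fact (2 * k) / (2 ^ k * fact k)) * t powr (- (real k + 1/2))"
  proof -
    have "t powr (- (real k + 1/2)) = inverse (t ^ k * sqrt t)"
      using assms by (simp only: powr_minus powr_add) (simp add: powr_realpow powr_half_sqrt)
    then show ?thesis using assms by (simp only: s) (simp add: power_mult_distrib field_simps)
  qed
  ultimately have "has_bochner_integral lborel (\<lambda>y. y ^ (2 * k) * exp (- t * y\<^sup>2 / 2))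
      (sqrt (2 * pi) * (fact (2 * k) / (2 ^ k * fact k)) * t powr (- (real k + 1/2)))"
    by simp
  then show ?thesis
    by (subst nn_integral_eq_integral)
       (auto simp: has_bochner_integral_iff zero_le_even_power)
qed

lemma nn_integral_gamma_scaled:
  assumes "0 < q" "0 < (c::real)"
  shows "(\<integral>\<^sup>+t. ennreal (indicator {0..} t * t powr (q - 1) * exp (- c * t)) \<partial>lborel) = ennreal (Gamma q * c powr (- q))"
proof -
  have "ennreal (Gamma q) = (\<integral>\<^sup>+t. ennreal (indicator {0..} t * t powr (q - 1) / exp t) \<partial>lborel)"
    by (rule Gamma_conv_nn_integral_real) fact
  also have "\<dots> = ennreal \<bar>c\<bar> * (\<integral>\<^sup>+t. ennreal (indicator {0..} (0 + c * t) * (0 + c * t) powr (q - 1) / exp (0 + c * t)) \<partial>lborel)"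
    using assms by (intro nn_integral_real_affine) auto
  also have "(\<integral>\<^sup>+t. ennreal (indicator {0..} (0 + c * t) * (0 + c * t) powr (q - 1) / exp (0 + c * t)) \<partial>lborel) =
      (\<integral>\<^sup>+t. ennreal (c powr (q - 1)) * ennreal (indicator {0..} t * t powr (q - 1) * exp (- c * t)) \<partial>lborel)"
    using assms
    by (intro nn_integral_cong)
       (auto simp: indicator_def zero_le_mult_iff powr_mult exp_minus field_simps simp flip: ennreal_mult')
  also have "\<dots> = ennreal (c powr (q - 1)) * (\<integral>\<^sup>+t. ennreal (indicator {0..} t * t powr (q - 1) * exp (- c * t)) \<partial>lborel)"
    by (rule nn_integral_cmult) measurable
  finally have "ennreal (Gamma q) = ennreal (c powr q) * (\<integral>\<^sup>+t. ennreal (indicator {0..} t * t powr (q - 1) * exp (- c * t)) \<partial>lborel)"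
    using assms by (simp add: powr_diff mult.assoc[symmetric] flip: ennreal_mult')
  \<comment> \<open>Multiplying by the inverse constant replaces a cancellation in
    \<open>ennreal\<close>; the same device recurs below.\<close>
  then have "ennreal (c powr (- q)) * ennreal (Gamma q) =
     (ennreal (c powr (- q)) * ennreal (c powr q)) * (\<integral>\<^sup>+t. ennreal (indicator {0..} t * t powr (q - 1) * exp (- c * t)) \<partial>lborel)"
    by (simp add: mult.assoc)
  also have "ennreal (c powr (- q)) * ennreal (c powr q) = 1"
    using assms by (simp add: powr_minus flip: ennreal_mult)
  finally show ?thesis using assms by (simp add: mult.commute flip: ennreal_mult')
qed

text \<open>Under the Gamma mixture the coordinates separate, and coordinate i contributes t^(-(k_i
  + 1/2)). What remains is a Gamma integral at q - n/2 - (sum of the k_i), and the hypothesis is its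
  convergence at t = 0.\<close>

lemma nn_integral_radial_even_moment:
  fixes k :: "'n::finite \<Rightarrow> nat"
  assumes q: "q > real CARD('n) / 2 + real (\<Sum>i\<in>UNIV. k i)"
  shows "(\<integral>\<^sup>+y. ennreal ((\<Prod>i\<in>UNIV. (y $ i) ^ (2 * k i)) * (1 + (y \<bullet> y) / 2) powr (- q)) \<partial>(lborel :: (real^'n) measure)) =
    ennreal ((2 * pi) powr (real CARD('n) / 2) * (\<Prod>i\<in>UNIV. fact (2 * k i) / (2 ^ k i * fact (k i))) *
      Gamma (q - real CARD('n) / 2 - real (\<Sum>i\<in>UNIV. k i)) / Gamma q)"
proof -
  let ?n = "real CARD('n)" and ?K = "real (\<Sum>i\<in>UNIV. k i)"
  let ?m = "\<Prod>i\<in>UNIV. fact (2 * k i) / (2 ^ k i * fact (k i)) :: real"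
  let ?P = "\<lambda>y::real^'n. \<Prod>i\<in>UNIV. (y $ i) ^ (2 * k i)"
  let ?I = "\<integral>\<^sup>+y. ennreal (?P y * (1 + (y \<bullet> y) / 2) powr (- q)) \<partial>lborel"
  have q0: "0 < q" using q by (rule le_less_trans[rotated]) (simp add: sum_nonneg)
  have P0: "0 \<le> ?P y" for y by (intro prod_nonneg) (simp add: zero_le_even_power)
  have "ennreal (Gamma q) * ?I = (\<integral>\<^sup>+y. ennreal (Gamma q) * ennreal (?P y * (1 + (y \<bullet> y) / 2) powr (- q)) \<partial>lborel)"
    by (rule nn_integral_cmult[symmetric]) measurable
  also have "\<dots> = (\<integral>\<^sup>+y. (\<integral>\<^sup>+t. ennreal (?P y) * ennreal (indicator {0..} t * t powr (q - 1) * exp (- (1 + (y \<bullet> y) / 2) * t)) \<partial>lborel) \<partial>lborel)"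
  proof (rule nn_integral_cong)
    fix y :: "real^'n"
    have "0 < 1 + (y \<bullet> y) / 2" by (simp add: add_pos_nonneg)
    from nn_integral_gamma_scaled[OF q0 this]
    show "ennreal (Gamma q) * ennreal (?P y * (1 + (y \<bullet> y) / 2) powr (- q)) =
      (\<integral>\<^sup>+t. ennreal (?P y) * ennreal (indicator {0..} t * t powr (q - 1) * exp (- (1 + (y \<bullet> y) / 2) * t)) \<partial>lborel)"
      using P0[of y] q0 by (subst nn_integral_cmult) (auto simp: mult_ac simp flip: ennreal_mult)
  qed
  also have "\<dots> = (\<integral>\<^sup>+t. (\<integral>\<^sup>+y. ennreal (?P y) * ennreal (indicator {0..} t * t powr (q - 1) * exp (- (1 + (y \<bullet> y) / 2) * t)) \<partial>lborel) \<partial>lborel)"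
    by (rule lborel_pair.Fubini'[symmetric]) measurable
  also have "\<dots> = (\<integral>\<^sup>+t. ennreal ((2 * pi) powr (?n / 2) * ?m) * ennreal (indicator {0..} t * t powr (q - ?n / 2 - ?K - 1) / exp t) \<partial>lborel)"
  proof (rule nn_integral_cong)
    fix t :: real
    show "(\<integral>\<^sup>+y. ennreal (?P y) * ennreal (indicator {0..} t * t powr (q - 1) * exp (- (1 + (y \<bullet> y) / 2) * t)) \<partial>lborel) =
      ennreal ((2 * pi) powr (?n / 2) * ?m) * ennreal (indicator {0..} t * t powr (q - ?n / 2 - ?K - 1) / exp t)"
    proof (cases "0 < t")
      case False
      then show ?thesis by (cases "t = 0") (auto simp: indicator_def)
    next
      case True
      have "ennreal (?P y) * ennreal (indicator {0..} t * t powr (q - 1) * exp (- (1 + (y \<bullet> y) / 2) * t)) =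
        ennreal (t powr (q - 1) / exp t) * (\<Prod>i\<in>UNIV. ennreal ((y $ i) ^ (2 * k i) * exp (- t * (y $ i)\<^sup>2 / 2)))" for y
      proof -
        have "exp (- (1 + (y \<bullet> y) / 2) * t) = inverse (exp t) * exp (\<Sum>i\<in>UNIV. - t * (y $ i)\<^sup>2 / 2)"
        proof -
          have "(\<Sum>i\<in>UNIV. - t * (y $ i)\<^sup>2 / 2) = - t * (y \<bullet> y) / 2"
            by (simp add: inner_vec_def power2_eq_square sum_negf sum_divide_distrib[symmetric] sum_distrib_left)
          moreover have "- (1 + (y \<bullet> y) / 2) * t = - t + - t * (y \<bullet> y) / 2" by (simp add: algebra_simps)
          ultimately show ?thesis by (simp only: exp_add exp_minus)
        qed
        also have "exp (\<Sum>i\<in>UNIV. - t * (y $ i)\<^sup>2 / 2) = (\<Prod>i\<in>UNIV. exp (- t * (y $ i)\<^sup>2 / 2))"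
          by (rule exp_sum) simp
        finally have e: "exp (- (1 + (y \<bullet> y) / 2) * t) = inverse (exp t) * (\<Prod>i\<in>UNIV. exp (- t * (y $ i)\<^sup>2 / 2))" .
        have E0: "0 \<le> (\<Prod>i\<in>UNIV. exp (- t * (y $ i)\<^sup>2 / 2))" by (intro prod_nonneg) simp
        have "ennreal (?P y) * ennreal (indicator {0..} t * t powr (q - 1) * exp (- (1 + (y \<bullet> y) / 2) * t)) =
            ennreal (?P y * (indicator {0..} t * t powr (q - 1) * exp (- (1 + (y \<bullet> y) / 2) * t)))"
          using P0[of y] True by (intro ennreal_mult[symmetric]) auto
        also have "\<dots> = ennreal (t powr (q - 1) / exp t * (?P y * (\<Prod>i\<in>UNIV. exp (- t * (y $ i)\<^sup>2 / 2))))"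
        proof -
          have "P * (indicator {0..} t * a * (inverse b * E)) = a / b * (P * E)" for P a b E :: real
            using True by (simp add: divide_inverse)
          then show ?thesis by (simp only: e)
        qed
        also have "\<dots> = ennreal (t powr (q - 1) / exp t) * ennreal (?P y * (\<Prod>i\<in>UNIV. exp (- t * (y $ i)\<^sup>2 / 2)))"
          using P0[of y] E0 by (intro ennreal_mult) auto
        also have "ennreal (?P y * (\<Prod>i\<in>UNIV. exp (- t * (y $ i)\<^sup>2 / 2))) =
            (\<Prod>i\<in>UNIV. ennreal ((y $ i) ^ (2 * k i) * exp (- t * (y $ i)\<^sup>2 / 2)))"
          by (subst prod_ennreal) (auto simp: zero_le_even_power prod.distrib)
        finally show ?thesis .
      qed
      then have "(\<integral>\<^sup>+y. ennreal (?P y) * ennreal (indicator {0..} t * t powr (q - 1) * exp (- (1 + (y \<bullet> y) / 2) * t)) \<partial>lborel)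
        = (\<integral>\<^sup>+y. ennreal (t powr (q - 1) / exp t) * (\<Prod>i\<in>UNIV. ennreal ((y $ i) ^ (2 * k i) * exp (- t * (y $ i)\<^sup>2 / 2))) \<partial>lborel)"
        by simp
      also have "\<dots> = ennreal (t powr (q - 1) / exp t) * (\<Prod>i\<in>UNIV. \<integral>\<^sup>+s. ennreal (s ^ (2 * k i) * exp (- t * s\<^sup>2 / 2)) \<partial>lborel)"
        by (subst nn_integral_cmult, measurable, subst nn_integral_lborel_vec_prod) auto
      also have "(\<Prod>i\<in>UNIV. \<integral>\<^sup>+s. ennreal (s ^ (2 * k i) * exp (- t * s\<^sup>2 / 2)) \<partial>lborel) =
          ennreal (\<Prod>i\<in>UNIV. sqrt (2 * pi) * (fact (2 * k i) / (2 ^ k i * fact (k i))) * t powr (- (real (k i) + 1/2)))"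
        unfolding nn_integral_gaussian_even_moment[OF True] by (rule prod_ennreal) simp
      also have "(\<Prod>i\<in>UNIV. sqrt (2 * pi) * (fact (2 * k i) / (2 ^ k i * fact (k i))) * t powr (- (real (k i) + 1/2)))
          = (2 * pi) powr (?n / 2) * ?m * t powr (- (?K + ?n / 2))"
      proof -
        have "(\<Prod>i\<in>UNIV. t powr (- (real (k i) + 1/2))) = t powr (\<Sum>i\<in>UNIV. - (real (k i) + 1/2))"
          using True by (simp add: powr_sum)
        also have "(\<Sum>i\<in>UNIV. - (real (k i) + 1/2)) = - (?K + ?n / 2)"
          by (simp add: sum_negf sum_subtractf)
        finally have t: "(\<Prod>i\<in>UNIV. t powr (- (real (k i) + 1/2))) = t powr (- (?K + ?n / 2))" .
        have "sqrt (2 * pi) ^ CARD('n) = (2 * pi) powr (?n / 2)"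
          by (simp add: powr_half_sqrt[symmetric] powr_powr flip: powr_realpow)
        then show ?thesis by (simp only: prod.distrib t prod_constant)
      qed
      also have "ennreal (t powr (q - 1) / exp t) * ennreal ((2 * pi) powr (?n / 2) * ?m * t powr (- (?K + ?n / 2)))
        = ennreal ((2 * pi) powr (?n / 2) * ?m) * ennreal (indicator {0..} t * t powr (q - ?n / 2 - ?K - 1) / exp t)"
      proof -
        have "t powr (q - ?n / 2 - ?K - 1) = t powr (q - 1) * t powr (- (?K + ?n / 2))"
          by (simp add: algebra_simps flip: powr_add)
        moreover have "0 \<le> ?m" by (intro prod_nonneg) simp
        ultimately show ?thesis using True by (simp add: mult_ac flip: ennreal_mult)
      qed
      finally show ?thesis .
    qed
  qed
  also have "\<dots> = ennreal ((2 * pi) powr (?n / 2) * ?m) * ennreal (Gamma (q - ?n / 2 - ?K))"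
    using q by (subst nn_integral_cmult) (auto simp: Gamma_conv_nn_integral_real)
  finally have "ennreal (Gamma q) * ?I = ennreal ((2 * pi) powr (?n / 2) * ?m) * ennreal (Gamma (q - ?n / 2 - ?K))" .
  then have "ennreal (1 / Gamma q) * (ennreal (Gamma q) * ?I) =
      ennreal (1 / Gamma q) * (ennreal ((2 * pi) powr (?n / 2) * ?m) * ennreal (Gamma (q - ?n / 2 - ?K)))" by simp
  moreover have "ennreal (1 / Gamma q) * ennreal (Gamma q) = 1"
    using Gamma_real_pos[OF q0] by (simp flip: ennreal_mult)
  moreover have "0 < Gamma (q - ?n / 2 - ?K)" using q by (intro Gamma_real_pos) simp
  moreover have "0 \<le> ?m" by (intro prod_nonneg) simp
  ultimately show ?thesis using Gamma_real_pos[OF q0]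
    by (simp add: mult.assoc[symmetric] flip: ennreal_mult)
qed

lemma nn_integral_gaussian_quadratic_form:
  fixes u :: "real^'n^'n"
  assumes u: "u \<in> pos_def_mats"
  shows "(\<integral>\<^sup>+x. ennreal (exp (- (x \<bullet> (u *v x)) / 2)) \<partial>lborel) = ennreal ((2 * pi) powr (real CARD('n) / 2) / sqrt (det u))"
proof -
  obtain B :: "real^'n^'n" where B: "det B \<noteq> 0" "(det B)\<^sup>2 * det u = 1" "\<And>y. (B *v y) \<bullet> (u *v (B *v y)) = y \<bullet> y"
    by (rule pos_def_congruent_identity[OF u]) blast
  have "(\<integral>\<^sup>+x. ennreal (exp (- (x \<bullet> (u *v x)) / 2)) \<partial>lborel) = ennreal \<bar>det B\<bar> * (\<integral>\<^sup>+y. ennreal (exp (- (y \<bullet> y) / 2)) \<partial>(lborel :: (real^'n) measure))"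
    using nn_integral_matrix_vector_mult[OF B(1), of "\<lambda>x. ennreal (exp (- (x \<bullet> (u *v x)) / 2))"]
    by (simp add: B(3))
  also have "(\<lambda>y::real^'n. ennreal (exp (- (y \<bullet> y) / 2))) = (\<lambda>y. \<Prod>i\<in>UNIV. ennreal (exp (- (y $ i)\<^sup>2 / 2)))"
  proof
    fix y :: "real^'n"
    have "- (y \<bullet> y) / 2 = (\<Sum>i\<in>UNIV. - (y $ i)\<^sup>2 / 2)"
      by (simp add: inner_vec_def power2_eq_square sum_negf sum_divide_distrib)
    then have "exp (- (y \<bullet> y) / 2) = (\<Prod>i\<in>UNIV. exp (- (y $ i)\<^sup>2 / 2))"
      by (simp only: exp_sum finite)
    then show "ennreal (exp (- (y \<bullet> y) / 2)) = (\<Prod>i\<in>UNIV. ennreal (exp (- (y $ i)\<^sup>2 / 2)))"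
      by (simp only:) (rule prod_ennreal[symmetric], simp)
  qed
  also have "(\<integral>\<^sup>+y. (\<Prod>i\<in>UNIV. ennreal (exp (- ((y::real^'n) $ i)\<^sup>2 / 2))) \<partial>lborel) =
      (\<Prod>i\<in>(UNIV::'n set). \<integral>\<^sup>+t. ennreal (exp (- t\<^sup>2 / 2)) \<partial>lborel)"
    by (rule nn_integral_lborel_vec_prod) measurable
  also have "(\<integral>\<^sup>+t. ennreal (exp (- t\<^sup>2 / 2)) \<partial>lborel) = ennreal (sqrt (2 * pi))"
    using nn_integral_gaussian_even_moment[of 1 0] by simp
  also have "(\<Prod>i\<in>(UNIV::'n set). ennreal (sqrt (2 * pi))) = ennreal ((2 * pi) powr (real CARD('n) / 2))"
    by (simp add: ennreal_power powr_half_sqrt[symmetric] powr_powr flip: powr_realpow)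
  also have "ennreal \<bar>det B\<bar> * \<dots> = ennreal ((2 * pi) powr (real CARD('n) / 2) / sqrt (det u))"
  proof -
    have "sqrt (det u) * \<bar>det B\<bar> = sqrt ((det B)\<^sup>2 * det u)" by (simp add: real_sqrt_mult)
    then have "\<bar>det B\<bar> = 1 / sqrt (det u)" using B det_pos_def[OF u] by (simp add: field_simps)
    then show ?thesis by (subst ennreal_mult''[symmetric]) auto
  qed
  finally show ?thesis .
qed

text \<open>Tonelli: for fixed \<open>u\<close> the Gaussian integral in x cancels sqrt(det u). The
  statement serves to determine \<open>mix_const\<close>.\<close>

lemma nn_integral_mix_density:
  fixes \<sigma> :: "real^'n^'n"
  assumes p: "p > (real CARD('n) - 1) / 2" and \<sigma>: "\<sigma> \<in> pos_def_mats"
  shows "(\<integral>\<^sup>+x. ennreal (mix_density p \<sigma> x) \<partial>lborel) = 1"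
proof -
  let ?c = "(2 * pi) powr (real CARD('n) / 2)"
  note W = sets_wishart[OF p \<sigma>] prob_space_wishart[OF p \<sigma>]
  interpret W: prob_space "wishart p \<sigma>" by (rule W(2))
  interpret pair_sigma_finite "lborel :: (real^'n) measure" "wishart p \<sigma>" ..
  have c: "0 < ?c" by simp
  have eq: "(\<integral>\<^sup>+u. ennreal (exp (- (x \<bullet> (u *v x)) / 2) * sqrt (det u)) \<partial>wishart p \<sigma>) = ennreal ?c * ennreal (mix_density p \<sigma> x)" for x
    using nn_integral_wishart_mixture[OF p \<sigma>, of x] by (simp add: mix_density_eq[OF p \<sigma>] ennreal_mult')
  have id_meas [measurable]: "(\<lambda>u. u) \<in> wishart p \<sigma> \<rightarrow>\<^sub>M borel"
    by (rule borel_measurable_restrict_pos_def[OF W(1)]) simp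
  have entry [measurable]: "(\<lambda>z. snd z $ i $ j) \<in> borel_measurable (lborel \<Otimes>\<^sub>M wishart p \<sigma>)" for i j
  proof -
    have "(\<lambda>u::real^'n^'n. u $ i $ j) \<in> borel_measurable borel"
      by (intro borel_measurable_continuous_onI continuous_intros)
    then have "(\<lambda>u. u $ i $ j) \<in> borel_measurable (wishart p \<sigma>)"
      by (rule borel_measurable_restrict_pos_def[OF W(1)])
    then show ?thesis by measurable
  qed
  have "(\<lambda>z. det (snd z)) \<in> borel_measurable (lborel \<Otimes>\<^sub>M wishart p \<sigma>)"
    unfolding det_def by measurable
  moreover have "(\<lambda>z. fst z \<bullet> (snd z *v fst z)) \<in> borel_measurable (lborel \<Otimes>\<^sub>M wishart p \<sigma>)"
    unfolding inner_vec_def matrix_vector_mult_def by simp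
  ultimately have meas: "(\<lambda>(x, u). ennreal (exp (- (x \<bullet> (u *v x)) / 2) * sqrt (det u))) \<in> borel_measurable (lborel \<Otimes>\<^sub>M wishart p \<sigma>)"
    unfolding split_beta by measurable
  have "(\<lambda>x. mix_density p \<sigma> x) \<in> borel_measurable borel" by (simp add: mix_density_eq[OF p \<sigma>])
  then have "ennreal ?c * (\<integral>\<^sup>+x. ennreal (mix_density p \<sigma> x) \<partial>lborel) =
      (\<integral>\<^sup>+x. ennreal ?c * ennreal (mix_density p \<sigma> x) \<partial>lborel)"
    by (intro nn_integral_cmult[symmetric]) simp
  also have "\<dots> = (\<integral>\<^sup>+u. (\<integral>\<^sup>+x. ennreal (exp (- (x \<bullet> (u *v x)) / 2) * sqrt (det u)) \<partial>lborel) \<partial>wishart p \<sigma>)"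
    unfolding eq[symmetric] by (rule Fubini'[symmetric]) (rule meas)
  also have "\<dots> = (\<integral>\<^sup>+u. ennreal ?c \<partial>wishart p \<sigma>)"
  proof (rule nn_integral_cong)
    fix u assume "u \<in> space (wishart p \<sigma>)"
    then have u: "u \<in> pos_def_mats" by (simp add: space_restrict_pos_def[OF W(1)])
    have "(\<integral>\<^sup>+x. ennreal (exp (- (x \<bullet> (u *v x)) / 2) * sqrt (det u)) \<partial>lborel) =
        (\<integral>\<^sup>+x. ennreal (exp (- (x \<bullet> (u *v x)) / 2)) \<partial>lborel) * ennreal (sqrt (det u))"
      using det_pos_def[OF u] by (subst nn_integral_multc[symmetric]) (auto simp: ennreal_mult)
    also have "\<dots> = ennreal (?c / sqrt (det u)) * ennreal (sqrt (det u))"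
      by (simp only: nn_integral_gaussian_quadratic_form[OF u])
    also have "\<dots> = ennreal ?c" using det_pos_def[OF u] by (simp flip: ennreal_mult)
    finally show "(\<integral>\<^sup>+x. ennreal (exp (- (x \<bullet> (u *v x)) / 2) * sqrt (det u)) \<partial>lborel) = ennreal ?c" .
  qed
  also have "\<dots> = ennreal ?c" by (simp add: W.emeasure_space_1)
  finally have "ennreal (1 / ?c) * (ennreal ?c * (\<integral>\<^sup>+x. ennreal (mix_density p \<sigma> x) \<partial>lborel)) = ennreal (1 / ?c) * ennreal ?c"
    by simp
  moreover have "ennreal (1 / ?c) * ennreal ?c = 1" using c by (simp flip: ennreal_mult)
  ultimately show ?thesis by (simp add: mult.assoc[symmetric])
qed

text \<open>The mixture density at \<sigma> = 1; \<open>std_weight\<close> is the factor that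
  accompanies y y^T in the score there.\<close>

definition std_density :: "real \<Rightarrow> real^'n \<Rightarrow> real" where
  "std_density p y = mix_const TYPE('n) p * (1 + (y \<bullet> y) / 2) powr (- (p + 1/2))"

definition std_weight :: "real^'n \<Rightarrow> real" where
  "std_weight y = 1 / (1 + (y \<bullet> y) / 2)"

lemma borel_measurable_std [measurable]:
  "std_density p \<in> borel_measurable borel" "std_weight \<in> borel_measurable borel"
  unfolding std_density_def std_weight_def by measurable

lemma shape_pos:
  assumes "p > (real CARD('n::finite) - 1) / 2" shows "0 < p + 1/2"
proof -
  have "1 \<le> CARD('n)" by (simp add: Suc_leI)
  then show ?thesis using assms by (simp add: field_simps)
qed

text \<open>Total mass 1 at \<sigma> = 1, compared with the radial moment of order zero. This
  replaces the evaluation of two multivariate Gamma values.\<close>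

lemma mix_const_eq:
  assumes p: "p > (real CARD('n) - 1) / 2"
  shows "mix_const TYPE('n::finite) p * (2 * pi) powr (real CARD('n) / 2) * Gamma (p + 1/2 - real CARD('n) / 2) = Gamma (p + 1/2)"
proof -
  let ?K = "mix_const TYPE('n) p" and ?c = "(2 * pi) powr (real CARD('n) / 2)"
  have p0: "0 < p + 1/2" by (rule shape_pos[OF p])
  have K: "0 < ?K" by (rule mix_const_pos[OF p])
  have "1 = (\<integral>\<^sup>+x. ennreal (mix_density p (mat 1 :: real^'n^'n) x) \<partial>lborel)"
    by (rule nn_integral_mix_density[OF p mat_1_pos_def, symmetric])
  also have "\<dots> = (\<integral>\<^sup>+x. ennreal ?K * ennreal ((\<Prod>i\<in>UNIV. (x $ i) ^ (2 * 0)) * (1 + (x \<bullet> x) / 2) powr (- (p + 1/2))) \<partial>(lborel :: (real^'n) measure))"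
    using K by (simp add: mix_density_eq[OF p mat_1_pos_def] flip: ennreal_mult')
  also have "\<dots> = ennreal ?K * (\<integral>\<^sup>+x. ennreal ((\<Prod>i\<in>UNIV. (x $ i) ^ (2 * 0)) * (1 + (x \<bullet> x) / 2) powr (- (p + 1/2))) \<partial>(lborel :: (real^'n) measure))"
    by (rule nn_integral_cmult) measurable
  also have "\<dots> = ennreal ?K * ennreal (?c * Gamma (p + 1/2 - real CARD('n) / 2) / Gamma (p + 1/2))"
    using nn_integral_radial_even_moment[of "\<lambda>_::'n. 0" "p + 1/2"] p by (simp add: field_simps)
  also have "\<dots> = ennreal (?K * (?c * Gamma (p + 1/2 - real CARD('n) / 2) / Gamma (p + 1/2)))"
    using K by (intro ennreal_mult'[symmetric]) simp
  finally have "ennreal (?K * (?c * Gamma (p + 1/2 - real CARD('n) / 2) / Gamma (p + 1/2))) = 1" by (rule sym)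
  then have "?K * (?c * Gamma (p + 1/2 - real CARD('n) / 2) / Gamma (p + 1/2)) = 1"
    by (simp only: ennreal_eq_1)
  then show ?thesis using Gamma_real_pos[OF p0] by (simp add: nonzero_divide_eq_eq mult.assoc)
qed

text \<open>A power s of \<open>std_weight\<close> raises the exponent to p + 1/2 + s, which offsets
  the degree 2s of the monomial: the Gamma value at p + 1/2 - n/2 is the same as in the
  normalisation and cancels. Hence the moment is finite for every admissible p and, apart from the
  product of factorials, independent of n.\<close>

lemma std_even_moment:
  fixes k :: "'n::finite \<Rightarrow> nat"
  assumes p: "p > (real CARD('n) - 1) / 2"
  shows "has_bochner_integral lborel
    (\<lambda>y. std_density p y * std_weight y ^ (\<Sum>i\<in>UNIV. k i) * (\<Prod>i\<in>UNIV. (y $ i) ^ (2 * k i)))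
    ((\<Prod>i\<in>UNIV. fact (2 * k i) / (2 ^ k i * fact (k i))) * (Gamma (p + 1/2) / Gamma (p + 1/2 + real (\<Sum>i\<in>UNIV. k i))))"
proof -
  let ?s = "\<Sum>i\<in>UNIV. k i" and ?K = "mix_const TYPE('n) p" and ?c = "(2 * pi) powr (real CARD('n) / 2)"
  let ?m = "\<Prod>i\<in>UNIV. fact (2 * k i) / (2 ^ k i * fact (k i)) :: real"
  let ?P = "\<lambda>y::real^'n. \<Prod>i\<in>UNIV. (y $ i) ^ (2 * k i)"
  have p0: "0 < p + 1/2" by (rule shape_pos[OF p])
  have K: "0 < ?K" by (rule mix_const_pos[OF p])
  have m0: "0 \<le> ?m" by (intro prod_nonneg) simp
  have P0: "0 \<le> ?P y" for y by (intro prod_nonneg) (simp add: zero_le_even_power)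
  have w: "std_density p y * std_weight y ^ ?s * ?P y = ?K * (?P y * (1 + (y \<bullet> y) / 2) powr (- (p + 1/2 + real ?s)))" for y
  proof -
    have pos: "0 < 1 + (y \<bullet> y) / 2" by (simp add: add_pos_nonneg)
    have "(1 + (y \<bullet> y) / 2) powr (- (p + 1/2 + real ?s)) = (1 + (y \<bullet> y) / 2) powr (- (p + 1/2)) * (1 + (y \<bullet> y) / 2) powr (- real ?s)"
      by (simp only: minus_add_distrib powr_add)
    also have "(1 + (y \<bullet> y) / 2) powr (- real ?s) = std_weight y ^ ?s"
      using pos by (simp only: powr_minus powr_realpow std_weight_def power_one_over inverse_eq_divide)
    finally show ?thesis by (simp add: std_density_def)
  qed
  have "(\<integral>\<^sup>+y. ennreal (std_density p y * std_weight y ^ ?s * ?P y) \<partial>lborel) =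
      ennreal ?K * (\<integral>\<^sup>+y. ennreal (?P y * (1 + (y \<bullet> y) / 2) powr (- (p + 1/2 + real ?s))) \<partial>lborel)"
    unfolding w using K by (subst nn_integral_cmult[symmetric]) (auto simp: ennreal_mult')
  also have "\<dots> = ennreal ?K * ennreal (?c * ?m * Gamma (p + 1/2 + real ?s - real CARD('n) / 2 - real ?s) / Gamma (p + 1/2 + real ?s))"
    using p by (subst nn_integral_radial_even_moment) (auto simp: field_simps)
  also have "\<dots> = ennreal (?m * (?K * ?c * Gamma (p + 1/2 - real CARD('n) / 2)) / Gamma (p + 1/2 + real ?s))"
  proof -
    have "p + 1/2 + real ?s - real CARD('n) / 2 - real ?s = p + 1/2 - real CARD('n) / 2" by simp
    then show ?thesis using K by (subst ennreal_mult'[symmetric]) (simp_all only: less_imp_le, simp add: mult_ac)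
  qed
  also have "?K * ?c * Gamma (p + 1/2 - real CARD('n) / 2) = Gamma (p + 1/2)"
    by (rule mix_const_eq[OF p])
  finally have I: "(\<integral>\<^sup>+y. ennreal (std_density p y * std_weight y ^ ?s * ?P y) \<partial>lborel) =
      ennreal (?m * (Gamma (p + 1/2) / Gamma (p + 1/2 + real ?s)))" by simp
  show ?thesis
  proof (rule has_bochner_integral_nn_integral)
    show "(\<lambda>y. std_density p y * std_weight y ^ ?s * ?P y) \<in> borel_measurable lborel"
      by measurable
    show "AE y in lborel. 0 \<le> std_density p y * std_weight y ^ ?s * ?P y"
      unfolding w using K P0 by simp
    have "0 < Gamma (p + 1/2 + real ?s)" by (intro Gamma_real_pos add_pos_nonneg[OF p0] of_nat_0_le_iff)
    then show "0 \<le> ?m * (Gamma (p + 1/2) / Gamma (p + 1/2 + real ?s))"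
      using m0 Gamma_real_pos[OF p0] by simp
  qed (rule I)
qed

lemma std_density_moment_0:
  assumes p: "p > (real CARD('n) - 1) / 2"
  shows "has_bochner_integral lborel (std_density p :: real^'n \<Rightarrow> real) 1"
  using std_even_moment[OF p, of "\<lambda>_. 0"] Gamma_real_pos[OF shape_pos[OF p]] by simp

text \<open>Since \<open>std_density\<close> and \<open>std_weight\<close> are invariant under these
  reflections, a monomial odd in some coordinate has integral 0.\<close>

lemma integral_reflect_coordinate:
  fixes f :: "real^'n \<Rightarrow> real"
  assumes [measurable]: "f \<in> borel_measurable borel"
  shows "(\<integral>y. f y \<partial>lborel) = (\<integral>y. f (\<chi> i. if i = a then - y $ i else y $ i) \<partial>lborel)"
proof -
  let ?B = "(\<chi> i j. if i = j then if i = a then - 1 else 1 else 0) :: real^'n^'n"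
  have "?B *v y = (\<chi> i. if i = a then - y $ i else y $ i)" for y
  proof -
    have "(\<Sum>j\<in>UNIV. (if i = j then if i = a then - 1 else 1 else 0) * y $ j) =
      (\<Sum>j\<in>UNIV. if i = j then if i = a then - y $ i else y $ i else 0)" for i
      by (rule sum.cong) auto
    then show ?thesis by (simp add: vec_eq_iff matrix_vector_mult_def)
  qed
  moreover have "det ?B = -1"
    by (subst det_diagonal) (auto simp: prod.If_cases)
  ultimately show ?thesis using integral_matrix_vector_mult[of ?B f] by simp
qed

lemma inner_reflect_coordinate:
  "(\<chi> i. if i = a then - y $ i else y $ i) \<bullet> (\<chi> i. if i = a then - y $ i else y $ i) = y \<bullet> (y::real^'n)"
  unfolding inner_vec_def by (rule sum.cong) auto

lemma std_reflect_coordinate: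
  "std_density p (\<chi> i. if i = a then - y $ i else y $ i) = std_density p y"
  "std_weight (\<chi> i. if i = a then - y $ i else y $ i) = std_weight y"
  by (simp_all only: std_density_def std_weight_def inner_reflect_coordinate)

text \<open>From |y_i y_j| <= |y|^2 <= 2 (1 + |y|^2/2). Boundedness yields integrability also for
  the monomials that are not even, which \<open>std_even_moment\<close> does not reach.\<close>

lemma std_weight_bound: "\<bar>std_weight y * (y $ i * y $ j)\<bar> \<le> 2"
proof -
  have "\<bar>y $ i\<bar> * \<bar>y $ j\<bar> \<le> norm y * norm y" by (intro mult_mono component_le_norm_cart) auto
  then have "\<bar>y $ i * y $ j\<bar> \<le> y \<bullet> y" by (simp add: abs_mult dot_square_norm power2_eq_square)
  moreover have "0 < 2 + y \<bullet> y" by (simp add: add_pos_nonneg)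
  ultimately show ?thesis by (simp add: std_weight_def abs_mult field_simps)
qed

lemma integrable_std_density_bounded:
  fixes g :: "real^'n \<Rightarrow> real"
  assumes p: "p > (real CARD('n) - 1) / 2" and [measurable]: "g \<in> borel_measurable borel" and "\<And>y. \<bar>g y\<bar> \<le> b"
  shows "integrable lborel (\<lambda>y. std_density p y * g y)"
proof (rule Bochner_Integration.integrable_bound)
  show "integrable lborel (\<lambda>y. std_density p (y::real^'n) * b)"
    using std_density_moment_0[OF p] by (auto simp: has_bochner_integral_iff)
  have "\<bar>g y\<bar> \<le> \<bar>b\<bar>" for y using assms(3)[of y] by linarith
  then show "AE y in lborel. norm (std_density p y * g y) \<le> norm (std_density p y * b)"
    by (auto simp: abs_mult intro!: mult_left_mono)
qed measurable

lemma std_density_moment_2: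
  fixes i j :: "'n::finite"
  assumes p: "p > (real CARD('n) - 1) / 2"
  shows "has_bochner_integral lborel (\<lambda>y. std_density p y * (std_weight y * (y $ i * y $ j)))
    (of_bool (i = j) / (p + 1/2))"
proof (cases "i = j")
  case True
  let ?k = "\<lambda>m. if m = i then 1 else 0 :: nat"
  have s: "(\<Sum>m\<in>UNIV. ?k m) = 1" by simp
  have "(\<Prod>m\<in>UNIV. fact (2 * ?k m) / (2 ^ ?k m * fact (?k m))) = (1::real)"
    by (intro prod.neutral) (auto simp: fact_numeral)
  moreover have "(\<Prod>m\<in>UNIV. (y $ m) ^ (2 * ?k m)) = y $ i * y $ j" for y :: "real^'n"
  proof -
    have "(\<Prod>m\<in>UNIV. (y $ m) ^ (2 * ?k m)) = (\<Prod>m\<in>UNIV. if m = i then (y $ i)\<^sup>2 else 1)" by (rule prod.cong) auto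
    then show ?thesis using True by (simp add: power2_eq_square)
  qed
  moreover have "Gamma (p + 1/2) / Gamma (p + 1/2 + 1) = 1 / (p + 1/2)"
  proof -
    have 1: "0 < p + 1/2" by (rule shape_pos[OF p])
    have "Gamma (p + 1/2 + 1) = (p + 1/2) * Gamma (p + 1/2)"
      using 1 by (intro Gamma_plus1) (auto simp: nonpos_Ints_def elim!: Ints_cases)
    moreover have "Gamma (p + 1/2) \<noteq> 0" using Gamma_real_pos[OF 1] by (rule less_imp_neq[symmetric])
    ultimately show ?thesis by simp
  qed
  ultimately show ?thesis using std_even_moment[OF p, of ?k] True unfolding s by (simp add: mult.assoc)
next
  case False
  let ?f = "\<lambda>y::real^'n. std_density p y * (std_weight y * (y $ i * y $ j))"
  have "integrable lborel ?f"
    by (rule integrable_std_density_bounded[OF p _ std_weight_bound]) measurable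
  moreover have "(\<integral>y. ?f y \<partial>lborel) = (\<integral>y. - ?f y \<partial>lborel)"
    using False by (subst integral_reflect_coordinate[where a = i]) (auto simp: std_reflect_coordinate)
  ultimately show ?thesis using False by (auto simp: has_bochner_integral_iff)
qed

text \<open>The three pairings of Isserlis' formula for Gaussian fourth moments. Four equal indices
  give 4!/(2^2 2!) = 3, two distinct pairs give 1, and otherwise some index value occurs an odd
  number of times and a reflection kills the integral. The denominator is the ratio of Gamma values
  two steps apart.\<close>

lemma std_density_moment_4:
  fixes i j k l :: "'n::finite"
  assumes p: "p > (real CARD('n) - 1) / 2"
  shows "has_bochner_integral lborel
    (\<lambda>y. std_density p y * ((std_weight y * (y $ i * y $ j)) * (std_weight y * (y $ k * y $ l))))
    ((of_bool (i = j \<and> k = l) + of_bool (i = k \<and> j = l) + of_bool (i = l \<and> j = k)) / ((p + 1/2) * (p + 3/2)))"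
proof -
  define F where "F i j k l y = std_density p y * ((std_weight y * (y $ i * y $ j)) * (std_weight y * (y $ k * y $ l)))"
    for i j k l and y :: "real^'n"
  let ?g = "1 / ((p + 1/2) * (p + 3/2))"
  have int: "integrable lborel (F i j k l)" for i j k l
    unfolding F_def
  proof (rule integrable_std_density_bounded[OF p, where b = 4])
    fix y :: "real^'n"
    have "\<bar>std_weight y * (y $ i * y $ j)\<bar> * \<bar>std_weight y * (y $ k * y $ l)\<bar> \<le> 2 * 2"
      by (intro mult_mono std_weight_bound) auto
    then show "\<bar>std_weight y * (y $ i * y $ j) * (std_weight y * (y $ k * y $ l))\<bar> \<le> 4" by (simp add: abs_mult)
  qed measurable
  have G: "Gamma (p + 1/2) / Gamma (p + 1/2 + 2) = ?g"
  proof -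
    have 1: "0 < p + 1/2" by (rule shape_pos[OF p])
    have "Gamma (p + 1/2 + 1 + 1) = (p + 1/2 + 1) * Gamma (p + 1/2 + 1)"
      using 1 by (intro Gamma_plus1) (auto simp: nonpos_Ints_def elim!: Ints_cases)
    also have "Gamma (p + 1/2 + 1) = (p + 1/2) * Gamma (p + 1/2)"
      using 1 by (intro Gamma_plus1) (auto simp: nonpos_Ints_def elim!: Ints_cases)
    finally show ?thesis using Gamma_real_pos[OF 1] by (simp add: add.commute add.left_commute)
  qed
  have eq3: "(\<integral>y. F i i i i y \<partial>lborel) = 3 * ?g" for i
  proof -
    let ?k = "\<lambda>m. if m = i then 2 else 0 :: nat"
    have s: "(\<Sum>m\<in>UNIV. ?k m) = 2" by simp
    have "(\<Prod>m\<in>UNIV. fact (2 * ?k m) / (2 ^ ?k m * fact (?k m))) = (\<Prod>m\<in>UNIV. if m = i then 3 else (1::real))"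
      by (intro prod.cong) (auto simp: fact_numeral)
    then have m: "(\<Prod>m\<in>UNIV. fact (2 * ?k m) / (2 ^ ?k m * fact (?k m))) = (3::real)" by simp
    have P: "(\<Prod>m\<in>UNIV. (y $ m) ^ (2 * ?k m)) = y $ i * y $ i * (y $ i * y $ i)" for y :: "real^'n"
    proof -
      have "(\<Prod>m\<in>UNIV. (y $ m) ^ (2 * ?k m)) = (\<Prod>m\<in>UNIV. if m = i then (y $ i) ^ 4 else 1)" by (rule prod.cong) auto
      then show ?thesis by (simp add: power4_eq_xxxx)
    qed
    show ?thesis
      using std_even_moment[OF p, of ?k] G unfolding s P m
      by (simp add: has_bochner_integral_iff F_def power2_eq_square mult_ac)
  qed
  have eq1: "(\<integral>y. F i i k k y \<partial>lborel) = ?g" if "i \<noteq> k" for i k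
  proof -
    let ?k = "\<lambda>m. (if m = i then 1 else 0) + (if m = k then 1 else 0) :: nat"
    have s: "(\<Sum>m\<in>UNIV. ?k m) = 2" by (simp add: sum.distrib)
    have m: "(\<Prod>m\<in>UNIV. fact (2 * ?k m) / (2 ^ ?k m * fact (?k m))) = (1::real)"
      using that by (intro prod.neutral) (auto simp: fact_numeral)
    have P: "(\<Prod>m\<in>UNIV. (y $ m) ^ (2 * ?k m)) = y $ i * y $ i * (y $ k * y $ k)" for y :: "real^'n"
    proof -
      have "(\<Prod>m\<in>UNIV. (y $ m) ^ (2 * ?k m)) = (\<Prod>m\<in>UNIV. (if m = i then (y $ i)\<^sup>2 else 1) * (if m = k then (y $ k)\<^sup>2 else 1))"
        using that by (intro prod.cong) (auto simp: power2_eq_square)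
      then show ?thesis by (simp add: power2_eq_square prod.distrib)
    qed
    show ?thesis
      using std_even_moment[OF p, of ?k] G unfolding s P m
      by (simp add: has_bochner_integral_iff F_def power2_eq_square mult_ac)
  qed
  have perm: "F i k i k = F i i k k" "F i k k i = F i i k k" for i k
    by (auto simp: F_def fun_eq_iff mult_ac)
  define sg where "sg a m = (if m = a then -1 else 1 :: real)" for a m :: 'n
  have refl: "(\<integral>y. F i j k l y \<partial>lborel) = sg a i * sg a j * sg a k * sg a l * (\<integral>y. F i j k l y \<partial>lborel)" for a i j k l
  proof -
    have "(\<integral>y. F i j k l y \<partial>lborel) = (\<integral>y. F i j k l (\<chi> i. if i = a then - y $ i else y $ i) \<partial>lborel)"
      by (rule integral_reflect_coordinate) (simp add: F_def[abs_def])
    also have "\<dots> = (\<integral>y. sg a i * sg a j * sg a k * sg a l * F i j k l y \<partial>lborel)"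
      by (rule Bochner_Integration.integral_cong) (auto simp: F_def std_reflect_coordinate sg_def)
    finally show ?thesis by simp
  qed
  have "(\<integral>y. F i j k l y \<partial>lborel) =
    (of_bool (i = j \<and> k = l) + of_bool (i = k \<and> j = l) + of_bool (i = l \<and> j = k)) * ?g"
  proof (cases "(i = j \<and> k = l) \<or> (i = k \<and> j = l) \<or> (i = l \<and> j = k)")
    case True
    then show ?thesis using eq3[of i] eq1[of i j] eq1[of i k] perm[of i j] perm[of i k]
      by (cases "i = j"; cases "i = k") auto
  next
    case False
    have "\<exists>a. sg a i * sg a j * sg a k * sg a l = - 1"
    proof -
      \<comment> \<open>Trying i, j and k suffices: the multiplicities sum to 4, so the value of l
        cannot be the only one of odd multiplicity.\<close>
      have "sg i i * sg i j * sg i k * sg i l = - 1 \<or> sg j i * sg j j * sg j k * sg j l = - 1 \<or>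
        sg k i * sg k j * sg k k * sg k l = - 1"
        using False by (auto simp: sg_def)
      then show ?thesis by blast
    qed
    then obtain a where "sg a i * sg a j * sg a k * sg a l = - 1" by blast
    then have "(\<integral>y. F i j k l y \<partial>lborel) = - (\<integral>y. F i j k l y \<partial>lborel)"
      using refl[of i j k l a] by (metis mult_minus1)
    then have zero: "(\<integral>y. F i j k l y \<partial>lborel) = 0" by linarith
    have ne: "\<not> (i = j \<and> k = l)" "\<not> (i = k \<and> j = l)" "\<not> (i = l \<and> j = k)" using False by blast+
    have "of_bool (i = j \<and> k = l) + of_bool (i = k \<and> j = l) + of_bool (i = l \<and> j = k) = (0::real)"
      by (simp only: ne of_bool_eq add_0)
    then show ?thesis by (simp only: zero mult_zero_left)
  qed
  with int show ?thesis by (simp add: has_bochner_integral_iff F_def[abs_def])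
qed

section \<open>Score and Fisher information\<close>

lemma trace_scaleR: "trace (c *\<^sub>R (A::real^'n^'n)) = c * trace A"
  by (simp add: trace_def sum_distrib_left)

text \<open>The rays \<sigma> + t x x^T with t >= 0 stay in the cone, so the one-sided derivative
  along them is determined. It equals x^T g x, and polarization recovers the symmetric
  \<open>g\<close>.\<close>

lemma sym_gradient_unique:
  fixes \<phi> :: "real^'n^'n \<Rightarrow> real"
  assumes \<sigma>: "\<sigma> \<in> pos_def_mats" and g: "g \<in> sym_mats" "g' \<in> sym_mats"
    and d: "(\<phi> has_derivative (\<lambda>h. trace (g ** h))) (at \<sigma> within pos_def_mats)"
    and d': "(\<phi> has_derivative (\<lambda>h. trace (g' ** h))) (at \<sigma> within pos_def_mats)"
  shows "g = g'"
proof (rule sym_mats_eqI[OF g])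
  fix x :: "real^'n"
  have dir: "((\<lambda>t. \<phi> (\<sigma> + t *\<^sub>R outer x)) has_vector_derivative (x \<bullet> (a *v x))) (at 0 within {0..})"
    if a: "(\<phi> has_derivative (\<lambda>h. trace (a ** h))) (at \<sigma> within pos_def_mats)" for a
  proof -
    have sub: "(\<lambda>t. \<sigma> + t *\<^sub>R outer x) ` {0..} \<subseteq> pos_def_mats"
      using pos_def_mats_add_outer[OF \<sigma>] by auto
    have "((\<lambda>t. \<sigma> + t *\<^sub>R outer x) has_derivative (\<lambda>t. t *\<^sub>R outer x)) (at 0 within {0..})"
      by (auto intro!: derivative_eq_intros)
    then have "((\<lambda>t. \<phi> (\<sigma> + t *\<^sub>R outer x)) has_derivative (\<lambda>t. trace (a ** (t *\<^sub>R outer x)))) (at 0 within {0..})"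
      using has_derivative_in_compose[of "\<lambda>t. \<sigma> + t *\<^sub>R outer x" "\<lambda>t. t *\<^sub>R outer x" 0 "{0..}" \<phi> "\<lambda>h. trace (a ** h)"]
        has_derivative_subset[OF a sub] by simp
    moreover have "trace (a ** (t *\<^sub>R outer x)) = t *\<^sub>R (x \<bullet> (a *v x))" for t
      by (simp add: matrix_mult_scaleR_right trace_scaleR trace_mul_sym[of a] trace_outer_mult)
    ultimately show ?thesis by (simp add: has_vector_derivative_def)
  qed
  have "at (0::real) within {0..} \<noteq> bot"
    by (simp add: at_within_Ici_at_right)
  then show "x \<bullet> (g *v x) = x \<bullet> (g' *v x)"
    using vector_derivative_unique_within dir[OF d] dir[OF d'] by blast
qed

lemma bounded_linear_inner_matrix_vector: "bounded_linear (\<lambda>u::real^'n^'n. x \<bullet> (u *v x))"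
  by (auto intro!: linear_conv_bounded_linear[THEN iffD1] linearI
      simp: matrix_vector_mult_add_rdistrib inner_add_right scaleR_matrix_vector)

lemma sym_gradient_ln_mix_density:
  fixes \<sigma> w :: "real^'n^'n"
  assumes p: "p > (real CARD('n) - 1) / 2" and \<sigma>: "\<sigma> \<in> pos_def_mats"
    and w: "w \<in> sym_mats" "\<sigma> ** w = mat 1" "w ** \<sigma> = mat 1"
  shows "sym_gradient (\<lambda>\<tau>. ln (mix_density p \<tau> x)) \<sigma> =
    (1/2) *\<^sub>R w - ((p + 1/2) / 2 / (1 + x \<bullet> (\<sigma> *v x) / 2)) *\<^sub>R outer x" (is "_ = ?g")
proof -
  let ?K = "mix_const TYPE('n) p"
  have K: "0 < ?K" by (rule mix_const_pos[OF p])
  have ln_eq: "ln (mix_density p \<tau> x) = ln ?K + ln (det \<tau>) / 2 - (p + 1/2) * ln (1 + x \<bullet> (\<tau> *v x) / 2)"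
    if "\<tau> \<in> pos_def_mats" for \<tau>
  proof -
    have "0 < 1 + x \<bullet> (\<tau> *v x) / 2" using pos_def_mats_nonneg[OF that, of x] by simp
    then show ?thesis using K det_pos_def[OF that]
      by (simp add: mix_density_eq[OF p that] ln_mult ln_sqrt ln_powr) (simp add: algebra_simps)
  qed
  have pos: "0 < 1 + x \<bullet> (\<sigma> *v x) / 2" using pos_def_mats_nonneg[OF \<sigma>, of x] by simp
  have det: "0 < det \<sigma>" by (rule det_pos_def[OF \<sigma>])
  \<comment> \<open>The derivative is stated in the raw shape, with its zero summands, in which the
    rules assemble it; it is simplified afterwards.\<close>
  have "((\<lambda>\<tau>. ln ?K + ln (det \<tau>) / 2 - (p + 1/2) * ln (1 + x \<bullet> (\<tau> *v x) / 2)) has_derivative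
      (\<lambda>h. 0 + (det \<sigma> * trace (w ** h)) * (1 / det \<sigma>) / 2 - (p + 1/2) * ((0 + x \<bullet> (h *v x) / 2) * (1 / (1 + x \<bullet> (\<sigma> *v x) / 2)))))
      (at \<sigma> within pos_def_mats)"
    by (intro has_derivative_diff has_derivative_add has_derivative_const bounded_linear.has_derivative[OF bounded_linear_divide]
        has_derivative_mult_right DERIV_compose_FDERIV[OF DERIV_ln_divide] det pos det_has_derivative[OF w(2,3)]
        bounded_linear.has_derivative[OF bounded_linear_inner_matrix_vector has_derivative_ident])
  moreover have "0 + (det \<sigma> * trace (w ** h)) * (1 / det \<sigma>) / 2 - (p + 1/2) * ((0 + x \<bullet> (h *v x) / 2) * (1 / (1 + x \<bullet> (\<sigma> *v x) / 2)))
      = trace (?g ** h)" for h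
  proof -
    have "trace (?g ** h) = trace (w ** h) / 2 - (p + 1/2) / 2 / (1 + x \<bullet> (\<sigma> *v x) / 2) * (x \<bullet> (h *v x))"
      by (simp add: matrix_diff_rdistrib matrix_mult_scaleR_left trace_sub trace_scaleR trace_outer_mult)
    then show ?thesis using det by simp
  qed
  ultimately have "((\<lambda>\<tau>. ln ?K + ln (det \<tau>) / 2 - (p + 1/2) * ln (1 + x \<bullet> (\<tau> *v x) / 2)) has_derivative
      (\<lambda>h. trace (?g ** h))) (at \<sigma> within pos_def_mats)" by simp
  then have d: "((\<lambda>\<tau>. ln (mix_density p \<tau> x)) has_derivative (\<lambda>h. trace (?g ** h))) (at \<sigma> within pos_def_mats)"
    by (rule has_derivative_transform[OF \<sigma>, rotated]) (simp add: ln_eq)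
  have s: "?g \<in> sym_mats"
    using w(1) outer_in_sym_mats[of x] by (simp add: sym_mats_def transpose_def vec_eq_iff)
  show ?thesis unfolding sym_gradient_def
  proof (rule the_equality)
    show "?g \<in> sym_mats \<and>
      ((\<lambda>\<tau>. ln (mix_density p \<tau> x)) has_derivative (\<lambda>h. trace (?g ** h))) (at \<sigma> within pos_def_mats)"
      using s d by (rule conjI)
  next
    fix g assume "g \<in> sym_mats \<and>
      ((\<lambda>\<tau>. ln (mix_density p \<tau> x)) has_derivative (\<lambda>h. trace (g ** h))) (at \<sigma> within pos_def_mats)"
    then show "g = ?g" using sym_gradient_unique[OF \<sigma> _ s _ d] by blast
  qed
qed

lemma has_bochner_integral_matrixI:
  fixes f :: "'a \<Rightarrow> real^'n^'m"
  assumes "\<And>i j. has_bochner_integral M (\<lambda>x. f x $ i $ j) (z $ i $ j)"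
  shows "has_bochner_integral M f z"
proof -
  have rep: "a = (\<Sum>b\<in>Basis. (a \<bullet> b) *\<^sub>R b)" for a :: "real^'n^'m" by (simp add: euclidean_representation)
  have "has_bochner_integral M (\<lambda>x. \<Sum>b\<in>Basis. (f x \<bullet> b) *\<^sub>R b) (\<Sum>b\<in>Basis. (z \<bullet> b) *\<^sub>R b)"
  proof (intro has_bochner_integral_sum has_bochner_integral_scaleR_left)
    fix b :: "real^'n^'m" assume "b \<in> Basis"
    then obtain i j where "b = axis i (axis j 1)" by (auto simp: Basis_vec_def)
    then show "has_bochner_integral M (\<lambda>x. f x \<bullet> b) (z \<bullet> b)" using assms by (simp add: inner_axis)
  qed
  then show ?thesis by (simp only: euclidean_representation)
qed

definition std_score :: "real \<Rightarrow> real^'n \<Rightarrow> real^'n^'n" where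
  "std_score p y = (1/2) *\<^sub>R mat 1 - ((p + 1/2) / 2 * std_weight y) *\<^sub>R outer y"

text \<open>Entrywise, the integrand is the density times (tr v / 2 - c S)(d/2 - c q_ij), where S is
  the sum of v_kl q_kl, q_kl is \<open>std_weight y\<close> times y_k y_l, and d is the Kronecker
  delta. Expansion leaves only moments of order 0, 2 and 4.\<close>

lemma std_fisher_information:
  fixes v :: "real^'n^'n"
  assumes p: "p > (real CARD('n) - 1) / 2" and v: "v \<in> sym_mats"
  shows "has_bochner_integral lborel (\<lambda>y. std_density p y *\<^sub>R tensor_sq (std_score p y) v)
    ((1 / (2 * (2 * p + 3))) *\<^sub>R ((2 * p + 1) *\<^sub>R v - trace v *\<^sub>R mat 1))"
proof (rule has_bochner_integral_matrixI)
  fix i j :: 'n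
  define c where "c = (p + 1/2) / 2"
  define d :: real where "d = of_bool (i = j)"
  let ?f = "std_density p :: real^'n \<Rightarrow> real" and ?q = "\<lambda>k l y. std_weight y * ((y::real^'n) $ k * y $ l)"
  have p0: "0 < p + 1/2" by (rule shape_pos[OF p])
  have tr: "trace (std_score p y ** v) = trace v / 2 - c * (\<Sum>k\<in>UNIV. \<Sum>l\<in>UNIV. v $ k $ l * ?q k l y)" for y
  proof -
    have "trace (std_score p y ** v) = trace v / 2 - c * std_weight y * (y \<bullet> (v *v y))"
      by (simp add: std_score_def c_def matrix_diff_rdistrib matrix_mult_scaleR_left trace_sub trace_scaleR trace_outer_mult)
    also have "y \<bullet> (v *v y) = (\<Sum>k\<in>UNIV. \<Sum>l\<in>UNIV. v $ k $ l * (y $ k * y $ l))"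
      by (simp add: inner_vec_def matrix_vector_mult_def sum_distrib_left mult_ac)
    finally show ?thesis by (simp add: sum_distrib_left mult_ac)
  qed
  have integrand: "(?f y *\<^sub>R tensor_sq (std_score p y) v) $ i $ j =
     (trace v * d / 4) * ?f y - (c * trace v / 2) * (?f y * ?q i j y)
     - (c * d / 2) * (\<Sum>k\<in>UNIV. \<Sum>l\<in>UNIV. v $ k $ l * (?f y * ?q k l y))
     + c\<^sup>2 * (\<Sum>k\<in>UNIV. \<Sum>l\<in>UNIV. v $ k $ l * (?f y * (?q i j y * ?q k l y)))" for y
  proof -
    define S where "S = (\<Sum>k\<in>UNIV. \<Sum>l\<in>UNIV. v $ k $ l * ?q k l y)"
    have S: "(\<Sum>k\<in>UNIV. \<Sum>l\<in>UNIV. v $ k $ l * (?f y * ?q k l y)) = ?f y * S"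
      "(\<Sum>k\<in>UNIV. \<Sum>l\<in>UNIV. v $ k $ l * (?f y * (?q i j y * ?q k l y))) = ?f y * (?q i j y * S)"
      by (simp_all add: S_def sum_distrib_left mult_ac)
    have "std_score p y $ i $ j = d / 2 - c * ?q i j y"
      by (simp add: std_score_def c_def d_def outer_def mat_def)
    then have "(?f y *\<^sub>R tensor_sq (std_score p y) v) $ i $ j = ?f y * ((trace v / 2 - c * S) * (d / 2 - c * ?q i j y))"
      by (simp add: tensor_sq_def tr S_def)
    then show ?thesis unfolding S by (simp add: algebra_simps power2_eq_square)
  qed
  let ?\<delta> = "\<lambda>k l. of_bool (k = l) / (p + 1/2)"
  let ?\<delta>4 = "\<lambda>k l. (of_bool (i = j \<and> k = l) + of_bool (i = k \<and> j = l) + of_bool (i = l \<and> j = k)) / ((p + 1/2) * (p + 3/2))"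
  have hb: "has_bochner_integral lborel (\<lambda>y. (?f y *\<^sub>R tensor_sq (std_score p y) v) $ i $ j)
     ((trace v * d / 4) * 1 - (c * trace v / 2) * ?\<delta> i j
     - (c * d / 2) * (\<Sum>k\<in>UNIV. \<Sum>l\<in>UNIV. v $ k $ l * ?\<delta> k l)
     + c\<^sup>2 * (\<Sum>k\<in>UNIV. \<Sum>l\<in>UNIV. v $ k $ l * ?\<delta>4 k l))"
    unfolding integrand
    by (intro has_bochner_integral_add has_bochner_integral_diff has_bochner_integral_mult_right
        has_bochner_integral_sum std_density_moment_0[OF p] std_density_moment_2[OF p] std_density_moment_4[OF p])
  have s2: "(\<Sum>k\<in>UNIV. \<Sum>l\<in>UNIV. v $ k $ l * ?\<delta> k l) = trace v / (p + 1/2)"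
  proof -
    have "(\<Sum>l\<in>UNIV. v $ k $ l * ?\<delta> k l) = (\<Sum>l\<in>UNIV. if k = l then v $ k $ k / (p + 1/2) else 0)" for k
      by (rule sum.cong) auto
    then show ?thesis by (simp add: trace_def sum_divide_distrib)
  qed
  have s4: "(\<Sum>k\<in>UNIV. \<Sum>l\<in>UNIV. v $ k $ l * ?\<delta>4 k l) = (trace v * d + v $ i $ j + v $ j $ i) / ((p + 1/2) * (p + 3/2))"
  proof -
    have "(\<Sum>k\<in>UNIV. \<Sum>l\<in>UNIV. v $ k $ l * ?\<delta>4 k l) = (\<Sum>k\<in>UNIV. \<Sum>l\<in>UNIV.
        ((if k = l then d * v $ k $ k else 0) + (if k = i then if l = j then v $ i $ j else 0 else 0)
         + (if k = j then if l = i then v $ j $ i else 0 else 0)) / ((p + 1/2) * (p + 3/2)))"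
      by (intro sum.cong refl) (auto simp: d_def)
    also have "\<dots> = (\<Sum>k\<in>UNIV. \<Sum>l\<in>UNIV.
        (if k = l then d * v $ k $ k else 0) + (if k = i then if l = j then v $ i $ j else 0 else 0)
         + (if k = j then if l = i then v $ j $ i else 0 else 0)) / ((p + 1/2) * (p + 3/2))"
      by (simp only: sum_divide_distrib)
    also have "(\<Sum>k\<in>UNIV. \<Sum>l\<in>UNIV.
        (if k = l then d * v $ k $ k else 0) + (if k = i then if l = j then v $ i $ j else 0 else 0)
         + (if k = j then if l = i then v $ j $ i else 0 else 0)) = trace v * d + v $ i $ j + v $ j $ i"
    proof -
      have "(\<Sum>l\<in>UNIV. (if k = l then d * v $ k $ k else 0) + (if k = i then if l = j then v $ i $ j else 0 else 0)
         + (if k = j then if l = i then v $ j $ i else 0 else 0)) =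
         d * v $ k $ k + (if k = i then v $ i $ j else 0) + (if k = j then v $ j $ i else 0)" for k
        by (cases "k = i"; cases "k = j") (simp_all add: sum.distrib)
      then have "(\<Sum>k\<in>UNIV. \<Sum>l\<in>UNIV.
          (if k = l then d * v $ k $ k else 0) + (if k = i then if l = j then v $ i $ j else 0 else 0)
           + (if k = j then if l = i then v $ j $ i else 0 else 0)) =
         (\<Sum>k\<in>UNIV. d * v $ k $ k + (if k = i then v $ i $ j else 0) + (if k = j then v $ j $ i else 0))"
        by (simp only:)
      then show ?thesis by (simp only: sum.distrib) (simp add: trace_def mult.commute flip: sum_distrib_left)
    qed
    finally show ?thesis .
  qed
  have sym: "v $ j $ i = v $ i $ j" using v by (auto simp: sym_mats_def transpose_def vec_eq_iff)
  have "(trace v * d / 4) * 1 - (c * trace v / 2) * ?\<delta> i j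
     - (c * d / 2) * (\<Sum>k\<in>UNIV. \<Sum>l\<in>UNIV. v $ k $ l * ?\<delta> k l)
     + c\<^sup>2 * (\<Sum>k\<in>UNIV. \<Sum>l\<in>UNIV. v $ k $ l * ?\<delta>4 k l)
     = ((1 / (2 * (2 * p + 3))) *\<^sub>R ((2 * p + 1) *\<^sub>R v - trace v *\<^sub>R mat 1)) $ i $ j"
  proof -
    have nz: "p + 1/2 \<noteq> 0" "p + 3/2 \<noteq> 0" "2 * p + 3 \<noteq> 0" using p0 by auto
    \<comment> \<open>By this value the first three terms combine to -1/4 of the trace times d; the
      coefficient from \<open>b\<close> then turns this into -1/(2(2p + 3)).\<close>
    have a: "c / (p + 1/2) = 1/2" using nz by (simp add: c_def)
    have b: "c\<^sup>2 / ((p + 1/2) * (p + 3/2)) = (2 * p + 1) / (4 * (2 * p + 3))"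
    proof -
      have "c\<^sup>2 / ((p + 1/2) * (p + 3/2)) = ((p + 1/2) / 4) / (p + 3/2)"
        using nz(1) by (simp add: c_def power2_eq_square)
      also have "\<dots> = (2 * p + 1) / (4 * (2 * p + 3))"
        using nz by (simp add: frac_eq_eq) (simp add: algebra_simps)
      finally show ?thesis .
    qed
    have "(trace v * d / 4) * 1 - (c * trace v / 2) * ?\<delta> i j
     - (c * d / 2) * (trace v / (p + 1/2))
     + c\<^sup>2 * ((trace v * d + v $ i $ j + v $ i $ j) / ((p + 1/2) * (p + 3/2)))
     = trace v * d / 4 - (c / (p + 1/2)) * trace v * d / 2 - (c / (p + 1/2)) * trace v * d / 2
       + (c\<^sup>2 / ((p + 1/2) * (p + 3/2))) * (trace v * d + 2 * v $ i $ j)"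
    proof -
      have "(T * d / 4) * 1 - (c * T / 2) * (d / P) - (c * d / 2) * (T / P) + c\<^sup>2 * ((T * d + V + V) / R)
        = T * d / 4 - (c / P) * T * d / 2 - (c / P) * T * d / 2 + (c\<^sup>2 / R) * (T * d + 2 * V)" for T V P R
        by (simp add: algebra_simps add_divide_distrib)
      then show ?thesis unfolding d_def .
    qed
    also have "\<dots> = (1 / (2 * (2 * p + 3))) * ((2 * p + 1) * v $ i $ j - trace v * d)"
      unfolding a b using nz(3) by (simp add: field_simps)
    also have "\<dots> = ((1 / (2 * (2 * p + 3))) *\<^sub>R ((2 * p + 1) *\<^sub>R v - trace v *\<^sub>R mat 1)) $ i $ j"
      by (simp add: d_def mat_def)
    finally show ?thesis unfolding s2 s4 sym .
  qed
  with hb show "has_bochner_integral lborel (\<lambda>y. (?f y *\<^sub>R tensor_sq (std_score p y) v) $ i $ j)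
      (((1 / (2 * (2 * p + 3))) *\<^sub>R ((2 * p + 1) *\<^sub>R v - trace v *\<^sub>R mat 1)) $ i $ j)"
    by simp
qed

lemma bounded_linear_congruence: "bounded_linear (\<lambda>A::real^'n^'n. B ** A ** C)" for B C :: "real^'n^'n"
  by (auto intro!: linear_conv_bounded_linear[THEN iffD1] linearI
      simp: matrix_add_ldistrib matrix_add_rdistrib matrix_mult_scaleR_right matrix_mult_scaleR_left)

text \<open>With x = B y and w = B B^T the score is B (\<open>std_score\<close> at y) B^T, and the
  Jacobian absorbs sqrt(det \<sigma>). Conjugation by \<open>B\<close> moves onto the argument as v'
  = B^T v B and, being bounded linear, leaves the integral; B v' B^T is then w v w.\<close>

lemma fisher_information_mix_density:
  fixes \<sigma> w v :: "real^'n^'n"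
  assumes p: "p > (real CARD('n) - 1) / 2" and \<sigma>: "\<sigma> \<in> pos_def_mats"
    and w: "\<sigma> ** w = mat 1" "w ** \<sigma> = mat 1" and v: "v \<in> sym_mats"
  shows "fisher_information (mix_density p) \<sigma> v =
    (1 / (2 * (2 * p + 3))) *\<^sub>R ((2 * p + 1) *\<^sub>R quad_rep w v - tensor_sq w v)"
proof -
  obtain B :: "real^'n^'n" where B: "transpose B ** \<sigma> ** B = mat 1" "det B \<noteq> 0" "(det B)\<^sup>2 * det \<sigma> = 1"
    "\<And>y. (B *v y) \<bullet> (\<sigma> *v (B *v y)) = y \<bullet> y"
    using pos_def_congruent_identity[OF \<sigma>] by blast
  have wB: "w = B ** transpose B"
  proof -
    have "B ** (transpose B ** \<sigma>) = mat 1" using B(1) matrix_left_right_inverse by blast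
    then show ?thesis using w by (metis matrix_mul_assoc matrix_mul_lid matrix_mul_rid)
  qed
  then have ws: "w \<in> sym_mats" by (simp add: sym_mats_def matrix_transpose_mul)
  define v' where "v' = transpose B ** v ** B"
  have v': "v' \<in> sym_mats" using v by (simp add: v'_def sym_mats_def matrix_transpose_mul matrix_mul_assoc)
  define G where "G x = (1/2) *\<^sub>R w - ((p + 1/2) / 2 / (1 + x \<bullet> (\<sigma> *v x) / 2)) *\<^sub>R outer x" for x
  have G: "sym_gradient (\<lambda>\<tau>. ln (mix_density p \<tau> x)) \<sigma> = G x" for x
    unfolding G_def by (rule sym_gradient_ln_mix_density[OF p \<sigma> ws w])
  have GB: "G (B *v y) = B ** std_score p y ** transpose B" for y
    by (simp add: G_def std_score_def std_weight_def B(4) wB matrix_diff_ldistrib matrix_diff_rdistrib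
        matrix_mult_scaleR_left matrix_mult_scaleR_right congruence_outer)
  have tB: "trace (B ** A ** transpose B ** v) = trace (A ** v')" for A
  proof -
    have "trace (B ** (A ** transpose B ** v)) = trace (A ** transpose B ** v ** B)" by (rule trace_mul_sym)
    then show ?thesis by (simp add: v'_def matrix_mul_assoc)
  qed
  have dens: "\<bar>det B\<bar> * mix_density p \<sigma> (B *v y) = std_density p y" for y
  proof -
    have "\<bar>det B\<bar> * sqrt (det \<sigma>) = sqrt ((det B)\<^sup>2 * det \<sigma>)" by (simp add: real_sqrt_mult)
    then have "\<bar>det B\<bar> * sqrt (det \<sigma>) = 1" using B(3) by simp
    then show ?thesis
      by (simp add: mix_density_eq[OF p \<sigma>] B(4) std_density_def mult_ac)
  qed
  let ?L = "\<lambda>A. B ** A ** transpose B"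
  have "(\<lambda>x. mix_density p \<sigma> x *\<^sub>R tensor_sq (G x) v) \<in> borel_measurable borel"
  proof (intro borel_measurable_vecI)
    fix i j
    have [measurable]: "(\<lambda>x. G x $ k $ l) \<in> borel_measurable borel" for k l
      unfolding G_def outer_def by simp
    have "(\<lambda>x. (mix_density p \<sigma> x *\<^sub>R tensor_sq (G x) v) $ i $ j) =
      (\<lambda>x. mix_density p \<sigma> x * ((\<Sum>k\<in>UNIV. \<Sum>l\<in>UNIV. G x $ k $ l * v $ l $ k) * G x $ i $ j))"
      by (simp add: tensor_sq_def trace_def matrix_matrix_mult_def mult.assoc)
    moreover have "\<dots> \<in> borel_measurable borel" unfolding mix_density_eq[OF p \<sigma>] by measurable
    ultimately show "(\<lambda>x. (mix_density p \<sigma> x *\<^sub>R tensor_sq (G x) v) $ i $ j) \<in> borel_measurable borel" by simp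
  qed
  then have "fisher_information (mix_density p) \<sigma> v =
      \<bar>det B\<bar> *\<^sub>R (\<integral>y. mix_density p \<sigma> (B *v y) *\<^sub>R tensor_sq (G (B *v y)) v \<partial>lborel)"
    unfolding fisher_information_def G by (rule integral_matrix_vector_mult[OF B(2)])
  also have "\<dots> = (\<integral>y. \<bar>det B\<bar> *\<^sub>R (mix_density p \<sigma> (B *v y) *\<^sub>R tensor_sq (G (B *v y)) v) \<partial>lborel)"
    by (rule integral_scaleR_right[symmetric])
  also have "\<dots> = (\<integral>y. ?L (std_density p y *\<^sub>R tensor_sq (std_score p y) v') \<partial>lborel)"
    by (rule Bochner_Integration.integral_cong)
       (simp_all add: GB tensor_sq_def tB dens matrix_mult_scaleR_left matrix_mult_scaleR_right)
  also have "\<dots> = ?L ((1 / (2 * (2 * p + 3))) *\<^sub>R ((2 * p + 1) *\<^sub>R v' - trace v' *\<^sub>R mat 1))"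
    using has_bochner_integral_bounded_linear[OF bounded_linear_congruence std_fisher_information[OF p v']]
    by (rule has_bochner_integral_integral_eq)
  also have "\<dots> = (1 / (2 * (2 * p + 3))) *\<^sub>R ((2 * p + 1) *\<^sub>R ?L v' - trace v' *\<^sub>R w)"
    by (simp add: matrix_diff_ldistrib matrix_diff_rdistrib matrix_mult_scaleR_left matrix_mult_scaleR_right wB)
  also have "?L v' = quad_rep w v" by (simp add: v'_def quad_rep_def wB matrix_mul_assoc)
  also have "trace v' = trace (w ** v)" using tB[of "mat 1"] by (simp add: wB)
  finally show ?thesis by (simp add: tensor_sq_def)
qed

text \<open>The closed form of the information is inverted by exhibiting the inverse. Both
  compositions reduce to quad_rep \<sigma> and quad_rep w being mutually inverse, each taking the
  other matrix to its own, and to tr(w \<sigma>) = n.\<close>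

theorem proposition4p1:
  fixes p :: real and \<sigma> :: "real^'n^'n"
  assumes "p > (real CARD('n) - 1) / 2"
    and "\<sigma> \<in> pos_def_mats"
  shows "bij_betw (fisher_information (mix_density p) \<sigma>) sym_mats sym_mats \<and>
    (\<forall>v \<in> sym_mats.
       inv_into sym_mats (fisher_information (mix_density p) \<sigma>) v =
       (2 * (2 * p + 3) / (2 * p + 1)) *\<^sub>R
         (quad_rep \<sigma> v + (1 / (2 * p + 1 - real CARD('n))) *\<^sub>R tensor_sq \<sigma> v))"
proof -
  let ?I = "fisher_information (mix_density p) \<sigma>" and ?n = "real CARD('n)"
  let ?J = "\<lambda>v. (2 * (2 * p + 3) / (2 * p + 1)) *\<^sub>R (quad_rep \<sigma> v + (1 / (2 * p + 1 - ?n)) *\<^sub>R tensor_sq \<sigma> v)"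
  obtain w where w: "w \<in> pos_def_mats" "\<sigma> ** w = mat 1" "w ** \<sigma> = mat 1"
    using pos_def_inverse[OF assms(2)] by blast
  have I: "?I v = (1 / (2 * (2 * p + 3))) *\<^sub>R ((2 * p + 1) *\<^sub>R quad_rep w v - tensor_sq w v)" if "v \<in> sym_mats" for v
    by (rule fisher_information_mix_density[OF assms w(2,3) that])
  have p0: "0 < p + 1/2" by (rule shape_pos[OF assms(1)])
  have nz: "2 * p + 3 \<noteq> 0" "2 * p + 1 \<noteq> 0" "2 * p + 1 - ?n \<noteq> 0" using p0 assms(1) by auto
  have sym: "a *\<^sub>R quad_rep u v + b *\<^sub>R tensor_sq u v \<in> sym_mats" if "u \<in> sym_mats" "v \<in> sym_mats" for a b and u v :: "real^'n^'n"
  proof -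
    have "transpose (a *\<^sub>R A + b *\<^sub>R C) = a *\<^sub>R transpose A + b *\<^sub>R transpose C" for a b and A C :: "real^'n^'n"
      by (simp add: transpose_def vec_eq_iff)
    then show ?thesis using that
      by (simp add: sym_mats_def quad_rep_def tensor_sq_def matrix_transpose_mul matrix_mul_assoc)
  qed
  have symI: "?I v \<in> sym_mats" if "v \<in> sym_mats" for v
    using sym[OF pos_def_mats_sym[OF w(1)] that, of "(2 * p + 1) / (2 * (2 * p + 3))" "- 1 / (2 * (2 * p + 3))"] I[OF that]
    by (simp add: scaleR_diff_right)
  have symJ: "?J v \<in> sym_mats" if "v \<in> sym_mats" for v
    using sym[OF pos_def_mats_sym[OF assms(2)] that, of "2 * (2 * p + 3) / (2 * p + 1)" "2 * (2 * p + 3) / (2 * p + 1) * (1 / (2 * p + 1 - ?n))"]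
    by (simp add: scaleR_add_right)
  have qr: "quad_rep a (x *\<^sub>R A + y *\<^sub>R C) = x *\<^sub>R quad_rep a A + y *\<^sub>R quad_rep a C"
    and ts: "tensor_sq a (x *\<^sub>R A + y *\<^sub>R C) = (x * trace (a ** A) + y * trace (a ** C)) *\<^sub>R a"
    for a A C :: "real^'n^'n" and x y
    by (simp_all add: quad_rep_def tensor_sq_def matrix_add_ldistrib matrix_add_rdistrib
        matrix_mult_scaleR_left matrix_mult_scaleR_right trace_add trace_scaleR)
  have comp: "quad_rep a (quad_rep b v) = v" "quad_rep a b = a" "trace (a ** quad_rep b v) = trace (b ** v)" "trace (a ** b) = ?n"
    if ab: "a ** b = mat 1" "b ** a = mat 1" for a b v :: "real^'n^'n"
  proof -
    have "quad_rep a (quad_rep b v) = (a ** b) ** v ** (b ** a)" by (simp add: quad_rep_def matrix_mul_assoc)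
    then show "quad_rep a (quad_rep b v) = v" using ab by simp
    show "quad_rep a b = a" using ab by (simp add: quad_rep_def)
    have "trace (a ** quad_rep b v) = trace ((a ** b) ** v ** b)" by (simp add: quad_rep_def matrix_mul_assoc)
    then show "trace (a ** quad_rep b v) = trace (b ** v)" using ab by (simp add: trace_mul_sym[of v b])
    show "trace (a ** b) = ?n" using ab by (simp add: trace_def mat_def)
  qed
  have IJ: "?I (?J v) = v" if "v \<in> sym_mats" for v
  proof -
    define k where "k = 2 * (2 * p + 3) / (2 * p + 1)"
    define m where "m = 1 / (2 * p + 1 - ?n)"
    define t where "t = trace (\<sigma> ** v)"
    have J: "?J v = k *\<^sub>R quad_rep \<sigma> v + (k * m * t) *\<^sub>R \<sigma>"
      by (simp add: k_def m_def t_def tensor_sq_def scaleR_add_right)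
    have "?I (?J v) = (1 / (2 * (2 * p + 3))) *\<^sub>R ((2 * p + 1) *\<^sub>R (k *\<^sub>R v + (k * m * t) *\<^sub>R w) - (k * t + k * m * t * ?n) *\<^sub>R w)"
      unfolding I[OF symJ[OF that]] unfolding J qr ts using comp[OF w(3,2)] by (simp add: t_def)
    \<comment> \<open>The coefficient of \<open>w\<close> contains m (2p + 1 - n) - 1, where n is
      tr(w \<sigma>); it vanishes by the choice of \<open>m\<close>, and \<open>k\<close> normalises
      the coefficient of \<open>v\<close>.\<close>
    also have "\<dots> = (1 / (2 * (2 * p + 3)) * (2 * p + 1) * k) *\<^sub>R v
        + (1 / (2 * (2 * p + 3)) * k * t * (m * (2 * p + 1 - ?n) - 1)) *\<^sub>R w"
    proof -
      have "j *\<^sub>R (c *\<^sub>R (k *\<^sub>R v + (k * m * t) *\<^sub>R w) - (k * t + k * m * t * l) *\<^sub>R w) =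
        (j * c * k) *\<^sub>R v + (j * k * t * (m * (c - l) - 1)) *\<^sub>R w" for j c l :: real
        by (simp add: algebra_simps)
      then show ?thesis .
    qed
    also have "1 / (2 * (2 * p + 3)) * (2 * p + 1) * k = 1" using nz by (simp add: k_def)
    also have "m * (2 * p + 1 - ?n) = 1" using nz by (simp add: m_def)
    finally show ?thesis by simp
  qed
  have JI: "?J (?I v) = v" if "v \<in> sym_mats" for v
  proof -
    define k where "k = 2 * (2 * p + 3) / (2 * p + 1)"
    define m where "m = 1 / (2 * p + 1 - ?n)"
    define j where "j = 1 / (2 * (2 * p + 3))"
    define t where "t = trace (w ** v)"
    have Iv: "?I v = (j * (2 * p + 1)) *\<^sub>R quad_rep w v + (- j * t) *\<^sub>R w"
      unfolding I[OF that] by (simp add: j_def t_def tensor_sq_def scaleR_diff_right)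
    have "?J (?I v) = k *\<^sub>R ((j * (2 * p + 1)) *\<^sub>R v + (- j * t) *\<^sub>R \<sigma> + m *\<^sub>R (j * (2 * p + 1) * t + (- j * t) * ?n) *\<^sub>R \<sigma>)"
      unfolding Iv qr ts using comp[OF w(2,3)] by (simp add: t_def k_def m_def)
    also have "\<dots> = (k * j * (2 * p + 1)) *\<^sub>R v + (k * j * t * (m * (2 * p + 1 - ?n) - 1)) *\<^sub>R \<sigma>"
    proof -
      have "k *\<^sub>R ((j * c) *\<^sub>R v + (- j * t) *\<^sub>R \<sigma> + m *\<^sub>R (j * c * t + (- j * t) * l) *\<^sub>R \<sigma>) =
        (k * j * c) *\<^sub>R v + (k * j * t * (m * (c - l) - 1)) *\<^sub>R \<sigma>" for c l :: real
        by (simp add: algebra_simps)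
      then show ?thesis .
    qed
    also have "k * j * (2 * p + 1) = 1" using nz by (simp add: k_def j_def)
    also have "m * (2 * p + 1 - ?n) = 1" using nz by (simp add: m_def)
    finally show ?thesis by simp
  qed
  have bij: "bij_betw ?I sym_mats sym_mats"
    by (rule bij_betw_byWitness[where f' = ?J]) (use IJ JI symI symJ in auto)
  moreover have "inv_into sym_mats ?I v = ?J v" if "v \<in> sym_mats" for v
    using bij that symJ[OF that] IJ[OF that] by (intro inv_into_f_eq) (auto simp: bij_betw_def)
  ultimately show ?thesis by blast
qed

end
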